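(* Let $\rho\in(-1,1)$ and let $c_1,c_2$ be two given real constants. For any $L>0$ we have: i) If $a\in(\rho,1]$, then as $u\to\infty$ $$\Psi_L(u,au)\sim K_{a,\rho}(L)\,\mathbb{P}\{W_1^*(1)>u,\ W_2^*(1)>au\},$$ where the constant $K_{a,\rho}(L)\in(0,\infty)$ is given by $$K_{a,\rho}(L)=\lambda_1\lambda_2\int_{\mathbb{R}^2}\mathbb{P}\left\{\int_0^\infty\mathbb{I}(W_1(t)-t>x,\ W_2(t)-at>y)\,dt>L\right\}e^{\lambda_1x+\lambda_2y}\,dx\,dy .$$ ii) If $a\le\rho$, then as $u\to\infty$ $$\Psi_L(u,au)\sim K(L)\,\mathbb{P}\{W_1^*(1)>u,\ W_2^*(1)>au\},$$ where $$K(L)=\int_{\mathbb{R}}e^x\,\mathbb{P}\left\{\int_0^\infty\mathbb{I}(W_1(t)-t>x)\,dt>L\right\}dx\in(0,\infty).$$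
   Context: Let $B_1,B_2$ be two independent standard Brownian motions and, for $\rho\in(-1,1)$, let $(W_1(t),W_2(t))$, $t\ge0$, be jointly Gaussian with the same law as $(B_1(t),\ \rho B_1(t)+\sqrt{1-\rho^2}\,B_2(t))$, $t\ge 0$. For real $c_1,c_2$, $u>0$ and real $a\le 1$, the risk processes are $R_1(t)=u+c_1t-W_1(t)$ and $R_2(t)=au+c_2t-W_2(t)$, $t\ge0$. Put $W_i^*(t)=W_i(t)-c_it$, $i=1,2$. $\mathbb{I}(\cdot)$ denotes the indicator function. The cumulative Parisian ruin probability on $[0,1]$ (with scaling function $u^2$) is $$\Psi_L(u,au)=\mathbb{P}\left\{\int_0^1\mathbb{I}(R_1(t)<0,\ R_2(t)<0)\,dt>L/u^2\right\}.$$ Further $\lambda_1=\dfrac{1-a\rho}{1-\rho^2}$ and $\lambda_2=\dfrac{a-\rho}{1-\rho^2}$. The notation $f(u)\sim g(u)$ as $u\to\infty$ means $f(u)/g(u)\to1$. *)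

theory Defs
  imports "HOL-Probability.Probability"
begin

text \<open>
  Processes are functions \<open>real \<Rightarrow> 'w \<Rightarrow> real\<close> of which only the times \<open>t \<ge> 0\<close> matter.
  Paths are continuous surely, not only almost surely: on an incomplete probability space the
  occupation-time events below could otherwise fail to be measurable, and
  \<^term>\<open>measure M A\<close> is 0 for non-measurable \<open>A\<close>.
\<close>

definition continuous_process :: "'w measure \<Rightarrow> (real \<Rightarrow> 'w \<Rightarrow> real) \<Rightarrow> bool" where
  "continuous_process M X \<longleftrightarrow>
     (\<forall>t\<ge>0. X t \<in> borel_measurable M) \<and>
     (\<forall>\<omega>\<in>space M. continuous_on {0..} (\<lambda>t. X t \<omega>))"

definition standard_brownian_motion :: "'w measure \<Rightarrow> (real \<Rightarrow> 'w \<Rightarrow> real) \<Rightarrow> bool" where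
  "standard_brownian_motion M B \<longleftrightarrow>
     prob_space M \<and> continuous_process M B \<and>
     (AE \<omega> in M. B 0 \<omega> = 0) \<and>
     (\<forall>\<tau>::nat \<Rightarrow> real. 0 \<le> \<tau> 0 \<and> incseq \<tau> \<longrightarrow>
        prob_space.indep_vars M (\<lambda>_. borel) (\<lambda>i \<omega>. B (\<tau> (Suc i)) \<omega> - B (\<tau> i) \<omega>) UNIV) \<and>
     (\<forall>s t. 0 \<le> s \<and> s < t \<longrightarrow>
        distributed M lborel (\<lambda>\<omega>. B t \<omega> - B s \<omega>) (normal_density 0 (sqrt (t - s))))"

text \<open>Independence of the whole processes, as random elements of the path space.\<close>

definition indep_processes ::
    "'w measure \<Rightarrow> (real \<Rightarrow> 'w \<Rightarrow> real) \<Rightarrow> (real \<Rightarrow> 'w \<Rightarrow> real) \<Rightarrow> bool" where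
  "indep_processes M X Y \<longleftrightarrow>
     prob_space.indep_var M
       (Pi\<^sub>M {0..} (\<lambda>_. borel)) (\<lambda>\<omega>. \<lambda>t\<in>{0..}. X t \<omega>)
       (Pi\<^sub>M {0..} (\<lambda>_. borel)) (\<lambda>\<omega>. \<lambda>t\<in>{0..}. Y t \<omega>)"

definition pair_process_law ::
    "'w measure \<Rightarrow> (real \<Rightarrow> 'w \<Rightarrow> real) \<Rightarrow> (real \<Rightarrow> 'w \<Rightarrow> real) \<Rightarrow> (real \<Rightarrow> real \<times> real) measure" where
  "pair_process_law M X Y =
     distr M (Pi\<^sub>M {0..} (\<lambda>_. borel)) (\<lambda>\<omega>. \<lambda>t\<in>{0..}. (X t \<omega>, Y t \<omega>))"

definition risk_process :: "real \<Rightarrow> real \<Rightarrow> (real \<Rightarrow> 'w \<Rightarrow> real) \<Rightarrow> real \<Rightarrow> 'w \<Rightarrow> real" where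
  "risk_process v c W t \<omega> = v + c * t - W t \<omega>"

definition drifted :: "real \<Rightarrow> (real \<Rightarrow> 'w \<Rightarrow> real) \<Rightarrow> real \<Rightarrow> 'w \<Rightarrow> real" where
  "drifted c W t \<omega> = W t \<omega> - c * t"

definition cumulative_parisian_ruin_prob ::
    "'w measure \<Rightarrow> (real \<Rightarrow> 'w \<Rightarrow> real) \<Rightarrow> (real \<Rightarrow> 'w \<Rightarrow> real) \<Rightarrow>
     real \<Rightarrow> real \<Rightarrow> real \<Rightarrow> real \<Rightarrow> real \<Rightarrow> real" where
  "cumulative_parisian_ruin_prob M W1 W2 c1 c2 L u v =
     measure M {\<omega>\<in>space M.
       (\<integral>\<^sup>+t\<in>{0..1}. indicator {t. risk_process u c1 W1 t \<omega> < 0 \<and> risk_process v c2 W2 t \<omega> < 0} t \<partial>lborel)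
         > ennreal (L / u\<^sup>2)}"

definition terminal_exceedance_prob ::
    "'w measure \<Rightarrow> (real \<Rightarrow> 'w \<Rightarrow> real) \<Rightarrow> (real \<Rightarrow> 'w \<Rightarrow> real) \<Rightarrow>
     real \<Rightarrow> real \<Rightarrow> real \<Rightarrow> real \<Rightarrow> real" where
  "terminal_exceedance_prob M W1 W2 c1 c2 u v =
     measure M {\<omega>\<in>space M. drifted c1 W1 1 \<omega> > u \<and> drifted c2 W2 1 \<omega> > v}"

definition lambda1 :: "real \<Rightarrow> real \<Rightarrow> real" where
  "lambda1 a \<rho> = (1 - a * \<rho>) / (1 - \<rho>\<^sup>2)"

definition lambda2 :: "real \<Rightarrow> real \<Rightarrow> real" where
  "lambda2 a \<rho> = (a - \<rho>) / (1 - \<rho>\<^sup>2)"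

text \<open>
  The constants are \<^typ>\<open>ennreal\<close>-valued, so that their finiteness is a genuine assertion.
  The factor \<open>\<lambda>\<^sub>1 \<lambda>\<^sub>2\<close> is positive for \<open>\<bar>\<rho>\<bar> < 1\<close> and \<open>\<rho> < a \<le> 1\<close>, the only case in which
  \<open>parisian_const2\<close> is meant to be used, so \<^term>\<open>ennreal\<close> does not truncate it.
\<close>

definition parisian_const2 ::
    "'w measure \<Rightarrow> (real \<Rightarrow> 'w \<Rightarrow> real) \<Rightarrow> (real \<Rightarrow> 'w \<Rightarrow> real) \<Rightarrow>
     real \<Rightarrow> real \<Rightarrow> real \<Rightarrow> ennreal" where
  "parisian_const2 M W1 W2 a \<rho> L =
     ennreal (lambda1 a \<rho> * lambda2 a \<rho>) *
     (\<integral>\<^sup>+(x, y). ennreal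
        (measure M {\<omega>\<in>space M.
           (\<integral>\<^sup>+t\<in>{0..}. indicator {t. W1 t \<omega> - t > x \<and> W2 t \<omega> - a * t > y} t \<partial>lborel) > ennreal L}
         * exp (lambda1 a \<rho> * x + lambda2 a \<rho> * y))
      \<partial>(lborel :: (real \<times> real) measure))"

definition parisian_const1 :: "'w measure \<Rightarrow> (real \<Rightarrow> 'w \<Rightarrow> real) \<Rightarrow> real \<Rightarrow> ennreal" where
  "parisian_const1 M W L =
     (\<integral>\<^sup>+x. ennreal
        (exp x * measure M {\<omega>\<in>space M.
           (\<integral>\<^sup>+t\<in>{0..}. indicator {t. W t \<omega> - t > x} t \<partial>lborel) > ennreal L})
      \<partial>(lborel :: real measure))"

end

theory Submission
  imports Defs
begin

text \<open>
  Put \<open>T = u\<^sup>2\<close>. Ruin is decided in a time window of length of order \<open>1 / T\<close> before time 1, and the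
  proof describes this window exactly before passing to the limit. Reversing time from 1 and rescaling,
  \<open>V s = u (B (1 - s / T) - B 1)\<close> is a Brownian motion on \<open>[0, T]\<close>. Conditioning on its end point
  splits it into a Brownian bridge and an independent Gaussian slope. When the end point of the
  drifted pair is written as \<open>(u + x / u, a u + y / u)\<close>, the drifts \<open>c1\<close>, \<open>c2\<close> cancel: terminal
  exceedance becomes \<open>x > 0, y > 0\<close>, and cumulative ruin becomes the event that the bridge pair
  satisfies \<open>x - s - s x / T + br1 s > 0\<close> and \<open>y - a s - s y / T + \<rho> br1 s + \<kappa> br2 s > 0\<close>, with
  \<open>\<kappa>\<^sup>2 = 1 - \<rho>\<^sup>2\<close>, during more than \<open>L\<close> time units. Hence both probabilities are integrals over
  \<open>(x, y)\<close> against the same Gaussian density (\<open>ruin_prob_disintegration\<close>, \<open>terminal_prob_disintegration\<close>). After division by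
  a common factor this density tends to \<open>exp (- \<lambda>\<^sub>1 x - \<lambda>\<^sub>2 y)\<close>, the bridge tends to Brownian motion,
  and the ratio of the two integrals tends to the constant of the first case.

  If \<open>a \<le> \<rho>\<close>, the second coordinate fluctuates around its conditional mean on scale 1 and not on scale
  \<open>1 / u\<close>. In the limit the second constraint then either holds during the whole window or fails during
  the whole window, so that its probability is a factor common to numerator and denominator, and the
  one-dimensional constant remains.

  The disintegration along the bridge (\<open>brownian_bridge_disintegration\<close>) follows from the
  Cameron-Martin formula by integrating over all drifts: adding a drift does not change the bridge,
  and Lebesgue measure on the drifts is invariant under the shift by the random slope. The
  Cameron-Martin formula itself compares independent Gaussian increments on finite time grids; with
  drift 0 it says that all Brownian motions have the same law, which accounts for the replacement of
  \<open>V\<close> by \<open>B\<close>.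

  The limit is dominated convergence in \<open>(x, y)\<close>.
    \<^item> Domination uses single times only. By Markov's inequality the probability that the
      occupation time exceeds \<open>L\<close> is at most its mean divided by \<open>L\<close>, and exponential moments at fixed
      times bound the mean by a multiple of \<open>exp (\<theta>\<^sub>1 x + \<theta>\<^sub>2 y)\<close> for every \<open>\<theta> \<ge> 0\<close> with positive
      \<open>drift_gap\<close> (\<open>exceed_prob_bound\<close>). If \<open>\<rho> < a \<le> 1\<close>, then \<open>\<lambda>\<close> lies in the interior of this set, so that
      \<open>\<theta>\<close> may be any of the four points \<open>(\<lambda>\<^sub>1 \<plusminus> \<epsilon>, \<lambda>\<^sub>2 \<plusminus> \<epsilon>)\<close>, which turns the weight \<open>exp (- \<lambda>\<^sub>1 x - \<lambda>\<^sub>2 y)\<close> into an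
      integrable \<open>exp (- \<epsilon> (\<bar>x\<bar> + \<bar>y\<bar>))\<close>.
    \<^item> For fixed \<open>(x, y)\<close> the occupation times converge in \<open>L\<^sup>1\<close>, because the events at each fixed time
      converge (\<open>occupation_prob_tendsto\<close>). The probability of exceeding \<open>L\<close> converges with them
      unless the limiting occupation time equals \<open>L\<close> with positive probability. That happens only on
      a null set of \<open>(x, y)\<close>: a continuous path spends time exactly \<open>L\<close> above at most one level
      (\<open>occupation_level_unique\<close>).
\<close>

section \<open>Occupation functionals on path space\<close>

definition dyadic_floor :: "nat \<Rightarrow> real \<Rightarrow> real" where
  "dyadic_floor n t = of_int \<lfloor>2^n * t\<rfloor> / 2^n"

text \<open>
  A path is read off from its values at the countably many dyadic times, so that evaluation at all
  times is jointly measurable for the product \<open>\<sigma>\<close>-algebra on path space. On continuous paths this is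
  ordinary evaluation.
\<close>

definition path_eval :: "(real \<Rightarrow> 'e) \<Rightarrow> real \<Rightarrow> 'e::t2_space" where
  "path_eval w t = lim (\<lambda>n. w (dyadic_floor n t))"

lemma dyadic_floor_bounds:
  assumes "0 \<le> t" shows "0 \<le> dyadic_floor n t" "dyadic_floor n t \<le> t"
  using assms by (auto simp: dyadic_floor_def field_simps)

lemma dyadic_floor_tendsto: "(\<lambda>n. dyadic_floor n t) \<longlonglongrightarrow> t"
proof (rule tendsto_sandwich)
  show "(\<lambda>n. t - 1 / 2^n) \<longlonglongrightarrow> t" by real_asymp
  show "\<forall>\<^sub>F n in sequentially. t - 1 / 2^n \<le> dyadic_floor n t"
  proof (intro always_eventually allI)
    fix n show "t - 1 / 2^n \<le> dyadic_floor n t"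
    proof -
      have "(2^n * t - 1) / 2^n \<le> real_of_int \<lfloor>2^n * t\<rfloor> / 2^n"
        by (intro divide_right_mono) (linarith, simp)
      then show ?thesis by (simp add: dyadic_floor_def diff_divide_distrib)
    qed
  qed
  show "\<forall>\<^sub>F n in sequentially. dyadic_floor n t \<le> t"
    unfolding dyadic_floor_def by (intro always_eventually allI) (simp add: field_simps)
qed simp

lemma path_eval_continuous:
  fixes w :: "real \<Rightarrow> 'e::t2_space"
  assumes "continuous_on I w" "t \<in> I" "\<And>n. dyadic_floor n t \<in> I"
  shows "path_eval w t = w t"
  unfolding path_eval_def
  by (rule limI, rule continuous_on_tendsto_compose[OF assms(1) dyadic_floor_tendsto])
     (use assms in auto)

text \<open>
  Each dyadic approximation reads one of countably many coordinates, selected by the measurable index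
  \<open>\<lfloor>2\<^sup>n t\<rfloor>\<close>. Coordinates outside the index set \<open>I\<close> are constant on the space of the product.
\<close>

lemma measurable_path_eval:
  fixes I :: "real set"
  shows "(\<lambda>z. path_eval (fst z) (snd z) :: 'e::{banach, second_countable_topology})
           \<in> borel_measurable (Pi\<^sub>M I (\<lambda>_. borel) \<Otimes>\<^sub>M borel)"
proof -
  let ?M = "Pi\<^sub>M I (\<lambda>_. borel :: 'e measure) \<Otimes>\<^sub>M (borel :: real measure)"
  have c: "(\<lambda>z. fst z (of_int k / 2^n)) \<in> borel_measurable ?M" for k n
  proof (cases "of_int k / 2^n \<in> I")
    case True
    then show ?thesis by measurable
  next
    case False
    have "(\<lambda>z. undefined) \<in> borel_measurable ?M" by simp
    then show ?thesis
      by (rule measurable_cong[THEN iffD1, rotated])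
         (use False in \<open>auto simp: space_pair_measure space_PiM PiE_def extensional_def\<close>)
  qed
  have "(\<lambda>z. fst z (dyadic_floor n (snd z))) \<in> borel_measurable ?M" for n
    unfolding dyadic_floor_def
    by (rule measurable_compose_countable[OF c, of "\<lambda>z. \<lfloor>2^n * snd z\<rfloor>"]) measurable
  then show ?thesis unfolding path_eval_def by measurable
qed

text \<open>
  The time in \<open>S\<close> that the path spends in the set \<open>H\<close>, which may depend on the time and on the value
  of the path at one reference time \<open>r\<close>.
\<close>

definition occupation :: "real set \<Rightarrow> (real \<times> 'e \<times> 'e) set \<Rightarrow> real \<Rightarrow> (real \<Rightarrow> 'e::t2_space) \<Rightarrow> ennreal" where
  "occupation S H r w = (\<integral>\<^sup>+s. indicator S s * indicator H (s, path_eval w s, w r) \<partial>lborel)"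

lemma measurable_occupation:
  fixes H :: "(real \<times> 'e::{banach, second_countable_topology} \<times> 'e) set" and I :: "real set"
  assumes [measurable]: "S \<in> sets borel"
    and H[measurable]: "H \<in> sets (borel \<Otimes>\<^sub>M borel \<Otimes>\<^sub>M (borel :: 'e measure))"
    and r: "r \<in> I"
  shows "occupation S H r \<in> borel_measurable (Pi\<^sub>M I (\<lambda>_. borel))"
proof -
  note measurable_path_eval[of I, measurable]
  have [measurable]: "(\<lambda>w. w r) \<in> Pi\<^sub>M I (\<lambda>_. borel :: 'e measure) \<rightarrow>\<^sub>M borel" using r by simp
  have "(\<lambda>z. (snd z, path_eval (fst z) (snd z), fst z r)) \<in>
     Pi\<^sub>M I (\<lambda>_. borel) \<Otimes>\<^sub>M lborel \<rightarrow>\<^sub>M borel \<Otimes>\<^sub>M borel \<Otimes>\<^sub>M (borel :: 'e measure)"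
    by measurable
  then have [measurable]: "(\<lambda>(w, s). (s, path_eval w s, w r)) \<in>
     Pi\<^sub>M I (\<lambda>_. borel) \<Otimes>\<^sub>M lborel \<rightarrow>\<^sub>M borel \<Otimes>\<^sub>M borel \<Otimes>\<^sub>M (borel :: 'e measure)"
    by (simp add: case_prod_beta')
  show ?thesis unfolding occupation_def by measurable
qed

lemma occupation_continuous_path:
  fixes g :: "real \<Rightarrow> 'e::t2_space"
  assumes g: "continuous_on I g" and r: "r \<in> I"
    and S: "\<And>s. s \<in> S \<Longrightarrow> s \<in> I \<and> {0..s} \<subseteq> I \<and> 0 \<le> s"
  shows "occupation S H r (\<lambda>s\<in>I. g s) = (\<integral>\<^sup>+s. indicator S s * indicator H (s, g s, g r) \<partial>lborel)"
  unfolding occupation_def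
proof (rule nn_integral_cong)
  fix s
  have "path_eval (\<lambda>s\<in>I. g s) s = g s" if "s \<in> S"
  proof -
    have "dyadic_floor n s \<in> I" for n
      using S[OF that] dyadic_floor_bounds[of s n] by auto
    moreover have "continuous_on I (\<lambda>s\<in>I. g s)"
      using g by (rule continuous_on_eq) simp
    ultimately show ?thesis using path_eval_continuous[of I "\<lambda>s\<in>I. g s" s] S[OF that] by simp
  qed
  then show "indicator S s * indicator H (s, path_eval (\<lambda>s\<in>I. g s) s, (\<lambda>s\<in>I. g s) r) =
      (indicator S s * indicator H (s, g s, g r) :: ennreal)"
    using r by (cases "s \<in> S") simp_all
qed

section \<open>The Cameron-Martin formula\<close>

text \<open>
  Brownian motion on \<open>[0, T]\<close>, described by the joint law of its increments on finite grids. The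
  product formula for emeasure contains both independence and the Gaussian marginals, and it is
  stable under reversing the order of the increments.
\<close>

definition brownian_increments_on :: "real \<Rightarrow> 'w measure \<Rightarrow> (real \<Rightarrow> 'w \<Rightarrow> real) \<Rightarrow> bool" where
  "brownian_increments_on T M X \<longleftrightarrow>
     (\<forall>t\<in>{0..T}. X t \<in> borel_measurable M) \<and> (AE \<omega> in M. X 0 \<omega> = 0) \<and>
     (\<forall>(n::nat) \<tau> A. 0 \<le> \<tau> 0 \<and> (\<forall>i<n. \<tau> i < \<tau> (Suc i)) \<and> \<tau> n \<le> T \<and> (\<forall>i<n. A i \<in> sets borel) \<longrightarrow>
        emeasure M {\<omega>\<in>space M. \<forall>i<n. X (\<tau> (Suc i)) \<omega> - X (\<tau> i) \<omega> \<in> A i} =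
        (\<Prod>i<n. emeasure (density lborel (normal_density 0 (sqrt (\<tau> (Suc i) - \<tau> i)))) (A i)))"

lemma brownian_increments_onD:
  assumes "brownian_increments_on T M X" "0 \<le> \<tau> 0" "\<And>i. i < n \<Longrightarrow> \<tau> i < \<tau> (Suc i)" "\<tau> n \<le> T"
    "\<And>i. i < n \<Longrightarrow> A i \<in> sets borel"
  shows "emeasure M {\<omega>\<in>space M. \<forall>i<n. X (\<tau> (Suc i)) \<omega> - X (\<tau> i) \<omega> \<in> A i} =
        (\<Prod>i<n. emeasure (density lborel (normal_density 0 (sqrt (\<tau> (Suc i) - \<tau> i)))) (A i))"
  using assms(1)[unfolded brownian_increments_on_def, THEN conjunct2, THEN conjunct2, rule_format, of \<tau> n A]
    assms(2-5) by simp

lemma emeasure_normal_density_shift: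
  assumes [measurable]: "A \<in> sets borel"
  shows "emeasure (density lborel (normal_density 0 s)) {x. x + m \<in> A} =
         emeasure (density lborel (normal_density m s)) A"
proof -
  have "emeasure (density lborel (normal_density m s)) A = (\<integral>\<^sup>+x. ennreal (normal_density m s x) * indicator A x \<partial>lborel)"
    by (simp add: emeasure_density)
  also have "\<dots> = (\<integral>\<^sup>+x. ennreal (normal_density m s (m + 1 * x)) * indicator A (m + 1 * x) \<partial>lborel)"
    by (subst nn_integral_real_affine[where c=1 and t=m]) auto
  also have "\<dots> = emeasure (density lborel (normal_density 0 s)) {x. x + m \<in> A}"
    by (subst emeasure_density)
       (auto intro!: nn_integral_cong simp: normal_density_def add.commute split: split_indicator)
  finally show ?thesis by simp
qed

lemma normal_density_tilt:
  assumes "0 < d"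
  shows "normal_density (\<mu> * d) (sqrt d) x = normal_density 0 (sqrt d) x * exp (\<mu> * x - \<mu>\<^sup>2 * d / 2)"
  using assms by (simp add: normal_density_def exp_add[symmetric] field_simps power2_eq_square)

lemma brownian_increments_law:
  assumes X: "brownian_increments_on T M X"
    and \<tau>: "0 \<le> \<tau> 0" "\<And>i. i < n \<Longrightarrow> \<tau> i < \<tau> (Suc i)" "\<tau> n \<le> T"
  shows "distr M (Pi\<^sub>M {..<n} (\<lambda>_. borel))
           (\<lambda>\<omega>. \<lambda>i\<in>{..<n}. X (\<tau> (Suc i)) \<omega> - X (\<tau> i) \<omega> + \<mu> * (\<tau> (Suc i) - \<tau> i)) =
         Pi\<^sub>M {..<n} (\<lambda>i. density lborel (normal_density (\<mu> * (\<tau> (Suc i) - \<tau> i)) (sqrt (\<tau> (Suc i) - \<tau> i))))"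
    (is "?L = Pi\<^sub>M _ ?D")
proof -
  have mono: "\<tau> i \<le> \<tau> j" if "i \<le> j" "j \<le> n" for i j
    using that
  proof (induction j rule: dec_induct)
    case (step k) then show ?case using \<tau>(2)[of k] by auto
  qed auto
  have X_meas[measurable]: "X (\<tau> i) \<in> borel_measurable M" if "i \<le> n" for i
    using X mono[of 0 i] mono[of i n] that \<tau> by (auto simp: brownian_increments_on_def)
  define D where "D i = (if i < n then ?D i else return borel 0)" for i
  have D_sets: "sets (D i) = sets borel" for i by (simp add: D_def)
  interpret D: product_sigma_finite D
  proof (rule product_sigma_finite.intro)
    fix i show "sigma_finite_measure (D i)"
    proof (cases "i < n")
      case True
      then interpret prob_space "?D i" using \<tau>(2)[of i] by (intro prob_space_normal_density) simp
      show ?thesis using True by (simp add: D_def, unfold_locales)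
    next
      case False
      interpret prob_space "return borel (0::real)" by (rule prob_space_return) simp
      show ?thesis using False by (simp add: D_def, unfold_locales)
    qed
  qed
  have "?L = Pi\<^sub>M {..<n} D"
  proof (rule D.PiM_eqI)
    show "sets ?L = sets (Pi\<^sub>M {..<n} D)" by (simp add: D_sets cong: sets_PiM_cong)
    fix A assume A: "\<And>i. i \<in> {..<n} \<Longrightarrow> A i \<in> sets (D i)"
    then have A'[measurable]: "A i \<in> sets borel" if "i < n" for i using that D_sets by auto
    have PE: "Pi\<^sub>E {..<n} A \<in> sets (Pi\<^sub>M {..<n} (\<lambda>_. borel))" by (intro sets_PiM_I_finite) auto
    let ?f = "\<lambda>\<omega>. \<lambda>i\<in>{..<n}. X (\<tau> (Suc i)) \<omega> - X (\<tau> i) \<omega> + \<mu> * (\<tau> (Suc i) - \<tau> i)"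
    have f: "?f \<in> M \<rightarrow>\<^sub>M Pi\<^sub>M {..<n} (\<lambda>_. borel)"
    proof (rule measurable_restrict)
      fix i assume "i \<in> {..<n}"
      then have [measurable]: "X (\<tau> (Suc i)) \<in> borel_measurable M" "X (\<tau> i) \<in> borel_measurable M"
        by (auto intro!: X_meas)
      show "(\<lambda>\<omega>. X (\<tau> (Suc i)) \<omega> - X (\<tau> i) \<omega> + \<mu> * (\<tau> (Suc i) - \<tau> i)) \<in> borel_measurable M" by measurable
    qed
    have "emeasure ?L (Pi\<^sub>E {..<n} A) = emeasure M (?f -` (Pi\<^sub>E {..<n} A) \<inter> space M)"
      by (rule emeasure_distr[OF f PE])
    also have "?f -` (Pi\<^sub>E {..<n} A) \<inter> space M =
      {\<omega>\<in>space M. \<forall>i<n. X (\<tau> (Suc i)) \<omega> - X (\<tau> i) \<omega> \<in> {x. x + \<mu> * (\<tau> (Suc i) - \<tau> i) \<in> A i}}"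
      by (rule set_eqI) (simp add: PiE_iff Ball_def conj_commute)
    also have "emeasure M \<dots> = (\<Prod>i<n. emeasure (density lborel (normal_density 0 (sqrt (\<tau> (Suc i) - \<tau> i))))
         {x. x + \<mu> * (\<tau> (Suc i) - \<tau> i) \<in> A i})"
    proof -
      have "{x. x + \<mu> * (\<tau> (Suc i) - \<tau> i) \<in> A i} \<in> sets borel" if "i < n" for i
      proof -
        have [measurable]: "A i \<in> sets borel" by (rule A'[OF that])
        have "(\<lambda>x. x + \<mu> * (\<tau> (Suc i) - \<tau> i)) -` A i \<inter> space borel \<in> sets borel"
          by (rule measurable_sets) measurable
        then show ?thesis by (simp add: vimage_def)
      qed
      then show ?thesis by (intro brownian_increments_onD[OF X]) (use \<tau> in simp_all)
    qed
    also have "\<dots> = (\<Prod>i\<in>{..<n}. emeasure (D i) (A i))"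
      by (intro prod.cong refl, subst emeasure_normal_density_shift) (auto simp: D_def)
    finally show "emeasure ?L (Pi\<^sub>E {..<n} A) = (\<Prod>i\<in>{..<n}. emeasure (D i) (A i))" .
  qed simp
  also have "\<dots> = Pi\<^sub>M {..<n} ?D" by (rule PiM_cong) (auto simp: D_def)
  finally show ?thesis .
qed

text \<open>
  The exponential tilt of independent centred Gaussian increments factorises and shifts each mean by
  \<open>\<mu>\<close> times the variance. This is the Cameron-Martin formula on a finite grid.
\<close>

lemma normal_product_tilt:
  fixes d :: "nat \<Rightarrow> real"
  assumes d: "\<And>i. i < n \<Longrightarrow> 0 < d i"
  shows "density (Pi\<^sub>M {..<n} (\<lambda>i. density lborel (normal_density 0 (sqrt (d i)))))
           (\<lambda>x. \<Prod>i<n. ennreal (exp (\<mu> * x i - \<mu>\<^sup>2 * d i / 2))) =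
         Pi\<^sub>M {..<n} (\<lambda>i. density lborel (normal_density (\<mu> * d i) (sqrt (d i))))"
    (is "?L = Pi\<^sub>M _ ?D")
proof -
  define D where "D i = (if i < n then ?D i else return borel 0)" for i
  define D0 where "D0 i = (if i < n then density lborel (normal_density 0 (sqrt (d i))) else return borel 0)" for i
  have D_sets[simp, measurable_cong]: "sets (D i) = sets borel" "sets (D0 i) = sets borel" for i by (auto simp: D_def D0_def)
  have ps: "prob_space (D i)" "prob_space (D0 i)" for i
    using d by (auto simp: D_def D0_def intro!: prob_space_normal_density prob_space_return)
  interpret D: product_sigma_finite D
    by (rule product_sigma_finite.intro) (rule prob_space_imp_sigma_finite[OF ps(1)])
  interpret D0: product_sigma_finite D0
    by (rule product_sigma_finite.intro) (rule prob_space_imp_sigma_finite[OF ps(2)])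
  have e0: "Pi\<^sub>M {..<n} (\<lambda>i. density lborel (normal_density 0 (sqrt (d i)))) = Pi\<^sub>M {..<n} D0"
    by (rule PiM_cong) (auto simp: D0_def)
  let ?g = "\<lambda>i x. ennreal (exp (\<mu> * x - \<mu>\<^sup>2 * d i / 2))"
  have "density (Pi\<^sub>M {..<n} D0) (\<lambda>x. \<Prod>i<n. ?g i (x i)) = Pi\<^sub>M {..<n} D"
  proof (rule D.PiM_eqI)
    fix A assume "\<And>i. i \<in> {..<n} \<Longrightarrow> A i \<in> sets (D i)"
    then have A[measurable]: "A i \<in> sets borel" if "i < n" for i using that by auto
    have PE: "Pi\<^sub>E {..<n} A \<in> sets (Pi\<^sub>M {..<n} D0)" by (intro sets_PiM_I_finite) auto
    have "emeasure (density (Pi\<^sub>M {..<n} D0) (\<lambda>x. \<Prod>i<n. ?g i (x i))) (Pi\<^sub>E {..<n} A) =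
      (\<integral>\<^sup>+x. (\<Prod>i<n. ?g i (x i)) * indicator (Pi\<^sub>E {..<n} A) x \<partial>Pi\<^sub>M {..<n} D0)"
      by (subst emeasure_density[OF _ PE]) (auto intro!: borel_measurable_prod)
    also have "\<dots> = (\<integral>\<^sup>+x. (\<Prod>i<n. ?g i (x i) * indicator (A i) (x i)) \<partial>Pi\<^sub>M {..<n} D0)"
    proof (intro nn_integral_cong)
      fix x assume "x \<in> space (Pi\<^sub>M {..<n} D0)"
      then have "x \<in> extensional {..<n}" by (auto simp: space_PiM PiE_def)
      then have "(indicator (Pi\<^sub>E {..<n} A) x :: ennreal) = (\<Prod>i<n. indicator (A i) (x i))"
        by (cases "x \<in> Pi\<^sub>E {..<n} A") (auto simp: PiE_iff indicator_def intro!: prod.neutral)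
      then show "(\<Prod>i<n. ?g i (x i)) * indicator (Pi\<^sub>E {..<n} A) x = (\<Prod>i<n. ?g i (x i) * indicator (A i) (x i))"
        by (simp add: prod.distrib)
    qed
    also have "\<dots> = (\<Prod>i<n. \<integral>\<^sup>+x. ?g i x * indicator (A i) x \<partial>D0 i)"
      by (rule D0.product_nn_integral_prod) auto
    also have "\<dots> = (\<Prod>i<n. emeasure (D i) (A i))"
    proof (intro prod.cong refl)
      fix i assume "i \<in> {..<n}"
      then have i: "i < n" by simp
      have "(\<integral>\<^sup>+x. ?g i x * indicator (A i) x \<partial>D0 i) =
        (\<integral>\<^sup>+x. ennreal (normal_density 0 (sqrt (d i)) x) * (?g i x * indicator (A i) x) \<partial>lborel)"
        using i by (simp add: D0_def nn_integral_density)
      also have "\<dots> = (\<integral>\<^sup>+x. ennreal (normal_density (\<mu> * d i) (sqrt (d i)) x) * indicator (A i) x \<partial>lborel)"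
        by (intro nn_integral_cong)
           (simp add: normal_density_tilt[OF d[OF i]] ennreal_mult mult.assoc)
      also have "\<dots> = emeasure (D i) (A i)" using i by (simp add: D_def emeasure_density)
      finally show "(\<integral>\<^sup>+x. ?g i x * indicator (A i) x \<partial>D0 i) = emeasure (D i) (A i)" .
    qed
    finally show "emeasure (density (Pi\<^sub>M {..<n} D0) (\<lambda>x. \<Prod>i<n. ?g i (x i))) (Pi\<^sub>E {..<n} A) = (\<Prod>i\<in>{..<n}. emeasure (D i) (A i))" .
  qed (auto cong: sets_PiM_cong)
  also have "\<dots> = Pi\<^sub>M {..<n} ?D" by (rule PiM_cong) (auto simp: D_def)
  finally show ?thesis by (simp add: e0)
qed
lemma finite_time_grid:
  fixes J :: "real set"
  assumes J: "finite J" "J \<subseteq> {0..T}" and T: "0 < T"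
  obtains n :: nat and \<tau> :: "nat \<Rightarrow> real" and k where
    "\<tau> 0 = 0" "\<tau> n = T" "\<And>i. i < n \<Longrightarrow> \<tau> i < \<tau> (Suc i)" "\<And>j. j \<in> J \<Longrightarrow> k j \<le> n \<and> \<tau> (k j) = j"
proof -
  let ?K = "insert 0 (insert T J)"
  define xs where "xs = sorted_list_of_set ?K"
  have fin: "finite ?K" using J by simp
  have set: "set xs = ?K" and so: "sorted xs" and di: "distinct xs"
    unfolding xs_def by (rule set_sorted_list_of_set[OF fin], rule sorted_sorted_list_of_set, rule distinct_sorted_list_of_set)
  have ss: "sorted_wrt (<) xs" using so di by (simp add: strict_sorted_iff)
  define n where "n = length xs - 1"
  have len: "length xs = Suc n" using set unfolding n_def by (cases xs) auto
  have ex: "\<exists>i\<le>n. xs ! i = j" if "j \<in> ?K" for j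
    using that set len by (metis in_set_conv_nth less_Suc_eq_le)
  have mono: "xs ! i \<le> xs ! j" if "i \<le> j" "j \<le> n" for i j
    using so len that by (auto intro: sorted_nth_mono)
  have bounds: "0 \<le> xs ! i" "xs ! i \<le> T" if "i \<le> n" for i
  proof -
    have "xs ! i \<in> ?K" using that len set by (metis le_imp_less_Suc nth_mem)
    then show "0 \<le> xs ! i" "xs ! i \<le> T" using J T by auto
  qed
  obtain i0 where i0: "i0 \<le> n" "xs ! i0 = 0" using ex[of 0] by auto
  obtain iT where iT: "iT \<le> n" "xs ! iT = T" using ex[of T] by auto
  have "xs ! 0 = 0" using mono[of 0 i0] bounds[of 0] i0 by simp
  moreover have "xs ! n = T" using mono[of iT n] bounds[of n] iT by simp
  moreover have "xs ! i < xs ! Suc i" if "i < n" for i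
    using ss len that by (auto simp: sorted_wrt_iff_nth_less)
  moreover obtain k where "\<And>j. j \<in> J \<Longrightarrow> k j \<le> n \<and> xs ! (k j) = j"
    using ex by (metis insertCI)
  ultimately show ?thesis by (rule that)
qed

text \<open>
  Both sides are finite measures on path space, so cylinder events suffice. A cylinder event is a
  measurable event for the increments on a grid that contains its times together with 0 and \<open>T\<close>; the
  density \<open>exp (\<mu> Y\<^sub>T - \<mu>\<^sup>2 T / 2)\<close> is the product of the tilts of the increments. The two processes
  may live on different spaces, so that \<open>\<mu> = 0\<close> is uniqueness in law.
\<close>

lemma cameron_martin_distr:
  assumes ps: "prob_space M" "prob_space M'" and T: "0 < T"
    and X: "brownian_increments_on T M X" and Y: "brownian_increments_on T M' Y"
  shows "distr M (Pi\<^sub>M {0..T} (\<lambda>_. borel)) (\<lambda>\<omega>. \<lambda>s\<in>{0..T}. X s \<omega> + \<mu> * s) =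
         distr (density M' (\<lambda>\<omega>. ennreal (exp (\<mu> * Y T \<omega> - \<mu>\<^sup>2 * T / 2))))
           (Pi\<^sub>M {0..T} (\<lambda>_. borel)) (\<lambda>\<omega>. \<lambda>s\<in>{0..T}. Y s \<omega>)" (is "?L = ?R")
proof -
  interpret M: prob_space M by fact
  interpret M': prob_space M' by fact
  have Xm[measurable]: "X s \<in> borel_measurable M" if "s \<in> {0..T}" for s
    using X that unfolding brownian_increments_on_def by blast
  have Ym[measurable]: "Y s \<in> borel_measurable M'" if "s \<in> {0..T}" for s
    using Y that unfolding brownian_increments_on_def by blast
  have YT[measurable]: "Y T \<in> borel_measurable M'" using T by (intro Ym) simp
  have X0: "AE \<omega> in M. X 0 \<omega> = 0" and Y0: "AE \<omega> in M'. Y 0 \<omega> = 0"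
    using X Y unfolding brownian_increments_on_def by blast+
  have Xp: "(\<lambda>\<omega>. \<lambda>s\<in>{0..T}. X s \<omega> + \<mu> * s) \<in> M \<rightarrow>\<^sub>M Pi\<^sub>M {0..T} (\<lambda>_. borel)"
    by (intro measurable_restrict borel_measurable_add Xm) auto
  have Yp: "(\<lambda>\<omega>. \<lambda>s\<in>{0..T}. Y s \<omega>) \<in> M' \<rightarrow>\<^sub>M Pi\<^sub>M {0..T} (\<lambda>_. borel)"
    by (intro measurable_restrict Ym) auto
  show ?thesis
  proof (rule measure_eqI_PiM_infinite)
    show "sets ?L = sets (Pi\<^sub>M {0..T} (\<lambda>_. borel))" "sets ?R = sets (Pi\<^sub>M {0..T} (\<lambda>_. borel))" by simp_all
    show "finite_measure ?L" by (intro finite_measure.finite_measure_distr M.finite_measure_axioms Xp)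
    fix J :: "real set" and A :: "real \<Rightarrow> real set"
    assume J: "finite J" "J \<subseteq> {0..T}" and A: "\<And>j. j \<in> J \<Longrightarrow> A j \<in> sets borel"
    obtain n \<tau> k where \<tau>: "\<tau> 0 = 0" "\<tau> n = T" "\<And>i::nat. i < n \<Longrightarrow> \<tau> i < \<tau> (Suc i)"
        and k: "\<And>j. j \<in> J \<Longrightarrow> k j \<le> n \<and> \<tau> (k j) = j"
      using finite_time_grid[OF J T] by metis
    have mono: "\<tau> i \<le> \<tau> j" if "i \<le> j" "j \<le> n" for i j
      using that
    proof (induction j rule: dec_induct)
      case (step k) then show ?case using \<tau>(3)[of k] by auto
    qed auto
    have \<tau>I: "\<tau> i \<in> {0..T}" if "i \<le> n" for i using mono[of 0 i] mono[of i n] \<tau> that by simp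
    let ?P = "Pi\<^sub>M {..<n} (\<lambda>_. borel :: real measure)"
    \<comment> \<open>the cylinder event, expressed by partial sums of the increments\<close>
    define cyl where "cyl = {x\<in>space ?P. \<forall>j\<in>J. (\<Sum>i<k j. x i) \<in> A j}"
    have cyl: "cyl \<in> sets ?P"
    proof -
      have "{x\<in>space ?P. (\<Sum>i<k j. x i) \<in> A j} \<in> sets ?P" if "j \<in> J" for j
      proof -
        have "(\<lambda>x. \<Sum>i<k j. x i) \<in> borel_measurable ?P"
          using k[OF that] by (intro borel_measurable_sum measurable_component_singleton) auto
        from measurable_sets[OF this A[OF that]] show ?thesis
          by (simp add: vimage_def Int_def conj_commute)
      qed
      then show ?thesis unfolding cyl_def using J by (intro sets.sets_Collect_finite_All) auto
    qed
    let ?IX = "\<lambda>\<omega>. \<lambda>i\<in>{..<n}. X (\<tau> (Suc i)) \<omega> - X (\<tau> i) \<omega> + \<mu> * (\<tau> (Suc i) - \<tau> i)"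
    let ?IY = "\<lambda>\<omega>. \<lambda>i\<in>{..<n}. Y (\<tau> (Suc i)) \<omega> - Y (\<tau> i) \<omega>"
    have IX: "?IX \<in> M \<rightarrow>\<^sub>M ?P"
      by (intro measurable_restrict borel_measurable_add borel_measurable_diff Xm \<tau>I) auto
    have IY: "?IY \<in> M' \<rightarrow>\<^sub>M ?P"
      by (intro measurable_restrict borel_measurable_diff Ym \<tau>I) auto
    have telX: "(\<Sum>i<m. ?IX \<omega> i) = X (\<tau> m) \<omega> + \<mu> * \<tau> m" if "X 0 \<omega> = 0" "m \<le> n" for m \<omega>
      using that(2)
    proof (induction m)
      case 0 then show ?case using that \<tau> by simp
    next
      case (Suc m) then show ?case by (simp add: algebra_simps)
    qed
    have telY: "(\<Sum>i<m. ?IY \<omega> i) = Y (\<tau> m) \<omega>" if "Y 0 \<omega> = 0" "m \<le> n" for m \<omega>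
      using that(2)
    proof (induction m)
      case 0 then show ?case using that \<tau> by simp
    next
      case (Suc m) then show ?case by (simp add: algebra_simps)
    qed
    have sp: "?IX \<omega> \<in> space ?P" "?IY \<omega>' \<in> space ?P" for \<omega> \<omega>' by (auto simp: space_PiM)
    let ?E = "prod_emb {0..T} (\<lambda>_. borel) J (Pi\<^sub>E J A)"
    have E: "?E \<in> sets (Pi\<^sub>M {0..T} (\<lambda>_. borel))"
      using J A by (intro sets_PiM_I) auto
    have inE: "(\<lambda>s\<in>{0..T}. h s) \<in> ?E \<longleftrightarrow> (\<forall>j\<in>J. h j \<in> A j)" for h :: "real \<Rightarrow> real"
      using J by (auto simp: prod_emb_def PiE_iff restrict_def extensional_def subset_iff)
    have lawX: "distr M ?P ?IX = Pi\<^sub>M {..<n} (\<lambda>i. density lborel (normal_density (\<mu> * (\<tau> (Suc i) - \<tau> i)) (sqrt (\<tau> (Suc i) - \<tau> i))))"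
      by (rule brownian_increments_law[OF X]) (use \<tau> in auto)
    have lawY: "distr M' ?P ?IY = Pi\<^sub>M {..<n} (\<lambda>i. density lborel (normal_density 0 (sqrt (\<tau> (Suc i) - \<tau> i))))"
      using brownian_increments_law[OF Y, of \<tau> n 0] \<tau> by simp
    let ?g = "\<lambda>x. \<Prod>i<n. ennreal (exp (\<mu> * x i - \<mu>\<^sup>2 * (\<tau> (Suc i) - \<tau> i) / 2))"
    have g: "?g \<in> borel_measurable ?P"
    proof (rule borel_measurable_prod_ennreal)
      fix i assume "i \<in> {..<n}"
      then have [measurable]: "(\<lambda>x. x i) \<in> borel_measurable ?P" by (intro measurable_component_singleton)
      show "(\<lambda>x. ennreal (exp (\<mu> * x i - \<mu>\<^sup>2 * (\<tau> (Suc i) - \<tau> i) / 2))) \<in> borel_measurable ?P" by measurable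
    qed
    have gY: "?g (?IY \<omega>) = ennreal (exp (\<mu> * Y T \<omega> - \<mu>\<^sup>2 * T / 2))" if "Y 0 \<omega> = 0" for \<omega>
    proof -
      have "?g (?IY \<omega>) = ennreal (\<Prod>i<n. exp (\<mu> * ?IY \<omega> i - \<mu>\<^sup>2 * (\<tau> (Suc i) - \<tau> i) / 2))"
        by (rule prod_ennreal) simp
      also have "(\<Prod>i<n. exp (\<mu> * ?IY \<omega> i - \<mu>\<^sup>2 * (\<tau> (Suc i) - \<tau> i) / 2)) =
          exp (\<Sum>i<n. \<mu> * ?IY \<omega> i - \<mu>\<^sup>2 * (\<tau> (Suc i) - \<tau> i) / 2)"
        by (rule exp_sum[symmetric]) simp
      also have "(\<Sum>i<n. \<mu> * ?IY \<omega> i - \<mu>\<^sup>2 * (\<tau> (Suc i) - \<tau> i) / 2) =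
          \<mu> * (\<Sum>i<n. ?IY \<omega> i) - \<mu>\<^sup>2 * (\<Sum>i<n. \<tau> (Suc i) - \<tau> i) / 2"
        by (simp add: sum_subtractf sum_distrib_left sum_divide_distrib right_diff_distrib diff_divide_distrib)
      also have "(\<Sum>i<n. \<tau> (Suc i) - \<tau> i) = T" using \<tau> by (simp add: sum_lessThan_telescope)
      also have "(\<Sum>i<n. ?IY \<omega> i) = Y T \<omega>" using telY[OF that, of n] \<tau> by simp
      finally show ?thesis .
    qed
    have "emeasure ?L ?E = emeasure M ((\<lambda>\<omega>. \<lambda>s\<in>{0..T}. X s \<omega> + \<mu> * s) -` ?E \<inter> space M)"
      by (rule emeasure_distr[OF Xp E])
    also have "\<dots> = emeasure M (?IX -` cyl \<inter> space M)"
    proof (rule emeasure_eq_AE)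
      show "AE \<omega> in M. (\<omega> \<in> (\<lambda>\<omega>. \<lambda>s\<in>{0..T}. X s \<omega> + \<mu> * s) -` ?E \<inter> space M) = (\<omega> \<in> ?IX -` cyl \<inter> space M)"
        using X0
      proof (eventually_elim)
        fix \<omega> assume "X 0 \<omega> = 0"
        then have "(\<Sum>i<k j. ?IX \<omega> i) = X j \<omega> + \<mu> * j" if "j \<in> J" for j
          using telX[of \<omega> "k j"] k[OF that] by simp
        then have "(?IX \<omega> \<in> cyl) = (\<forall>j\<in>J. X j \<omega> + \<mu> * j \<in> A j)"
          unfolding cyl_def using sp by simp
        then show "(\<omega> \<in> (\<lambda>\<omega>. \<lambda>s\<in>{0..T}. X s \<omega> + \<mu> * s) -` ?E \<inter> space M) = (\<omega> \<in> ?IX -` cyl \<inter> space M)"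
          by (simp only: vimage_eq Int_iff inE)
      qed
    qed (intro measurable_sets[OF Xp E] measurable_sets[OF IX cyl])+
    also have "\<dots> = emeasure (distr M ?P ?IX) cyl" by (rule emeasure_distr[OF IX cyl, symmetric])
    also have "\<dots> = emeasure (density (distr M' ?P ?IY) ?g) cyl"
      unfolding lawX lawY by (subst normal_product_tilt) (use \<tau> in auto)
    also have "\<dots> = (\<integral>\<^sup>+x. ?g x * indicator cyl x \<partial>distr M' ?P ?IY)"
      by (rule emeasure_density) (use g cyl in simp_all)
    also have "\<dots> = (\<integral>\<^sup>+\<omega>. ?g (?IY \<omega>) * indicator cyl (?IY \<omega>) \<partial>M')"
      by (rule nn_integral_distr[OF IY]) (use g cyl in simp)
    also have "\<dots> = (\<integral>\<^sup>+\<omega>. ennreal (exp (\<mu> * Y T \<omega> - \<mu>\<^sup>2 * T / 2)) *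
        indicator ((\<lambda>\<omega>. \<lambda>s\<in>{0..T}. Y s \<omega>) -` ?E \<inter> space M') \<omega> \<partial>M')"
    proof (rule nn_integral_cong_AE)
      show "AE \<omega> in M'. ?g (?IY \<omega>) * indicator cyl (?IY \<omega>) = ennreal (exp (\<mu> * Y T \<omega> - \<mu>\<^sup>2 * T / 2)) *
        indicator ((\<lambda>\<omega>. \<lambda>s\<in>{0..T}. Y s \<omega>) -` ?E \<inter> space M') \<omega>"
        using Y0 AE_space
      proof eventually_elim
        fix \<omega> assume y: "Y 0 \<omega> = 0" and w: "\<omega> \<in> space M'"
        have "(\<Sum>i<k j. ?IY \<omega> i) = Y j \<omega>" if "j \<in> J" for j
          using telY[OF y, of "k j"] k[OF that] by simp
        then have "(?IY \<omega> \<in> cyl) = (\<forall>j\<in>J. Y j \<omega> \<in> A j)"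
          unfolding cyl_def using sp by simp
        then have "(?IY \<omega> \<in> cyl) = (\<omega> \<in> (\<lambda>\<omega>. \<lambda>s\<in>{0..T}. Y s \<omega>) -` ?E \<inter> space M')"
          using w by (simp only: vimage_eq Int_iff inE simp_thms)
        then show "?g (?IY \<omega>) * indicator cyl (?IY \<omega>) = ennreal (exp (\<mu> * Y T \<omega> - \<mu>\<^sup>2 * T / 2)) *
          indicator ((\<lambda>\<omega>. \<lambda>s\<in>{0..T}. Y s \<omega>) -` ?E \<inter> space M') \<omega>"
          unfolding gY[OF y] indicator_def by simp
      qed
    qed
    also have "\<dots> = emeasure (density M' (\<lambda>\<omega>. ennreal (exp (\<mu> * Y T \<omega> - \<mu>\<^sup>2 * T / 2))))
        ((\<lambda>\<omega>. \<lambda>s\<in>{0..T}. Y s \<omega>) -` ?E \<inter> space M')"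
      by (rule emeasure_density[symmetric]) (use measurable_sets[OF Yp E] in measurable)
    also have "\<dots> = emeasure ?R ?E"
      using Yp E by (subst emeasure_distr) auto
    finally show "emeasure ?L ?E = emeasure ?R ?E" .
  qed
qed

section \<open>Disintegration of Brownian motion along its bridge\<close>

text \<open>
  Completing the square; the integrand is a constant multiple of the normal density with mean \<open>b / T\<close>
  and variance \<open>1 / T\<close>.
\<close>

lemma gaussian_exp_integral:
  assumes T: "0 < T"
  shows "(\<integral>\<^sup>+\<mu>. ennreal (exp (\<mu> * b - \<mu>\<^sup>2 * T / 2)) \<partial>lborel) = ennreal (sqrt (2 * pi / T) * exp (b\<^sup>2 / (2 * T)))"
proof -
  have e: "exp (\<mu> * b - \<mu>\<^sup>2 * T / 2) = sqrt (2 * pi / T) * exp (b\<^sup>2 / (2 * T)) * normal_density (b / T) (1 / sqrt T) \<mu>" for \<mu>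
  proof -
    have "normal_density (b / T) (1 / sqrt T) \<mu> = 1 / sqrt (2 * pi / T) * exp (- (\<mu> - b / T)\<^sup>2 * T / 2)"
      using T by (simp add: normal_density_def power_divide real_sqrt_divide)
    moreover have "exp (b\<^sup>2 / (2 * T)) * exp (- (\<mu> - b / T)\<^sup>2 * T / 2) = exp (\<mu> * b - \<mu>\<^sup>2 * T / 2)"
      using T by (simp add: exp_add[symmetric] field_simps power2_eq_square)
    moreover have "sqrt (2 * pi / T) > 0" using T by simp
    ultimately show ?thesis using T by simp
  qed
  interpret prob_space "density lborel (normal_density (b / T) (1 / sqrt T))"
    using T by (intro prob_space_normal_density) simp
  have "(\<integral>\<^sup>+\<mu>. ennreal (normal_density (b / T) (1 / sqrt T) \<mu>) \<partial>lborel) = 1"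
    using emeasure_space_1 by (simp add: emeasure_density)
  then show ?thesis
    unfolding e using T by (subst ennreal_mult) (simp_all add: nn_integral_cmult)
qed

text \<open>
  A Brownian motion is its bridge plus an independent Gaussian slope \<open>z\<close> of variance \<open>1 / T\<close>. Integrate
  the Cameron-Martin formula over the drift \<open>\<mu>\<close>. On one side the density integrates to an explicit
  function of the end point, which the choice of \<open>g\<close> cancels. On the other side \<open>X + \<mu> s\<close> is the bridge of
  \<open>X\<close> plus the slope \<open>X\<^sub>T / T + \<mu>\<close>, and the substitution \<open>z = X\<^sub>T / T + \<mu>\<close> removes the dependence of the
  slope on the path.
\<close>

lemma brownian_bridge_disintegration:
  fixes f :: "(real \<Rightarrow> real) \<Rightarrow> ennreal"
  assumes ps: "prob_space M" "prob_space M'" and T: "0 < T"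
    and X: "brownian_increments_on T M X" and Y: "brownian_increments_on T M' Y"
    and f[measurable]: "f \<in> borel_measurable (Pi\<^sub>M {0..T} (\<lambda>_. borel))"
  shows "(\<integral>\<^sup>+\<omega>. f (\<lambda>s\<in>{0..T}. Y s \<omega>) \<partial>M') =
    (\<integral>\<^sup>+z. ennreal (sqrt (T / (2 * pi)) * exp (- T * z\<^sup>2 / 2)) *
       (\<integral>\<^sup>+\<omega>. f (\<lambda>s\<in>{0..T}. X s \<omega> - s / T * X T \<omega> + z * s) \<partial>M) \<partial>lborel)"
proof -
  interpret M: prob_space M by fact
  interpret M': prob_space M' by fact
  interpret LM: pair_sigma_finite lborel M ..
  interpret LM': pair_sigma_finite lborel M' ..
  have Xm: "X s \<in> borel_measurable M" if "s \<in> {0..T}" for s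
    using X that unfolding brownian_increments_on_def by blast
  have Ym: "Y s \<in> borel_measurable M'" if "s \<in> {0..T}" for s
    using Y that unfolding brownian_increments_on_def by blast
  have TI: "T \<in> {0..T}" using T by simp
  note [measurable] = Xm[OF TI] Ym[OF TI]
  have YP[measurable]: "(\<lambda>\<omega>. \<lambda>s\<in>{0..T}. Y s \<omega>) \<in> M' \<rightarrow>\<^sub>M Pi\<^sub>M {0..T} (\<lambda>_. borel)"
    by (intro measurable_restrict Ym)
  have XP[measurable]: "(\<lambda>(z, \<omega>). \<lambda>s\<in>{0..T}. X s \<omega> + h z \<omega> * s) \<in> lborel \<Otimes>\<^sub>M M \<rightarrow>\<^sub>M Pi\<^sub>M {0..T} (\<lambda>_. borel)"
    if h[measurable]: "(\<lambda>(z, \<omega>). h z \<omega>) \<in> borel_measurable (lborel \<Otimes>\<^sub>M M)" for h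
  proof -
    have "(\<lambda>x. X s (snd x) + h (fst x) (snd x) * s) \<in> borel_measurable (lborel \<Otimes>\<^sub>M M)" if "s \<in> {0..T}" for s
      using h Xm[OF that] by (simp add: case_prod_beta')
    then show ?thesis unfolding case_prod_beta' by (intro measurable_restrict)
  qed
  \<comment> \<open>the reciprocal of the value given by \<open>gaussian_exp_integral\<close> for \<open>b = w T\<close>\<close>
  define g where "g w = ennreal (sqrt (T / (2 * pi)) * exp (- (w T)\<^sup>2 / (2 * T))) * f w" for w
  have cT[measurable]: "(\<lambda>w. w T) \<in> borel_measurable (Pi\<^sub>M {0..T} (\<lambda>_. borel))"
    by (intro measurable_component_singleton TI)
  have g[measurable]: "g \<in> borel_measurable (Pi\<^sub>M {0..T} (\<lambda>_. borel))"
    unfolding g_def by measurable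
  have cm: "(\<integral>\<^sup>+\<omega>. g (\<lambda>s\<in>{0..T}. X s \<omega> + \<mu> * s) \<partial>M) =
      (\<integral>\<^sup>+\<omega>. ennreal (exp (\<mu> * Y T \<omega> - \<mu>\<^sup>2 * T / 2)) * g (\<lambda>s\<in>{0..T}. Y s \<omega>) \<partial>M')" for \<mu>
  proof -
    have XP': "(\<lambda>\<omega>. \<lambda>s\<in>{0..T}. X s \<omega> + \<mu> * s) \<in> M \<rightarrow>\<^sub>M Pi\<^sub>M {0..T} (\<lambda>_. borel)"
      by (intro measurable_restrict borel_measurable_add Xm) auto
    have "(\<integral>\<^sup>+\<omega>. g (\<lambda>s\<in>{0..T}. X s \<omega> + \<mu> * s) \<partial>M) =
      (\<integral>\<^sup>+w. g w \<partial>distr M (Pi\<^sub>M {0..T} (\<lambda>_. borel)) (\<lambda>\<omega>. \<lambda>s\<in>{0..T}. X s \<omega> + \<mu> * s))"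
      by (rule nn_integral_distr[OF XP', symmetric]) simp
    also have "\<dots> = (\<integral>\<^sup>+w. g w \<partial>distr (density M' (\<lambda>\<omega>. ennreal (exp (\<mu> * Y T \<omega> - \<mu>\<^sup>2 * T / 2))))
        (Pi\<^sub>M {0..T} (\<lambda>_. borel)) (\<lambda>\<omega>. \<lambda>s\<in>{0..T}. Y s \<omega>))"
      by (simp only: cameron_martin_distr[OF ps T X Y])
    also have "\<dots> = (\<integral>\<^sup>+\<omega>. g (\<lambda>s\<in>{0..T}. Y s \<omega>) \<partial>density M' (\<lambda>\<omega>. ennreal (exp (\<mu> * Y T \<omega> - \<mu>\<^sup>2 * T / 2))))"
      by (rule nn_integral_distr) simp_all
    also have "\<dots> = (\<integral>\<^sup>+\<omega>. ennreal (exp (\<mu> * Y T \<omega> - \<mu>\<^sup>2 * T / 2)) * g (\<lambda>s\<in>{0..T}. Y s \<omega>) \<partial>M')"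
      by (rule nn_integral_density) measurable
    finally show ?thesis .
  qed
  have "(\<integral>\<^sup>+\<omega>. f (\<lambda>s\<in>{0..T}. Y s \<omega>) \<partial>M') =
    (\<integral>\<^sup>+\<omega>. (\<integral>\<^sup>+\<mu>. ennreal (exp (\<mu> * Y T \<omega> - \<mu>\<^sup>2 * T / 2)) * g (\<lambda>s\<in>{0..T}. Y s \<omega>) \<partial>lborel) \<partial>M')"
  proof (rule nn_integral_cong)
    fix \<omega>
    have "(\<integral>\<^sup>+\<mu>. ennreal (exp (\<mu> * Y T \<omega> - \<mu>\<^sup>2 * T / 2)) * g (\<lambda>s\<in>{0..T}. Y s \<omega>) \<partial>lborel) =
      ennreal (sqrt (2 * pi / T) * exp ((Y T \<omega>)\<^sup>2 / (2 * T))) * g (\<lambda>s\<in>{0..T}. Y s \<omega>)"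
      by (subst nn_integral_multc) (simp_all add: gaussian_exp_integral[OF T])
    also have "\<dots> = f (\<lambda>s\<in>{0..T}. Y s \<omega>)"
    proof -
      have "sqrt (2 * pi / T) * exp ((Y T \<omega>)\<^sup>2 / (2 * T)) * (sqrt (T / (2 * pi)) * exp (- (Y T \<omega>)\<^sup>2 / (2 * T))) = 1"
        using T by (simp add: exp_minus real_sqrt_divide field_simps)
      then show ?thesis
        using T unfolding g_def by (simp add: mult.assoc[symmetric] ennreal_mult[symmetric] TI)
    qed
    finally show "f (\<lambda>s\<in>{0..T}. Y s \<omega>) = (\<integral>\<^sup>+\<mu>. ennreal (exp (\<mu> * Y T \<omega> - \<mu>\<^sup>2 * T / 2)) * g (\<lambda>s\<in>{0..T}. Y s \<omega>) \<partial>lborel)" ..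
  qed
  also have "\<dots> = (\<integral>\<^sup>+\<mu>. (\<integral>\<^sup>+\<omega>. ennreal (exp (\<mu> * Y T \<omega> - \<mu>\<^sup>2 * T / 2)) * g (\<lambda>s\<in>{0..T}. Y s \<omega>) \<partial>M') \<partial>lborel)"
    by (rule LM'.Fubini') measurable
  also have "\<dots> = (\<integral>\<^sup>+\<mu>. (\<integral>\<^sup>+\<omega>. g (\<lambda>s\<in>{0..T}. X s \<omega> + \<mu> * s) \<partial>M) \<partial>lborel)"
    by (simp only: cm)
  also have "\<dots> = (\<integral>\<^sup>+\<omega>. (\<integral>\<^sup>+\<mu>. g (\<lambda>s\<in>{0..T}. X s \<omega> + \<mu> * s) \<partial>lborel) \<partial>M)"
    by (rule LM.Fubini'[symmetric]) measurable
  also have "\<dots> = (\<integral>\<^sup>+\<omega>. (\<integral>\<^sup>+z. g (\<lambda>s\<in>{0..T}. X s \<omega> + (z - X T \<omega> / T) * s) \<partial>lborel) \<partial>M)"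
  proof (rule nn_integral_cong)
    fix \<omega> assume w: "\<omega> \<in> space M"
    have m: "(\<lambda>\<mu>. g (\<lambda>s\<in>{0..T}. X s \<omega> + \<mu> * s)) \<in> borel_measurable borel"
    proof -
      have "(\<lambda>\<mu>. \<lambda>s\<in>{0..T}. X s \<omega> + \<mu> * s) \<in> borel \<rightarrow>\<^sub>M Pi\<^sub>M {0..T} (\<lambda>_. borel)"
        by (intro measurable_restrict) measurable
      then show ?thesis by measurable
    qed
    show "(\<integral>\<^sup>+\<mu>. g (\<lambda>s\<in>{0..T}. X s \<omega> + \<mu> * s) \<partial>lborel) = (\<integral>\<^sup>+z. g (\<lambda>s\<in>{0..T}. X s \<omega> + (z - X T \<omega> / T) * s) \<partial>lborel)"
      using nn_integral_real_affine[OF m, of 1 "- X T \<omega> / T"] by (simp add: algebra_simps)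
  qed
  also have "\<dots> = (\<integral>\<^sup>+\<omega>. (\<integral>\<^sup>+z. ennreal (sqrt (T / (2 * pi)) * exp (- T * z\<^sup>2 / 2)) *
       f (\<lambda>s\<in>{0..T}. X s \<omega> + (z - X T \<omega> / T) * s) \<partial>lborel) \<partial>M)"
  proof (intro nn_integral_cong)
    fix \<omega> z
    have w: "(\<lambda>s\<in>{0..T}. X s \<omega> + (z - X T \<omega> / T) * s) T = z * T"
      using T by (simp add: field_simps)
    have e: "- (z * T)\<^sup>2 / (2 * T) = - T * z\<^sup>2 / 2"
      using T by (simp add: field_simps power2_eq_square)
    show "g (\<lambda>s\<in>{0..T}. X s \<omega> + (z - X T \<omega> / T) * s) = ennreal (sqrt (T / (2 * pi)) * exp (- T * z\<^sup>2 / 2)) *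
       f (\<lambda>s\<in>{0..T}. X s \<omega> + (z - X T \<omega> / T) * s)"
      unfolding g_def w e ..
  qed
  also have "\<dots> = (\<integral>\<^sup>+z. (\<integral>\<^sup>+\<omega>. ennreal (sqrt (T / (2 * pi)) * exp (- T * z\<^sup>2 / 2)) *
       f (\<lambda>s\<in>{0..T}. X s \<omega> + (z - X T \<omega> / T) * s) \<partial>M) \<partial>lborel)"
    by (rule LM.Fubini') measurable
  also have "\<dots> = (\<integral>\<^sup>+z. ennreal (sqrt (T / (2 * pi)) * exp (- T * z\<^sup>2 / 2)) *
       (\<integral>\<^sup>+\<omega>. f (\<lambda>s\<in>{0..T}. X s \<omega> + (z - X T \<omega> / T) * s) \<partial>M) \<partial>lborel)"
    by (intro nn_integral_cong nn_integral_cmult) measurable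
  also have "\<dots> = (\<integral>\<^sup>+z. ennreal (sqrt (T / (2 * pi)) * exp (- T * z\<^sup>2 / 2)) *
       (\<integral>\<^sup>+\<omega>. f (\<lambda>s\<in>{0..T}. X s \<omega> - s / T * X T \<omega> + z * s) \<partial>M) \<partial>lborel)"
    by (simp add: algebra_simps)
  finally show ?thesis .
qed

section \<open>Time reversal and moments of standard Brownian motion\<close>

text \<open>
  The independence of increments is given for infinite grids; a finite grid is continued by repeating
  its last time.
\<close>

lemma standard_brownian_increments:
  assumes B: "standard_brownian_motion N B"
    and \<tau>: "0 \<le> \<tau> 0" "\<And>i. i < n \<Longrightarrow> \<tau> i < \<tau> (Suc i)"
    and A: "\<And>i. i < n \<Longrightarrow> A i \<in> sets borel"
  shows "emeasure N {\<omega>\<in>space N. \<forall>i<n. B (\<tau> (Suc i)) \<omega> - B (\<tau> i) \<omega> \<in> A i} =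
        (\<Prod>i<n. emeasure (density lborel (normal_density 0 (sqrt (\<tau> (Suc i) - \<tau> i)))) (A i))"
proof (cases "n = 0")
  case True
  interpret prob_space N using B by (simp add: standard_brownian_motion_def)
  show ?thesis using True by (simp add: emeasure_space_1)
next
  case False
  interpret prob_space N using B by (simp add: standard_brownian_motion_def)
  define \<sigma> where "\<sigma> i = \<tau> (min i n)" for i
  have "incseq \<sigma>"
  proof (rule incseq_SucI)
    fix i show "\<sigma> i \<le> \<sigma> (Suc i)"
      using \<tau>(2)[of i] by (cases "i < n") (auto simp: \<sigma>_def min_def not_less_eq_eq dest: le_antisym)
  qed
  have nn: "0 \<le> \<tau> i" if "i \<le> n" for i
    using that
  proof (induction i)
    case (Suc i) then show ?case using \<tau>(2)[of i] by auto
  qed (use \<tau> in simp)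
  have ind: "indep_vars (\<lambda>_. borel) (\<lambda>i \<omega>. B (\<sigma> (Suc i)) \<omega> - B (\<sigma> i) \<omega>) UNIV"
  proof -
    have "0 \<le> \<sigma> 0" using \<tau>(1) by (simp add: \<sigma>_def)
    then show ?thesis using B \<open>incseq \<sigma>\<close> unfolding standard_brownian_motion_def by blast
  qed
  have eq: "\<sigma> i = \<tau> i" "\<sigma> (Suc i) = \<tau> (Suc i)" if "i < n" for i using that by (auto simp: \<sigma>_def)
  let ?D = "\<lambda>i \<omega>. B (\<tau> (Suc i)) \<omega> - B (\<tau> i) \<omega>"
  have dist: "distributed N lborel (?D i) (normal_density 0 (sqrt (\<tau> (Suc i) - \<tau> i)))" if "i < n" for i
    using B nn[of i] \<tau>(2)[OF that] that unfolding standard_brownian_motion_def by auto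
  have "prob (\<Inter>i\<in>{..<n}. (\<lambda>\<omega>. B (\<sigma> (Suc i)) \<omega> - B (\<sigma> i) \<omega>) -` A i \<inter> space N) =
      (\<Prod>i\<in>{..<n}. prob ((\<lambda>\<omega>. B (\<sigma> (Suc i)) \<omega> - B (\<sigma> i) \<omega>) -` A i \<inter> space N))"
    by (rule indep_varsD[OF ind]) (use False A in auto)
  also have "(\<Inter>i\<in>{..<n}. (\<lambda>\<omega>. B (\<sigma> (Suc i)) \<omega> - B (\<sigma> i) \<omega>) -` A i \<inter> space N) =
      {\<omega>\<in>space N. \<forall>i<n. ?D i \<omega> \<in> A i}" using False by (auto simp: eq)
  also have "(\<Prod>i\<in>{..<n}. prob ((\<lambda>\<omega>. B (\<sigma> (Suc i)) \<omega> - B (\<sigma> i) \<omega>) -` A i \<inter> space N)) =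
     (\<Prod>i<n. prob (?D i -` A i \<inter> space N))"
    by (intro prod.cong refl) (auto simp: eq)
  finally have "emeasure N {\<omega>\<in>space N. \<forall>i<n. ?D i \<omega> \<in> A i} = (\<Prod>i<n. emeasure N (?D i -` A i \<inter> space N))"
    by (simp add: emeasure_eq_measure prod_ennreal)
  also have "\<dots> = (\<Prod>i<n. emeasure (density lborel (normal_density 0 (sqrt (\<tau> (Suc i) - \<tau> i)))) (A i))"
  proof (rule prod.cong[OF refl])
    fix i assume "i \<in> {..<n}"
    then have i: "i < n" by simp
    have "emeasure N (?D i -` A i \<inter> space N) = emeasure (distr N lborel (?D i)) (A i)"
      using dist[OF i] A[OF i] by (subst emeasure_distr) (auto simp: distributed_def)
    also have "distr N lborel (?D i) = density lborel (normal_density 0 (sqrt (\<tau> (Suc i) - \<tau> i)))"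
      using dist[OF i] by (simp add: distributed_def)
    finally show "emeasure N (?D i -` A i \<inter> space N) =
        emeasure (density lborel (normal_density 0 (sqrt (\<tau> (Suc i) - \<tau> i)))) (A i)" .
  qed
  finally show ?thesis .
qed

lemma standard_brownian_motionD:
  assumes "standard_brownian_motion N B"
  shows "prob_space N" "continuous_process N B" "AE \<omega> in N. B 0 \<omega> = 0"
    "t \<ge> 0 \<Longrightarrow> B t \<in> borel_measurable N"
    "\<omega> \<in> space N \<Longrightarrow> continuous_on {0..} (\<lambda>t. B t \<omega>)"
  using assms by (auto simp: standard_brownian_motion_def continuous_process_def)

lemma brownian_increments_on_standard:
  assumes B: "standard_brownian_motion N B"
  shows "brownian_increments_on T N B"
  unfolding brownian_increments_on_def
  using standard_brownian_motionD[OF B] standard_brownian_increments[OF B] by simp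

lemma emeasure_normal_density_scale:
  assumes [measurable]: "A \<in> sets borel" and c: "c \<noteq> 0" and s: "0 < s"
  shows "emeasure (density lborel (normal_density 0 s)) {x. c * x \<in> A} =
         emeasure (density lborel (normal_density 0 (\<bar>c\<bar> * s))) A"
proof -
  have [measurable]: "{x. c * x \<in> A} \<in> sets borel"
  proof -
    have "(\<lambda>x. c * x) -` A \<inter> space borel \<in> sets borel" by (rule measurable_sets) measurable
    then show ?thesis by (simp add: vimage_def)
  qed
  have e: "\<bar>c\<bar> * normal_density 0 (\<bar>c\<bar> * s) (c * x) = normal_density 0 s x" for x
    using c s by (simp add: normal_density_def power_mult_distrib real_sqrt_mult)
  have "emeasure (density lborel (normal_density 0 (\<bar>c\<bar> * s))) A =
      (\<integral>\<^sup>+x. ennreal (normal_density 0 (\<bar>c\<bar> * s) x) * indicator A x \<partial>lborel)"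
    by (simp add: emeasure_density)
  also have "\<dots> = ennreal \<bar>c\<bar> * (\<integral>\<^sup>+x. ennreal (normal_density 0 (\<bar>c\<bar> * s) (0 + c * x)) * indicator A (0 + c * x) \<partial>lborel)"
    by (subst nn_integral_real_affine[where c=c and t=0]) (use c in auto)
  also have "\<dots> = (\<integral>\<^sup>+x. ennreal (normal_density 0 s x) * indicator {x. c * x \<in> A} x \<partial>lborel)"
    by (subst nn_integral_cmult[symmetric])
       (auto intro!: nn_integral_cong simp: e[symmetric] ennreal_mult mult.assoc split: split_indicator)
  also have "\<dots> = emeasure (density lborel (normal_density 0 s)) {x. c * x \<in> A}"
    by (simp add: emeasure_density)
  finally show ?thesis by simp
qed

text \<open>
  The increments of the reversed process on a grid are, up to the factor \<open>- u\<close>, the increments of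
  \<open>B\<close> on the reflected grid \<open>\<sigma>\<close>, in reverse order.
\<close>

lemma brownian_increments_on_reversed:
  assumes B: "standard_brownian_motion N B" and u: "0 < u"
  shows "brownian_increments_on (u\<^sup>2) N (\<lambda>s \<omega>. u * (B (1 - s / u\<^sup>2) \<omega> - B 1 \<omega>))"
  unfolding brownian_increments_on_def
proof (intro conjI ballI allI impI)
  fix t assume "t \<in> {0..u\<^sup>2}"
  then have "0 \<le> 1 - t / u\<^sup>2" using u by (simp add: field_simps)
  then show "(\<lambda>\<omega>. u * (B (1 - t / u\<^sup>2) \<omega> - B 1 \<omega>)) \<in> borel_measurable N"
    using standard_brownian_motionD(4)[OF B] by (intro borel_measurable_times borel_measurable_diff) auto
next
  show "AE \<omega> in N. u * (B (1 - 0 / u\<^sup>2) \<omega> - B 1 \<omega>) = 0" by simp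
next
  fix n :: nat and \<tau> :: "nat \<Rightarrow> real" and A :: "nat \<Rightarrow> real set"
  assume "0 \<le> \<tau> 0 \<and> (\<forall>i<n. \<tau> i < \<tau> (Suc i)) \<and> \<tau> n \<le> u\<^sup>2 \<and> (\<forall>i<n. A i \<in> sets borel)"
  then have \<tau>: "0 \<le> \<tau> 0" "\<And>i. i < n \<Longrightarrow> \<tau> i < \<tau> (Suc i)" "\<tau> n \<le> u\<^sup>2" and A: "\<And>i. i < n \<Longrightarrow> A i \<in> sets borel"
    by auto
  define \<sigma> where "\<sigma> j = 1 - \<tau> (n - j) / u\<^sup>2" for j
  have s0: "0 \<le> \<sigma> 0" using \<tau> u by (simp add: \<sigma>_def)
  have s1: "\<sigma> j < \<sigma> (Suc j)" if "j < n" for j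
  proof -
    have "\<tau> (n - Suc j) < \<tau> (n - j)" using \<tau>(2)[of "n - Suc j"] that by (simp add: Suc_diff_Suc)
    then show ?thesis using u by (simp add: \<sigma>_def divide_strict_right_mono)
  qed
  let ?A = "\<lambda>j. {x. (- u) * x \<in> A (n - Suc j)}"
  have A': "?A j \<in> sets borel" if "j < n" for j
  proof -
    have "(\<lambda>x. (- u) * x) -` A (n - Suc j) \<inter> space borel \<in> sets borel"
      by (rule measurable_sets[OF _ A]) (use that in auto)
    then show ?thesis by (simp add: vimage_def)
  qed
  let ?V = "\<lambda>s \<omega>. u * (B (1 - s / u\<^sup>2) \<omega> - B 1 \<omega>)"
  have inc: "?V (\<tau> (Suc i)) \<omega> - ?V (\<tau> i) \<omega> = (- u) * (B (\<sigma> (Suc (n - Suc i))) \<omega> - B (\<sigma> (n - Suc i)) \<omega>)"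
    if "i < n" for i \<omega>
  proof -
    have "\<sigma> (Suc (n - Suc i)) = 1 - \<tau> i / u\<^sup>2" "\<sigma> (n - Suc i) = 1 - \<tau> (Suc i) / u\<^sup>2"
      using that by (simp_all add: \<sigma>_def Suc_diff_Suc)
    then show ?thesis by (simp only:) (simp add: algebra_simps)
  qed
  have "{\<omega>\<in>space N. \<forall>i<n. ?V (\<tau> (Suc i)) \<omega> - ?V (\<tau> i) \<omega> \<in> A i} =
      {\<omega>\<in>space N. \<forall>j<n. B (\<sigma> (Suc j)) \<omega> - B (\<sigma> j) \<omega> \<in> ?A j}"
  proof -
    have "(\<forall>i<n. ?V (\<tau> (Suc i)) \<omega> - ?V (\<tau> i) \<omega> \<in> A i) = (\<forall>j<n. B (\<sigma> (Suc j)) \<omega> - B (\<sigma> j) \<omega> \<in> ?A j)" for \<omega>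
    proof (intro iffI allI impI)
      fix j assume h: "\<forall>i<n. ?V (\<tau> (Suc i)) \<omega> - ?V (\<tau> i) \<omega> \<in> A i" and j: "j < n"
      then have "?V (\<tau> (Suc (n - Suc j))) \<omega> - ?V (\<tau> (n - Suc j)) \<omega> \<in> A (n - Suc j)" by simp
      then show "B (\<sigma> (Suc j)) \<omega> - B (\<sigma> j) \<omega> \<in> ?A j"
        using inc[of "n - Suc j" \<omega>] j by simp
    next
      fix i assume h: "\<forall>j<n. B (\<sigma> (Suc j)) \<omega> - B (\<sigma> j) \<omega> \<in> ?A j" and i: "i < n"
      have "n - Suc i < n" using i by simp
      from h[rule_format, OF this]
      have "B (\<sigma> (Suc (n - Suc i))) \<omega> - B (\<sigma> (n - Suc i)) \<omega> \<in> ?A (n - Suc i)" .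
      then show "?V (\<tau> (Suc i)) \<omega> - ?V (\<tau> i) \<omega> \<in> A i" using inc[of i \<omega>] i by simp
    qed
    then show ?thesis by simp
  qed
  then have "emeasure N {\<omega>\<in>space N. \<forall>i<n. ?V (\<tau> (Suc i)) \<omega> - ?V (\<tau> i) \<omega> \<in> A i} =
      (\<Prod>j<n. emeasure (density lborel (normal_density 0 (sqrt (\<sigma> (Suc j) - \<sigma> j)))) (?A j))"
    using standard_brownian_increments[of N B \<sigma> n ?A] B s0 s1 A' by simp
  also have "\<dots> = (\<Prod>j<n. emeasure (density lborel (normal_density 0 (sqrt (\<tau> (Suc (n - Suc j)) - \<tau> (n - Suc j))))) (A (n - Suc j)))"
  proof (rule prod.cong[OF refl])
    fix j assume "j \<in> {..<n}"
    then have j: "j < n" by simp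
    have d: "\<sigma> (Suc j) - \<sigma> j = (\<tau> (Suc (n - Suc j)) - \<tau> (n - Suc j)) / u\<^sup>2"
      using j u by (simp add: \<sigma>_def Suc_diff_Suc diff_divide_distrib)
    have p: "0 < \<sigma> (Suc j) - \<sigma> j" using s1[OF j] by simp
    have q: "\<bar>- u\<bar> * sqrt (\<sigma> (Suc j) - \<sigma> j) = sqrt (\<tau> (Suc (n - Suc j)) - \<tau> (n - Suc j))"
      unfolding d using u by (simp add: real_sqrt_divide)
    show "emeasure (density lborel (normal_density 0 (sqrt (\<sigma> (Suc j) - \<sigma> j)))) (?A j) =
      emeasure (density lborel (normal_density 0 (sqrt (\<tau> (Suc (n - Suc j)) - \<tau> (n - Suc j))))) (A (n - Suc j))"
      using emeasure_normal_density_scale[of "A (n - Suc j)" "- u" "sqrt (\<sigma> (Suc j) - \<sigma> j)"] A[of "n - Suc j"] j u p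
      unfolding q by simp
  qed
  also have "\<dots> = (\<Prod>i<n. emeasure (density lborel (normal_density 0 (sqrt (\<tau> (Suc i) - \<tau> i)))) (A i))"
    by (rule prod.nat_diff_reindex)
  finally show "emeasure N {\<omega>\<in>space N. \<forall>i<n. ?V (\<tau> (Suc i)) \<omega> - ?V (\<tau> i) \<omega> \<in> A i} =
      (\<Prod>i<n. emeasure (density lborel (normal_density 0 (sqrt (\<tau> (Suc i) - \<tau> i)))) (A i))" .
qed

lemma continuous_process_jointly_measurable:
  assumes X: "continuous_process N X"
  shows "(\<lambda>z. X (max 0 (fst z)) (snd z)) \<in> borel_measurable (borel \<Otimes>\<^sub>M N)"
proof -
  let ?M = "(borel :: real measure) \<Otimes>\<^sub>M N"
  have m: "X t \<in> borel_measurable N" if "0 \<le> t" for t using X that by (simp add: continuous_process_def)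
  have "(\<lambda>z. X (max 0 (of_int k / 2^n)) (snd z)) \<in> borel_measurable ?M" for k n
    using m[of "max 0 (of_int k / 2^n)"] by simp
  then have "(\<lambda>z. X (max 0 (dyadic_floor n (max 0 (fst z)))) (snd z)) \<in> borel_measurable ?M" for n
    unfolding dyadic_floor_def
    by (rule measurable_compose_countable[of "\<lambda>k z. X (max 0 (of_int k / 2^n)) (snd z)"]) measurable
  then have b: "(\<lambda>z. lim (\<lambda>n. X (max 0 (dyadic_floor n (max 0 (fst z)))) (snd z))) \<in> borel_measurable ?M"
    by (rule borel_measurable_lim_metric)
  show ?thesis
  proof (rule measurable_cong[THEN iffD1, OF _ b])
    fix z assume z: "z \<in> space ?M"
    then have c: "continuous_on {0..} (\<lambda>t. X t (snd z))"
      using X by (simp add: continuous_process_def space_pair_measure mem_Times_iff)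
    have "(\<lambda>n. X (dyadic_floor n (max 0 (fst z))) (snd z)) \<longlonglongrightarrow> X (max 0 (fst z)) (snd z)"
      by (rule continuous_on_tendsto_compose[OF c dyadic_floor_tendsto]) (auto intro!: always_eventually dyadic_floor_bounds)
    then show "lim (\<lambda>n. X (max 0 (dyadic_floor n (max 0 (fst z)))) (snd z)) = X (max 0 (fst z)) (snd z)"
      by (intro limI) (simp add: max_absorb2 dyadic_floor_bounds)
  qed
qed

lemma standard_brownian_distributed:
  assumes B: "standard_brownian_motion N B" and t: "0 < t"
  shows "distributed N lborel (B t) (normal_density 0 (sqrt t))"
proof -
  have d: "distributed N lborel (\<lambda>\<omega>. B t \<omega> - B 0 \<omega>) (normal_density 0 (sqrt t))"
    using B t unfolding standard_brownian_motion_def by force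
  have m: "B t \<in> borel_measurable N" "B 0 \<in> borel_measurable N"
    using standard_brownian_motionD(4)[OF B] t by auto
  have "distr N lborel (B t) = distr N lborel (\<lambda>\<omega>. B t \<omega> - B 0 \<omega>)"
  proof (rule distr_cong_AE)
    show "AE \<omega> in N. B t \<omega> = B t \<omega> - B 0 \<omega>"
      using standard_brownian_motionD(3)[OF B] by eventually_elim simp
  qed (use m in simp_all)
  then show ?thesis using d m by (simp add: distributed_def)
qed

text \<open>
  The Gaussian moment generating function, from the tilt of the normal density.
\<close>

lemma standard_brownian_exp_moment:
  assumes B: "standard_brownian_motion N B" and t: "0 \<le> t"
  shows "(\<integral>\<^sup>+\<omega>. ennreal (exp (k * B t \<omega>)) \<partial>N) = ennreal (exp (k\<^sup>2 * t / 2))"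
proof (cases "t = 0")
  case True
  interpret prob_space N using B by (rule standard_brownian_motionD)
  have "(\<integral>\<^sup>+\<omega>. ennreal (exp (k * B t \<omega>)) \<partial>N) = (\<integral>\<^sup>+\<omega>. 1 \<partial>N)"
  proof (rule nn_integral_cong_AE)
    show "AE \<omega> in N. ennreal (exp (k * B t \<omega>)) = 1"
      using standard_brownian_motionD(3)[OF B] by eventually_elim (simp add: True)
  qed
  then show ?thesis by (simp add: True emeasure_space_1)
next
  case False
  then have t: "0 < t" using t by simp
  have "(\<integral>\<^sup>+\<omega>. ennreal (exp (k * B t \<omega>)) \<partial>N) = (\<integral>\<^sup>+x. ennreal (normal_density 0 (sqrt t) x) * ennreal (exp (k * x)) \<partial>lborel)"
    by (rule distributed_nn_integral[symmetric, OF standard_brownian_distributed[OF B t]]) simp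
  also have "\<dots> = (\<integral>\<^sup>+x. ennreal (exp (k\<^sup>2 * t / 2)) * ennreal (normal_density (k * t) (sqrt t) x) \<partial>lborel)"
  proof (rule nn_integral_cong)
    fix x
    have "normal_density 0 (sqrt t) x * exp (k * x) = exp (k\<^sup>2 * t / 2) * normal_density (k * t) (sqrt t) x"
      unfolding normal_density_tilt[OF t] by (simp add: exp_diff)
    then show "ennreal (normal_density 0 (sqrt t) x) * ennreal (exp (k * x)) =
        ennreal (exp (k\<^sup>2 * t / 2)) * ennreal (normal_density (k * t) (sqrt t) x)"
      by (simp add: ennreal_mult[symmetric])
  qed
  also have "\<dots> = ennreal (exp (k\<^sup>2 * t / 2)) * (\<integral>\<^sup>+x. ennreal (normal_density (k * t) (sqrt t) x) \<partial>lborel)"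
    by (rule nn_integral_cmult) simp
  also have "(\<integral>\<^sup>+x. ennreal (normal_density (k * t) (sqrt t) x) \<partial>lborel) = 1"
    using prob_space.emeasure_space_1[OF prob_space_normal_density[of "sqrt t" "k * t"]] t
    by (simp add: emeasure_density)
  finally show ?thesis by simp
qed

text \<open>
  Since \<open>B\<^sub>s\<close> is the bridge value plus \<open>z s\<close> with an independent slope \<open>z\<close>, its exponential moment
  \<open>exp (k\<^sup>2 s / 2)\<close> factorises; dividing by the contribution \<open>exp (k\<^sup>2 s\<^sup>2 / (2 T))\<close> of the slope leaves the
  moment of the bridge.
\<close>

lemma brownian_bridge_exp_moment:
  assumes B: "standard_brownian_motion N B" and T: "0 < T" and s: "s \<in> {0..T}"
  shows "(\<integral>\<^sup>+\<omega>. ennreal (exp (k * (B s \<omega> - s / T * B T \<omega>))) \<partial>N) = ennreal (exp (k\<^sup>2 * s * (1 - s / T) / 2))"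
proof -
  note N = standard_brownian_motionD(1)[OF B] and inc = brownian_increments_on_standard[OF B, of T]
  let ?E = "\<integral>\<^sup>+\<omega>. ennreal (exp (k * (B s \<omega> - s / T * B T \<omega>))) \<partial>N"
  have [measurable]: "(\<lambda>w. w s) \<in> borel_measurable (Pi\<^sub>M {0..T} (\<lambda>_. borel :: real measure))" using s by simp
  have [measurable]: "B s \<in> borel_measurable N" "B T \<in> borel_measurable N"
    using standard_brownian_motionD(4)[OF B] s T by auto
  have "(\<lambda>w. ennreal (exp (k * w s))) \<in> borel_measurable (Pi\<^sub>M {0..T} (\<lambda>_. borel))" by measurable
  from brownian_bridge_disintegration[OF N N T inc inc this]
  have "ennreal (exp (k\<^sup>2 * s / 2)) = (\<integral>\<^sup>+z. ennreal (sqrt (T / (2 * pi)) * exp (- T * z\<^sup>2 / 2)) *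
       (\<integral>\<^sup>+\<omega>. ennreal (exp (k * (B s \<omega> - s / T * B T \<omega> + z * s))) \<partial>N) \<partial>lborel)"
    using s standard_brownian_exp_moment[OF B, of s k] by simp
  also have "\<dots> = (\<integral>\<^sup>+z. ennreal (sqrt (T / (2 * pi))) * ?E * ennreal (exp (z * (k * s) - z\<^sup>2 * T / 2)) \<partial>lborel)"
  proof (rule nn_integral_cong)
    fix z
    have e1: "(\<integral>\<^sup>+\<omega>. ennreal (exp (k * (B s \<omega> - s / T * B T \<omega> + z * s))) \<partial>N) = ennreal (exp (k * z * s)) * ?E"
      by (subst nn_integral_cmult[symmetric]) (simp_all add: ennreal_mult[symmetric] exp_add[symmetric] algebra_simps)
    have "sqrt (T / (2 * pi)) * exp (- T * z\<^sup>2 / 2) * exp (k * z * s) = sqrt (T / (2 * pi)) * exp (z * (k * s) - z\<^sup>2 * T / 2)"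
      by (simp add: mult.assoc exp_add[symmetric] algebra_simps)
    then have e2: "ennreal (sqrt (T / (2 * pi)) * exp (- T * z\<^sup>2 / 2)) * ennreal (exp (k * z * s)) =
       ennreal (sqrt (T / (2 * pi))) * ennreal (exp (z * (k * s) - z\<^sup>2 * T / 2))"
      using T by (simp add: ennreal_mult[symmetric])
    show "ennreal (sqrt (T / (2 * pi)) * exp (- T * z\<^sup>2 / 2)) *
       (\<integral>\<^sup>+\<omega>. ennreal (exp (k * (B s \<omega> - s / T * B T \<omega> + z * s))) \<partial>N) =
       ennreal (sqrt (T / (2 * pi))) * ?E * ennreal (exp (z * (k * s) - z\<^sup>2 * T / 2))"
      unfolding e1 mult.assoc[symmetric] e2 by (simp only: mult_ac)
  qed
  also have "\<dots> = ennreal (sqrt (T / (2 * pi))) * ?E * ennreal (sqrt (2 * pi / T) * exp ((k * s)\<^sup>2 / (2 * T)))"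
    by (subst nn_integral_cmult) (simp_all add: gaussian_exp_integral[OF T])
  also have "\<dots> = ennreal (exp ((k * s)\<^sup>2 / (2 * T))) * ?E"
  proof -
    have "sqrt (T / (2 * pi)) * (sqrt (2 * pi / T) * exp ((k * s)\<^sup>2 / (2 * T))) = exp ((k * s)\<^sup>2 / (2 * T))"
      using T by (simp add: real_sqrt_divide)
    then have e3: "ennreal (sqrt (T / (2 * pi))) * ennreal (sqrt (2 * pi / T) * exp ((k * s)\<^sup>2 / (2 * T))) = ennreal (exp ((k * s)\<^sup>2 / (2 * T)))"
      using T by (simp add: ennreal_mult[symmetric])
    have "x * y * z = x * z * y" for x y z :: ennreal by (simp only: mult_ac)
    from this[of _ ?E] show ?thesis unfolding e3[symmetric] by (rule trans) simp
  qed
  finally have e: "ennreal (exp (k\<^sup>2 * s / 2)) = ennreal (exp ((k * s)\<^sup>2 / (2 * T))) * ?E" .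
  have "ennreal (exp (- ((k * s)\<^sup>2 / (2 * T)))) * ennreal (exp (k\<^sup>2 * s / 2)) = ?E"
    unfolding e by (simp add: mult.assoc[symmetric] ennreal_mult[symmetric] exp_add[symmetric])
  also have "ennreal (exp (- ((k * s)\<^sup>2 / (2 * T)))) * ennreal (exp (k\<^sup>2 * s / 2)) = ennreal (exp (k\<^sup>2 * s * (1 - s / T) / 2))"
    using T by (simp add: ennreal_mult[symmetric] exp_add[symmetric] field_simps power2_eq_square)
  finally show ?thesis ..
qed

lemma standard_brownian_abs_moment:
  assumes B: "standard_brownian_motion N B" and t: "0 < t"
  shows "(\<integral>\<^sup>+\<omega>. ennreal \<bar>B t \<omega>\<bar> \<partial>N) \<le> ennreal (sqrt t)"
proof -
  have "(\<integral>\<^sup>+\<omega>. ennreal \<bar>B t \<omega>\<bar> \<partial>N) = (\<integral>\<^sup>+x. ennreal (normal_density 0 (sqrt t) x) * ennreal \<bar>x\<bar> \<partial>lborel)"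
    by (rule distributed_nn_integral[symmetric, OF standard_brownian_distributed[OF B t]]) simp
  also have "\<dots> = (\<integral>\<^sup>+x. ennreal (normal_density 0 (sqrt t) x * \<bar>x - 0\<bar> ^ (2 * 0 + 1)) \<partial>lborel)"
    by (simp add: ennreal_mult)
  also have "\<dots> = ennreal (2^0 * sqrt t ^ (2 * 0 + 1) * fact 0 * sqrt (2 / pi))"
    using normal_moment_abs_odd[of "sqrt t" 0 0] t
    by (intro nn_integral_eq_integral[THEN trans] arg_cong[where f=ennreal] has_bochner_integral_integral_eq)
       (auto simp: has_bochner_integral_iff)
  also have "\<dots> \<le> ennreal (sqrt t)"
  proof (rule ennreal_leI)
    have "sqrt (2 / pi) \<le> 1" using pi_gt3 by (intro real_le_lsqrt) auto
    then have "sqrt t * sqrt (2 / pi) \<le> sqrt t * 1" using t by (intro mult_left_mono) auto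
    then show "2^0 * sqrt t ^ (2 * 0 + 1) * fact 0 * sqrt (2 / pi) \<le> sqrt t" by simp
  qed
  finally show ?thesis .
qed

lemma standard_brownian_no_atom:
  assumes B: "standard_brownian_motion N B" and t: "0 < t"
  shows "emeasure N {\<omega>\<in>space N. B t \<omega> = c} = 0"
proof -
  have "emeasure N (B t -` {c} \<inter> space N) = (\<integral>\<^sup>+x. ennreal (normal_density 0 (sqrt t) x) * indicator {c} x \<partial>lborel)"
    by (rule distributed_emeasure[OF standard_brownian_distributed[OF B t]]) simp
  also have "\<dots> = 0" by (simp add: nn_integral_indicator_singleton)
  finally show ?thesis by (simp add: vimage_def Int_def conj_commute)
qed

section \<open>Two independent Brownian motions\<close>

text \<open>
  Working on the product space \<open>Q\<close> makes the independence of the two motions an instance of Fubini's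
  theorem. The correlated pair is \<open>(b1, \<rho> b1 + \<kappa> b2)\<close>.
\<close>

locale brownian_pair =
  fixes N :: "'b measure" and B1 B2 :: "real \<Rightarrow> 'b \<Rightarrow> real" and \<rho> :: real
  assumes B1: "standard_brownian_motion N B1" and B2: "standard_brownian_motion N B2"
    and rho: "-1 < \<rho>" "\<rho> < 1"
begin

definition Q :: "('b \<times> 'b) measure" where "Q = N \<Otimes>\<^sub>M N"

text \<open>
  Freezing the process at negative times makes it continuous on all of \<open>\<real>\<close> and jointly measurable in
  time and \<open>q\<close>.
\<close>

definition b1 :: "real \<Rightarrow> 'b \<times> 'b \<Rightarrow> real" where "b1 t q = B1 (max 0 t) (fst q)"

definition b2 :: "real \<Rightarrow> 'b \<times> 'b \<Rightarrow> real" where "b2 t q = B2 (max 0 t) (snd q)"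

definition \<kappa> :: real where "\<kappa> = sqrt (1 - \<rho>\<^sup>2)"

lemma rho_sq: "\<rho>\<^sup>2 < 1" using rho by (simp add: abs_square_less_1)

lemma \<kappa>_pos: "0 < \<kappa>" and \<kappa>_sq: "\<kappa>\<^sup>2 = 1 - \<rho>\<^sup>2"
  using rho_sq by (simp_all add: \<kappa>_def)

sublocale N: prob_space N using B1 by (rule standard_brownian_motionD)

sublocale NN: pair_prob_space N N ..

sublocale Q: prob_space Q
  unfolding Q_def by (rule prob_space_pair) unfold_locales

lemma fst_Q[measurable]: "fst \<in> Q \<rightarrow>\<^sub>M N" and snd_Q[measurable]: "snd \<in> Q \<rightarrow>\<^sub>M N"
  by (simp_all add: Q_def)

lemma b1_measurable[measurable (raw)]:
  assumes [measurable]: "f \<in> borel_measurable R" "g \<in> R \<rightarrow>\<^sub>M Q"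
  shows "(\<lambda>r. b1 (f r) (g r)) \<in> borel_measurable R"
proof -
  have "(\<lambda>r. (f r, fst (g r))) \<in> R \<rightarrow>\<^sub>M borel \<Otimes>\<^sub>M N" by measurable
  from measurable_compose[OF this continuous_process_jointly_measurable[OF standard_brownian_motionD(2)[OF B1]]]
  show ?thesis by (simp add: b1_def)
qed

lemma b2_measurable[measurable (raw)]:
  assumes [measurable]: "f \<in> borel_measurable R" "g \<in> R \<rightarrow>\<^sub>M Q"
  shows "(\<lambda>r. b2 (f r) (g r)) \<in> borel_measurable R"
proof -
  have "(\<lambda>r. (f r, snd (g r))) \<in> R \<rightarrow>\<^sub>M borel \<Otimes>\<^sub>M N" by measurable
  from measurable_compose[OF this continuous_process_jointly_measurable[OF standard_brownian_motionD(2)[OF B2]]]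
  show ?thesis by (simp add: b2_def)
qed

lemma b1_continuous: "q \<in> space Q \<Longrightarrow> continuous_on A (\<lambda>t. b1 t q)"
  and b2_continuous: "q \<in> space Q \<Longrightarrow> continuous_on A (\<lambda>t. b2 t q)"
proof -
  assume "q \<in> space Q"
  then have q: "fst q \<in> space N" "snd q \<in> space N" by (auto simp: Q_def space_pair_measure)
  show "continuous_on A (\<lambda>t. b1 t q)" unfolding b1_def
    by (rule continuous_on_compose2[OF standard_brownian_motionD(5)[OF B1 q(1)]]) (auto intro!: continuous_intros)
  show "continuous_on A (\<lambda>t. b2 t q)" unfolding b2_def
    by (rule continuous_on_compose2[OF standard_brownian_motionD(5)[OF B2 q(2)]]) (auto intro!: continuous_intros)
qed

definition br1 :: "real \<Rightarrow> real \<Rightarrow> 'b \<times> 'b \<Rightarrow> real" where "br1 T s q = b1 s q - s / T * b1 T q"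

definition br2 :: "real \<Rightarrow> real \<Rightarrow> 'b \<times> 'b \<Rightarrow> real" where "br2 T s q = b2 s q - s / T * b2 T q"

lemma br_measurable[measurable (raw)]:
  assumes [measurable]: "f \<in> borel_measurable R" "g \<in> R \<rightarrow>\<^sub>M Q" "h \<in> borel_measurable R"
  shows "(\<lambda>r. br1 (h r) (f r) (g r)) \<in> borel_measurable R"
    "(\<lambda>r. br2 (h r) (f r) (g r)) \<in> borel_measurable R"
  unfolding br1_def br2_def by measurable

lemma pair_path_measurable:
  "(\<lambda>(w1, w2). \<lambda>s\<in>I. (w1 s, w2 s) :: real \<times> real) \<in>
     Pi\<^sub>M I (\<lambda>_. borel) \<Otimes>\<^sub>M Pi\<^sub>M I (\<lambda>_. borel) \<rightarrow>\<^sub>M Pi\<^sub>M I (\<lambda>_. borel)"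
  unfolding case_prod_beta'
proof (rule measurable_restrict)
  fix s assume s: "s \<in> I"
  have [measurable]: "(\<lambda>w. w s) \<in> borel_measurable (Pi\<^sub>M I (\<lambda>_. borel :: real measure))"
    using s by simp
  show "(\<lambda>x. (fst x s, snd x s)) \<in> borel_measurable (Pi\<^sub>M I (\<lambda>_. borel :: real measure) \<Otimes>\<^sub>M Pi\<^sub>M I (\<lambda>_. borel :: real measure))"
    unfolding borel_prod[symmetric] by measurable
qed

text \<open>
  The one-dimensional disintegration is applied to the second motion with the first path fixed, and
  then to the first motion.
\<close>

lemma bridge_disintegration:
  fixes f :: "(real \<Rightarrow> real \<times> real) \<Rightarrow> ennreal"
  assumes u: "0 < u" and f: "f \<in> borel_measurable (Pi\<^sub>M {0..u\<^sup>2} (\<lambda>_. borel))"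
  defines "\<gamma> \<equiv> \<lambda>z. ennreal (sqrt (u\<^sup>2 / (2 * pi)) * exp (- u\<^sup>2 * z\<^sup>2 / 2))"
  shows "(\<integral>\<^sup>+q. f (\<lambda>s\<in>{0..u\<^sup>2}. (u * (b1 (1 - s / u\<^sup>2) q - b1 1 q), u * (b2 (1 - s / u\<^sup>2) q - b2 1 q))) \<partial>Q) =
    (\<integral>\<^sup>+z1. \<gamma> z1 * (\<integral>\<^sup>+z2. \<gamma> z2 * (\<integral>\<^sup>+q. f (\<lambda>s\<in>{0..u\<^sup>2}. (br1 (u\<^sup>2) s q + z1 * s, br2 (u\<^sup>2) s q + z2 * s)) \<partial>Q)
       \<partial>lborel) \<partial>lborel)"
proof -
  define T where "T = u\<^sup>2"
  have T: "0 < T" using u by (simp add: T_def)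
  let ?V = "\<lambda>B s \<omega>. u * (B (1 - s / T) \<omega> - B 1 \<omega>)"
  let ?P = "Pi\<^sub>M {0..T} (\<lambda>_. borel :: real measure)"
  define F where "F w1 w2 = f (\<lambda>s\<in>{0..T}. (w1 s, w2 s))" for w1 w2 :: "real \<Rightarrow> real"
  have F: "(\<lambda>(w1, w2). F w1 w2) \<in> borel_measurable (?P \<Otimes>\<^sub>M ?P)"
    using measurable_compose[OF pair_path_measurable f[folded T_def]] by (simp add: F_def case_prod_beta')
  have Fr: "F (\<lambda>s\<in>{0..T}. g s) (\<lambda>s\<in>{0..T}. h s) = f (\<lambda>s\<in>{0..T}. (g s, h s))" for g h
    unfolding F_def by (intro arg_cong[where f=f]) auto
  have V: "brownian_increments_on T N (?V B1)" "brownian_increments_on T N (?V B2)"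
    using brownian_increments_on_reversed[OF B1 u] brownian_increments_on_reversed[OF B2 u] by (simp_all add: T_def)
  have X: "brownian_increments_on T N B1" "brownian_increments_on T N B2"
    using brownian_increments_on_standard[OF B1] brownian_increments_on_standard[OF B2] by simp_all
  have path: "(\<lambda>\<omega>. \<lambda>s\<in>{0..T}. Y s \<omega>) \<in> N \<rightarrow>\<^sub>M ?P" if "brownian_increments_on T N Y" for Y
    using that unfolding brownian_increments_on_def by (intro measurable_restrict) blast
  note pV[measurable] = path[OF V(1)] path[OF V(2)]
  have bp: "(\<lambda>(z, \<omega>). \<lambda>s\<in>{0..T}. B s \<omega> - s / T * B T \<omega> + z * s) \<in> (borel :: real measure) \<Otimes>\<^sub>M N \<rightarrow>\<^sub>M ?P"
    if "standard_brownian_motion N B" for B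
    unfolding case_prod_beta'
  proof (rule measurable_restrict)
    fix s assume s: "s \<in> {0..T}"
    have [measurable]: "B s \<in> borel_measurable N" "B T \<in> borel_measurable N"
      using s T by (auto intro!: standard_brownian_motionD(4)[OF that])
    show "(\<lambda>x. B s (snd x) - s / T * B T (snd x) + fst x * s) \<in> borel_measurable (borel \<Otimes>\<^sub>M N)" by measurable
  qed
  note bp[OF B1, measurable] bp[OF B2, measurable]
  have bs: "(\<lambda>\<omega>. \<lambda>s\<in>{0..T}. B2 s \<omega> - s / T * B2 T \<omega> + z * s) \<in> N \<rightarrow>\<^sub>M ?P" for z
    using measurable_compose[OF _ bp[OF B2], of "\<lambda>\<omega>. (z, \<omega>)"] by simp
  note F[measurable]
  interpret LN: pair_sigma_finite lborel N ..
  have Fsec: "F w \<in> borel_measurable ?P" if "w \<in> space ?P" for w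
    using measurable_compose[OF measurable_Pair1'[OF that] F] by simp
  have "(\<integral>\<^sup>+q. f (\<lambda>s\<in>{0..T}. (u * (b1 (1 - s / T) q - b1 1 q), u * (b2 (1 - s / T) q - b2 1 q))) \<partial>Q) =
    (\<integral>\<^sup>+q. F (\<lambda>s\<in>{0..T}. ?V B1 s (fst q)) (\<lambda>s\<in>{0..T}. ?V B2 s (snd q)) \<partial>(N \<Otimes>\<^sub>M N))"
    unfolding Fr Q_def
    by (intro nn_integral_cong arg_cong[where f=f])
       (auto simp: b1_def b2_def fun_eq_iff max_absorb2 T)
  also have "\<dots> = (\<integral>\<^sup>+\<omega>. (\<integral>\<^sup>+\<omega>'. F (\<lambda>s\<in>{0..T}. ?V B1 s \<omega>) (\<lambda>s\<in>{0..T}. ?V B2 s \<omega>') \<partial>N) \<partial>N)"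
    by (subst N.nn_integral_fst[symmetric]) simp_all
  also have "\<dots> = (\<integral>\<^sup>+\<omega>. (\<integral>\<^sup>+z2. \<gamma> z2 * (\<integral>\<^sup>+\<omega>'. F (\<lambda>s\<in>{0..T}. ?V B1 s \<omega>) (\<lambda>s\<in>{0..T}. B2 s \<omega>' - s / T * B2 T \<omega>' + z2 * s) \<partial>N) \<partial>lborel) \<partial>N)"
  proof (rule nn_integral_cong)
    fix \<omega> assume "\<omega> \<in> space N"
    then have "(\<lambda>s\<in>{0..T}. ?V B1 s \<omega>) \<in> space ?P" by (simp add: space_PiM)
    from brownian_bridge_disintegration[OF N.prob_space_axioms N.prob_space_axioms T X(2) V(2) Fsec[OF this]]
    show "(\<integral>\<^sup>+\<omega>'. F (\<lambda>s\<in>{0..T}. ?V B1 s \<omega>) (\<lambda>s\<in>{0..T}. ?V B2 s \<omega>') \<partial>N) =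
      (\<integral>\<^sup>+z2. \<gamma> z2 * (\<integral>\<^sup>+\<omega>'. F (\<lambda>s\<in>{0..T}. ?V B1 s \<omega>) (\<lambda>s\<in>{0..T}. B2 s \<omega>' - s / T * B2 T \<omega>' + z2 * s) \<partial>N) \<partial>lborel)"
      by (simp add: \<gamma>_def T_def)
  qed
  also have "\<dots> = (\<integral>\<^sup>+z1. \<gamma> z1 * (\<integral>\<^sup>+\<omega>. (\<integral>\<^sup>+z2. \<gamma> z2 * (\<integral>\<^sup>+\<omega>'.
      F (\<lambda>s\<in>{0..T}. B1 s \<omega> - s / T * B1 T \<omega> + z1 * s) (\<lambda>s\<in>{0..T}. B2 s \<omega>' - s / T * B2 T \<omega>' + z2 * s) \<partial>N) \<partial>lborel) \<partial>N) \<partial>lborel)"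
  proof -
    have "(\<lambda>w. \<integral>\<^sup>+z2. \<gamma> z2 * (\<integral>\<^sup>+\<omega>'. F w (\<lambda>s\<in>{0..T}. B2 s \<omega>' - s / T * B2 T \<omega>' + z2 * s) \<partial>N) \<partial>lborel) \<in> borel_measurable ?P"
      unfolding \<gamma>_def by measurable
    from brownian_bridge_disintegration[OF N.prob_space_axioms N.prob_space_axioms T X(1) V(1) this]
    show ?thesis by (simp add: \<gamma>_def T_def)
  qed
  also have "\<dots> = (\<integral>\<^sup>+z1. \<gamma> z1 * (\<integral>\<^sup>+z2. \<gamma> z2 * (\<integral>\<^sup>+q. f (\<lambda>s\<in>{0..T}. (br1 T s q + z1 * s, br2 T s q + z2 * s)) \<partial>Q)
       \<partial>lborel) \<partial>lborel)"
  proof (intro nn_integral_cong arg_cong2[where f="(*)"] refl)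
    fix z1 :: real
    let ?G = "\<lambda>\<omega> z2 \<omega>'. F (\<lambda>s\<in>{0..T}. B1 s \<omega> - s / T * B1 T \<omega> + z1 * s) (\<lambda>s\<in>{0..T}. B2 s \<omega>' - s / T * B2 T \<omega>' + z2 * s)"
    have bs1[measurable]: "(\<lambda>\<omega>. \<lambda>s\<in>{0..T}. B1 s \<omega> - s / T * B1 T \<omega> + z1 * s) \<in> N \<rightarrow>\<^sub>M ?P"
      using measurable_compose[OF _ bp[OF B1], of "\<lambda>\<omega>. (z1, \<omega>)"] by simp
    have "(\<integral>\<^sup>+\<omega>. (\<integral>\<^sup>+z2. \<gamma> z2 * (\<integral>\<^sup>+\<omega>'. ?G \<omega> z2 \<omega>' \<partial>N) \<partial>lborel) \<partial>N) =
      (\<integral>\<^sup>+z2. (\<integral>\<^sup>+\<omega>. \<gamma> z2 * (\<integral>\<^sup>+\<omega>'. ?G \<omega> z2 \<omega>' \<partial>N) \<partial>N) \<partial>lborel)"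
      unfolding \<gamma>_def by (rule LN.Fubini') measurable
    also have "\<dots> = (\<integral>\<^sup>+z2. \<gamma> z2 * (\<integral>\<^sup>+q. f (\<lambda>s\<in>{0..T}. (br1 T s q + z1 * s, br2 T s q + z2 * s)) \<partial>Q) \<partial>lborel)"
    proof (rule nn_integral_cong)
      fix z2 :: real
      note bs[of z2, measurable]
      have "(\<integral>\<^sup>+\<omega>. \<gamma> z2 * (\<integral>\<^sup>+\<omega>'. ?G \<omega> z2 \<omega>' \<partial>N) \<partial>N) = \<gamma> z2 * (\<integral>\<^sup>+\<omega>. (\<integral>\<^sup>+\<omega>'. ?G \<omega> z2 \<omega>' \<partial>N) \<partial>N)"
        by (rule nn_integral_cmult) measurable
      also have "(\<integral>\<^sup>+\<omega>. (\<integral>\<^sup>+\<omega>'. ?G \<omega> z2 \<omega>' \<partial>N) \<partial>N) = (\<integral>\<^sup>+q. ?G (fst q) z2 (snd q) \<partial>(N \<Otimes>\<^sub>M N))"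
      proof -
        have "(\<lambda>q. ?G (fst q) z2 (snd q)) \<in> borel_measurable (N \<Otimes>\<^sub>M N)" by measurable
        from N.nn_integral_fst[OF this] show ?thesis by simp
      qed
      also have "\<dots> = (\<integral>\<^sup>+q. f (\<lambda>s\<in>{0..T}. (br1 T s q + z1 * s, br2 T s q + z2 * s)) \<partial>Q)"
        unfolding Fr Q_def
        by (intro nn_integral_cong arg_cong[where f=f])
           (use T in \<open>auto simp: br1_def br2_def b1_def b2_def fun_eq_iff max_absorb2\<close>)
      finally show "(\<integral>\<^sup>+\<omega>. \<gamma> z2 * (\<integral>\<^sup>+\<omega>'. ?G \<omega> z2 \<omega>' \<partial>N) \<partial>N) =
        \<gamma> z2 * (\<integral>\<^sup>+q. f (\<lambda>s\<in>{0..T}. (br1 T s q + z1 * s, br2 T s q + z2 * s)) \<partial>Q)" .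
    qed
    finally show "(\<integral>\<^sup>+\<omega>. (\<integral>\<^sup>+z2. \<gamma> z2 * (\<integral>\<^sup>+\<omega>'. ?G \<omega> z2 \<omega>' \<partial>N) \<partial>lborel) \<partial>N) =
      (\<integral>\<^sup>+z2. \<gamma> z2 * (\<integral>\<^sup>+q. f (\<lambda>s\<in>{0..T}. (br1 T s q + z1 * s, br2 T s q + z2 * s)) \<partial>Q) \<partial>lborel)" .
  qed
  finally show ?thesis by (simp add: T_def)
qed

end

section \<open>Ruin and terminal exceedance as bridge integrals\<close>

lemma ennreal_scaled_less_iff:
  assumes "0 < k" "0 \<le> l"
  shows "ennreal (l / k) < ennreal (1 / k) * X \<longleftrightarrow> ennreal l < X"
proof (cases X)
  case (real r)
  then have "ennreal (1 / k) * X = ennreal (r / k)" using assms by (simp add: ennreal_mult[symmetric])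
  then show ?thesis using assms real by (simp add: ennreal_less_iff divide_less_cancel)
next
  case top
  then show ?thesis using assms by (simp add: ennreal_mult_top)
qed

context brownian_pair
begin

text \<open>
  The density of the two slopes in the coordinates \<open>z\<^sub>1 = - (1 + c / u + x / u\<^sup>2)\<close> and \<open>z\<^sub>2 = - v / u\<close>. The
  first coordinate places the end point of the first drifted process at \<open>u + x / u\<close>; the second one
  leaves the second motion on its natural scale.
\<close>

definition terminal_weight :: "real \<Rightarrow> real \<Rightarrow> real \<Rightarrow> real \<Rightarrow> real" where
  "terminal_weight c u x v =
     exp (- u\<^sup>2 * (1 + c / u)\<^sup>2 / 2) / (u * sqrt (2 * pi)) *
     (exp (- x * (1 + c / u) - x\<^sup>2 / (2 * u\<^sup>2)) * std_normal_density v)"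

text \<open>
  The value of \<open>y\<close> for which the end point of the second drifted process is \<open>a u + y / u\<close>, in terms of
  the coordinates \<open>x\<close> and \<open>v\<close> of the slopes.
\<close>

definition second_excess :: "real \<Rightarrow> real \<Rightarrow> real \<Rightarrow> real \<Rightarrow> real \<Rightarrow> real \<Rightarrow> real" where
  "second_excess a c1 c2 u x v = (\<rho> - a) * u\<^sup>2 + u * (\<rho> * c1 - c2 + \<kappa> * v) + \<rho> * x"

text \<open>
  Both risk processes are negative at time \<open>1 - s / T\<close>, given the end points \<open>u + x / u\<close> and
  \<open>a u + y / u\<close> of the drifted processes.
\<close>

definition in_quadrant :: "real \<Rightarrow> real \<Rightarrow> real \<Rightarrow> real \<Rightarrow> real \<Rightarrow> 'b \<times> 'b \<Rightarrow> bool" where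
  "in_quadrant a T x y s q \<longleftrightarrow>
     0 < x - s - s * x / T + br1 T s q \<and>
     0 < y - a * s - s * y / T + (\<rho> * br1 T s q + \<kappa> * br2 T s q)"

definition bridge_occupation :: "real \<Rightarrow> real \<Rightarrow> real \<Rightarrow> real \<Rightarrow> 'b \<times> 'b \<Rightarrow> ennreal" where
  "bridge_occupation a T x y q = (\<integral>\<^sup>+s\<in>{0..T}. indicator {s. in_quadrant a T x y s q} s \<partial>lborel)"

text \<open>
  The change of variables from slopes to the coordinates of \<open>terminal_weight\<close>.
\<close>

lemma bridge_disintegration_local:
  fixes f :: "(real \<Rightarrow> real \<times> real) \<Rightarrow> ennreal"
  assumes u: "0 < u" and f: "f \<in> borel_measurable (Pi\<^sub>M {0..u\<^sup>2} (\<lambda>_. borel))"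
  shows "(\<integral>\<^sup>+q. f (\<lambda>s\<in>{0..u\<^sup>2}. (u * (b1 (1 - s / u\<^sup>2) q - b1 1 q), u * (b2 (1 - s / u\<^sup>2) q - b2 1 q))) \<partial>Q) =
    (\<integral>\<^sup>+x. (\<integral>\<^sup>+v. ennreal (terminal_weight c u x v) * (\<integral>\<^sup>+q. f (\<lambda>s\<in>{0..u\<^sup>2}.
       (br1 (u\<^sup>2) s q - (1 + c / u + x / u\<^sup>2) * s, br2 (u\<^sup>2) s q - v / u * s)) \<partial>Q) \<partial>lborel) \<partial>lborel)"
proof -
  define \<gamma> where "\<gamma> z = ennreal (sqrt (u\<^sup>2 / (2 * pi)) * exp (- u\<^sup>2 * z\<^sup>2 / 2))" for z
  define G where "G z1 z2 = (\<integral>\<^sup>+q. f (\<lambda>s\<in>{0..u\<^sup>2}. (br1 (u\<^sup>2) s q + z1 * s, br2 (u\<^sup>2) s q + z2 * s)) \<partial>Q)" for z1 z2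
  have [measurable]: "(\<lambda>z. \<gamma> (h z)) \<in> borel_measurable R" if [measurable]: "h \<in> borel_measurable R" for h R
    unfolding \<gamma>_def by measurable
  have "(\<lambda>((z1, z2), q). \<lambda>s\<in>{0..u\<^sup>2}. (br1 (u\<^sup>2) s q + z1 * s, br2 (u\<^sup>2) s q + z2 * s)) \<in>
      (borel \<Otimes>\<^sub>M borel) \<Otimes>\<^sub>M Q \<rightarrow>\<^sub>M Pi\<^sub>M {0..u\<^sup>2} (\<lambda>_. borel)"
    unfolding case_prod_beta' by (rule measurable_restrict) (simp only: borel_prod[symmetric], measurable)
  from measurable_compose[OF this f]
  have "(\<lambda>((z1, z2), q). f (\<lambda>s\<in>{0..u\<^sup>2}. (br1 (u\<^sup>2) s q + z1 * s, br2 (u\<^sup>2) s q + z2 * s))) \<in>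
      borel_measurable ((borel \<Otimes>\<^sub>M borel) \<Otimes>\<^sub>M Q)" by (simp add: case_prod_beta')
  from Q.borel_measurable_nn_integral_fst[OF this]
  have Gm: "(\<lambda>p. G (fst p) (snd p)) \<in> borel_measurable (borel \<Otimes>\<^sub>M borel)"
    by (simp add: G_def case_prod_beta')
  have [measurable]: "(\<lambda>z. G (h z) (k z)) \<in> borel_measurable R"
    if [measurable]: "h \<in> borel_measurable R" "k \<in> borel_measurable R" for h k R
    using measurable_compose[OF measurable_Pair[OF that] Gm] by simp
  have s1: "(\<integral>\<^sup>+z1. \<gamma> z1 * H z1 \<partial>lborel) =
      (\<integral>\<^sup>+x. ennreal (1 / u\<^sup>2) * (\<gamma> (- (1 + c / u + x / u\<^sup>2)) * H (- (1 + c / u + x / u\<^sup>2))) \<partial>lborel)"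
    if [measurable]: "H \<in> borel_measurable borel" for H
    using u by (subst nn_integral_real_affine[where c="- (1 / u\<^sup>2)" and t="- (1 + c / u)"])
      (simp_all add: nn_integral_cmult)
  have s2: "(\<integral>\<^sup>+z2. \<gamma> z2 * H z2 \<partial>lborel) = (\<integral>\<^sup>+v. ennreal (1 / u) * (\<gamma> (- (v / u)) * H (- (v / u))) \<partial>lborel)"
    if [measurable]: "H \<in> borel_measurable borel" for H
    using u by (subst nn_integral_real_affine[where c="- (1 / u)" and t="0"]) (simp_all add: nn_integral_cmult)
  have w: "ennreal (1 / u\<^sup>2) * \<gamma> (- (1 + c / u + x / u\<^sup>2)) * (ennreal (1 / u) * \<gamma> (- (v / u))) =
      ennreal (terminal_weight c u x v)" for x v
  proof -
    have e1: "- u\<^sup>2 * (- (1 + c / u + x / u\<^sup>2))\<^sup>2 / 2 = - u\<^sup>2 * (1 + c / u)\<^sup>2 / 2 + (- x * (1 + c / u) - x\<^sup>2 / (2 * u\<^sup>2))"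
      using u by (simp add: field_simps power2_eq_square)
    have e2: "- u\<^sup>2 * (- (v / u))\<^sup>2 / 2 = - v\<^sup>2 / 2" using u by (simp add: field_simps power2_eq_square)
    have e3: "sqrt (u\<^sup>2 / (2 * pi)) = u / sqrt (2 * pi)" using u by (simp add: real_sqrt_divide)
    show ?thesis
      unfolding \<gamma>_def e1 e2 e3 terminal_weight_def std_normal_density_def exp_add
      using u by (simp add: ennreal_mult[symmetric] power2_eq_square field_simps)
  qed
  have "(\<integral>\<^sup>+q. f (\<lambda>s\<in>{0..u\<^sup>2}. (u * (b1 (1 - s / u\<^sup>2) q - b1 1 q), u * (b2 (1 - s / u\<^sup>2) q - b2 1 q))) \<partial>Q) =
      (\<integral>\<^sup>+z1. \<gamma> z1 * (\<integral>\<^sup>+z2. \<gamma> z2 * G z1 z2 \<partial>lborel) \<partial>lborel)"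
    using bridge_disintegration[OF u f] by (simp add: G_def \<gamma>_def)
  also have "\<dots> = (\<integral>\<^sup>+x. ennreal (1 / u\<^sup>2) * (\<gamma> (- (1 + c / u + x / u\<^sup>2)) *
      (\<integral>\<^sup>+v. ennreal (1 / u) * (\<gamma> (- (v / u)) * G (- (1 + c / u + x / u\<^sup>2)) (- (v / u))) \<partial>lborel)) \<partial>lborel)"
    by (subst s1) (simp_all add: s2)
  also have "\<dots> = (\<integral>\<^sup>+x. (\<integral>\<^sup>+v. ennreal (terminal_weight c u x v) * G (- (1 + c / u + x / u\<^sup>2)) (- (v / u)) \<partial>lborel) \<partial>lborel)"
    by (simp add: nn_integral_cmult[symmetric] w[symmetric] mult.assoc del: mult_minus_left)
  finally show ?thesis unfolding G_def by (simp only: mult_minus_left add_uminus_conv_diff)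
qed

lemma start_at_zero: "AE q in Q. b1 0 q = 0 \<and> b2 0 q = 0"
proof -
  have "AE q in N \<Otimes>\<^sub>M N. b1 0 q = 0 \<and> b2 0 q = 0"
  proof (rule NN.AE_pair_measure)
    show "{x \<in> space (N \<Otimes>\<^sub>M N). b1 0 x = 0 \<and> b2 0 x = 0} \<in> sets (N \<Otimes>\<^sub>M N)"
      unfolding Q_def[symmetric] by measurable
    show "AE x in N. AE y in N. b1 0 (x, y) = 0 \<and> b2 0 (x, y) = 0"
      using standard_brownian_motionD(3)[OF B1]
    proof eventually_elim
      fix x assume "B1 0 x = 0"
      with standard_brownian_motionD(3)[OF B2]
      show "AE y in N. b1 0 (x, y) = 0 \<and> b2 0 (x, y) = 0"
        by (auto simp: b1_def b2_def)
    qed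
  qed
  then show ?thesis unfolding Q_def .
qed

lemma br_continuous:
  assumes "q \<in> space Q"
  shows "continuous_on A (\<lambda>s. br1 T s q)" "continuous_on A (\<lambda>s. br2 T s q)"
  unfolding br1_def br2_def divide_inverse
  by (intro continuous_intros b1_continuous b2_continuous assms)+

text \<open>
  Substitute \<open>t = 1 - s / u\<^sup>2\<close> in the occupation integral and multiply the two ruin conditions by
  \<open>u\<close>. They then read \<open>u b (1 - s / T) = V s - V T\<close> against a linear boundary, and inserting
  bridge plus slope for \<open>V\<close> turns them into \<open>in_quadrant\<close>.
\<close>

lemma ruin_prob_disintegration:
  assumes u: "0 < u" and L: "0 \<le> L"
  shows "emeasure Q {q\<in>space Q. (\<integral>\<^sup>+t\<in>{0..1}. indicator {t. u < b1 t q - c1 * t \<and> a * u < \<rho> * b1 t q + \<kappa> * b2 t q - c2 * t} t \<partial>lborel) > ennreal (L / u\<^sup>2)} =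
    (\<integral>\<^sup>+x. (\<integral>\<^sup>+v. ennreal (terminal_weight c1 u x v) *
       emeasure Q {q\<in>space Q. ennreal L < bridge_occupation a (u\<^sup>2) x (second_excess a c1 c2 u x v) q} \<partial>lborel) \<partial>lborel)"
proof -
  define T where "T = u\<^sup>2"
  have T: "0 < T" using u by (simp add: T_def)
  define H where "H = {(s, x, y). T < fst x - fst y - c1 * u * (1 - s / T) \<and>
      a * T < \<rho> * (fst x - fst y) + \<kappa> * (snd x - snd y) - c2 * u * (1 - s / T)} "
  have H: "H \<in> sets (borel \<Otimes>\<^sub>M borel \<Otimes>\<^sub>M (borel :: (real \<times> real) measure))"
  proof -
    have "{z\<in>space (borel \<Otimes>\<^sub>M borel \<Otimes>\<^sub>M (borel :: (real \<times> real) measure)).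
      T < fst (fst (snd z)) - fst (snd (snd z)) - c1 * u * (1 - fst z / T) \<and>
      a * T < \<rho> * (fst (fst (snd z)) - fst (snd (snd z))) + \<kappa> * (snd (fst (snd z)) - snd (snd (snd z))) - c2 * u * (1 - fst z / T)}
      \<in> sets (borel \<Otimes>\<^sub>M borel \<Otimes>\<^sub>M (borel :: (real \<times> real) measure))"
      unfolding borel_prod[symmetric] by measurable
    also have "{z\<in>space (borel \<Otimes>\<^sub>M borel \<Otimes>\<^sub>M (borel :: (real \<times> real) measure)).
      T < fst (fst (snd z)) - fst (snd (snd z)) - c1 * u * (1 - fst z / T) \<and>
      a * T < \<rho> * (fst (fst (snd z)) - fst (snd (snd z))) + \<kappa> * (snd (fst (snd z)) - snd (snd (snd z))) - c2 * u * (1 - fst z / T)} = H"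
      by (auto simp: H_def space_pair_measure)
    finally show ?thesis .
  qed
  define f :: "(real \<Rightarrow> real \<times> real) \<Rightarrow> ennreal" where "f = indicator {w. ennreal L < occupation {0..T} H T w}"
  have occm: "occupation {0..T} H T \<in> borel_measurable (Pi\<^sub>M {0..T} (\<lambda>_. borel))"
    by (rule measurable_occupation) (use H T in auto)
  have f: "f \<in> borel_measurable (Pi\<^sub>M {0..T} (\<lambda>_. borel))"
    unfolding f_def by (rule borel_measurable_indicator') (use occm in measurable)
  have occ: "occupation {0..T} H T (\<lambda>s\<in>{0..T}. g s) = (\<integral>\<^sup>+s. indicator {0..T} s * indicator H (s, g s, g T) \<partial>lborel)"
    if "continuous_on {0..T} g" for g
    by (rule occupation_continuous_path[OF that]) (use T in auto)
  let ?h = "\<lambda>q t. indicator {t. u < b1 t q - c1 * t \<and> a * u < \<rho> * b1 t q + \<kappa> * b2 t q - c2 * t} t * indicator {0..1} t :: ennreal"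
  have hm[measurable]: "(\<lambda>t. ?h q t) \<in> borel_measurable borel" if "q \<in> space Q" for q
  proof -
    have [measurable]: "(\<lambda>_. q) \<in> borel \<rightarrow>\<^sub>M Q" using that by simp
    show ?thesis by measurable
  qed
  let ?E = "{q\<in>space Q. (\<integral>\<^sup>+t. ?h q t \<partial>lborel) > ennreal (L / T)}"
  let ?V = "\<lambda>q. (\<lambda>s. (u * (b1 (1 - s / T) q - b1 1 q), u * (b2 (1 - s / T) q - b2 1 q)))"
  have E: "?E \<in> sets Q" by measurable
  have "emeasure Q ?E = (\<integral>\<^sup>+q. indicator ?E q \<partial>Q)" using E by simp
  also have "\<dots> = (\<integral>\<^sup>+q. f (\<lambda>s\<in>{0..T}. ?V q s) \<partial>Q)"
  proof (rule nn_integral_cong_AE)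
    show "AE q in Q. indicator ?E q = f (\<lambda>s\<in>{0..T}. ?V q s)"
      using start_at_zero AE_space
    proof eventually_elim
      fix q assume b0: "b1 0 q = 0 \<and> b2 0 q = 0" and q: "q \<in> space Q"
      have c: "continuous_on {0..T} (?V q)"
        unfolding divide_inverse
        by (intro continuous_intros continuous_on_compose2[OF b1_continuous[OF q, of UNIV]]
            continuous_on_compose2[OF b2_continuous[OF q, of UNIV]]) auto
      have "(\<integral>\<^sup>+t. ?h q t \<partial>lborel) = ennreal (1 / T) * (\<integral>\<^sup>+s. ?h q (1 - s / T) \<partial>lborel)"
        using T q by (subst nn_integral_real_affine[where c="- (1 / T)" and t=1]) simp_all
      also have "(\<integral>\<^sup>+s. ?h q (1 - s / T) \<partial>lborel) = (\<integral>\<^sup>+s. indicator {0..T} s * indicator H (s, ?V q s, ?V q T) \<partial>lborel)"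
      proof (rule nn_integral_cong)
        fix s
        have i: "1 - s / T \<in> {0..1} \<longleftrightarrow> s \<in> {0..T}" using T by (auto simp: field_simps)
        have k: "u < X - d * (1 - s / T) \<longleftrightarrow> T < u * X - d * u * (1 - s / T)"
          "a * u < X - d * (1 - s / T) \<longleftrightarrow> a * T < u * X - d * u * (1 - s / T)" for X d
        proof -
          have "u < X - d * (1 - s / T) \<longleftrightarrow> u * u < u * (X - d * (1 - s / T))" using u by simp
          then show "u < X - d * (1 - s / T) \<longleftrightarrow> T < u * X - d * u * (1 - s / T)"
            by (simp add: T_def power2_eq_square algebra_simps)
          have "a * u < X - d * (1 - s / T) \<longleftrightarrow> u * (a * u) < u * (X - d * (1 - s / T))" using u by simp
          then show "a * u < X - d * (1 - s / T) \<longleftrightarrow> a * T < u * X - d * u * (1 - s / T)"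
            by (simp add: T_def power2_eq_square algebra_simps)
        qed
        have "(u < b1 (1 - s / T) q - c1 * (1 - s / T) \<and> a * u < \<rho> * b1 (1 - s / T) q + \<kappa> * b2 (1 - s / T) q - c2 * (1 - s / T)) \<longleftrightarrow>
            (s, ?V q s, ?V q T) \<in> H"
          unfolding k
          using b0 T by (simp add: H_def algebra_simps)
        then show "?h q (1 - s / T) = indicator {0..T} s * indicator H (s, ?V q s, ?V q T)"
          using i by (simp add: indicator_def)
      qed
      also have "\<dots> = occupation {0..T} H T (\<lambda>s\<in>{0..T}. ?V q s)" by (rule occ[OF c, symmetric])
      finally have "(\<integral>\<^sup>+t. ?h q t \<partial>lborel) = ennreal (1 / T) * occupation {0..T} H T (\<lambda>s\<in>{0..T}. ?V q s)" .
      then show "indicator ?E q = f (\<lambda>s\<in>{0..T}. ?V q s)"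
        using q T L by (simp add: f_def indicator_def ennreal_scaled_less_iff)
    qed
  qed
  also have "\<dots> = (\<integral>\<^sup>+x. (\<integral>\<^sup>+v. ennreal (terminal_weight c1 u x v) * (\<integral>\<^sup>+q. f (\<lambda>s\<in>{0..T}.
       (br1 T s q - (1 + c1 / u + x / T) * s, br2 T s q - v / u * s)) \<partial>Q) \<partial>lborel) \<partial>lborel)"
    using bridge_disintegration_local[OF u, of f c1] f by (simp add: T_def)
  also have "\<dots> = (\<integral>\<^sup>+x. (\<integral>\<^sup>+v. ennreal (terminal_weight c1 u x v) *
       emeasure Q {q\<in>space Q. ennreal L < bridge_occupation a T x (second_excess a c1 c2 u x v) q} \<partial>lborel) \<partial>lborel)"
  proof (intro nn_integral_cong arg_cong2[where f="(*)"] refl)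
    fix x v
    let ?y = "second_excess a c1 c2 u x v"
    let ?g = "\<lambda>q s. (br1 T s q - (1 + c1 / u + x / T) * s, br2 T s q - v / u * s)"
    let ?F = "{q\<in>space Q. ennreal L < bridge_occupation a T x ?y q}"
    have F: "?F \<in> sets Q" unfolding bridge_occupation_def in_quadrant_def by measurable
    have "(\<integral>\<^sup>+q. f (\<lambda>s\<in>{0..T}. ?g q s) \<partial>Q) = (\<integral>\<^sup>+q. indicator ?F q \<partial>Q)"
    proof (rule nn_integral_cong)
      fix q assume q: "q \<in> space Q"
      have c: "continuous_on {0..T} (?g q)" by (intro continuous_intros br_continuous q)
      have "occupation {0..T} H T (\<lambda>s\<in>{0..T}. ?g q s) = bridge_occupation a T x ?y q"
        unfolding occ[OF c] bridge_occupation_def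
      proof (rule nn_integral_cong)
        fix s
        have z: "br1 T T q = 0" "br2 T T q = 0" using T by (simp_all add: br1_def br2_def)
        have e1: "fst (?g q s) - fst (?g q T) - c1 * u * (1 - s / T) - T = x - s - s * x / T + br1 T s q"
          using T u unfolding z fst_conv snd_conv
          by (simp add: T_def field_simps power2_eq_square)
        have e2: "\<rho> * (fst (?g q s) - fst (?g q T)) + \<kappa> * (snd (?g q s) - snd (?g q T)) - c2 * u * (1 - s / T) - a * T
            = ?y - a * s - s * ?y / T + (\<rho> * br1 T s q + \<kappa> * br2 T s q)"
          using T u unfolding z fst_conv snd_conv second_excess_def
          by (simp add: T_def field_simps power2_eq_square)
        have "(s, ?g q s, ?g q T) \<in> H \<longleftrightarrow> in_quadrant a T x ?y s q"
          unfolding in_quadrant_def e1[symmetric] e2[symmetric] by (simp add: H_def)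
        then show "indicator {0..T} s * indicator H (s, ?g q s, ?g q T) =
            (indicator {s. in_quadrant a T x ?y s q} s * indicator {0..T} s :: ennreal)"
          by (simp add: indicator_def)
      qed
      then show "f (\<lambda>s\<in>{0..T}. ?g q s) = indicator ?F q" using q by (simp add: f_def indicator_def)
    qed
    then show "(\<integral>\<^sup>+q. f (\<lambda>s\<in>{0..T}. ?g q s) \<partial>Q) = emeasure Q ?F" using F by simp
  qed
  finally show ?thesis by (simp add: T_def)
qed

text \<open>
  The same disintegration for the single time \<open>s = 0\<close>. The bridge vanishes at \<open>T\<close>, and only the signs
  of the two excesses remain.
\<close>

lemma terminal_prob_disintegration:
  assumes u: "0 < u"
  shows "emeasure Q {q\<in>space Q. u < b1 1 q - c1 \<and> a * u < \<rho> * b1 1 q + \<kappa> * b2 1 q - c2} =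
    (\<integral>\<^sup>+x. (\<integral>\<^sup>+v. ennreal (terminal_weight c1 u x v) *
       indicator {0<..} x * indicator {0<..} (second_excess a c1 c2 u x v) \<partial>lborel) \<partial>lborel)"
proof -
  define T where "T = u\<^sup>2"
  have T: "0 < T" using u by (simp add: T_def)
  define f :: "(real \<Rightarrow> real \<times> real) \<Rightarrow> ennreal" where
    "f = indicator {w. T < - fst (w T) - c1 * u \<and> a * T < - (\<rho> * fst (w T) + \<kappa> * snd (w T)) - c2 * u}"
  have f: "f \<in> borel_measurable (Pi\<^sub>M {0..T} (\<lambda>_. borel))"
  proof -
    have "(\<lambda>w. w T) \<in> Pi\<^sub>M {0..T} (\<lambda>_. borel :: (real \<times> real) measure) \<rightarrow>\<^sub>M borel \<Otimes>\<^sub>M borel"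
      unfolding borel_prod using T by simp
    then have [measurable]: "(\<lambda>w. fst (w T)) \<in> borel_measurable (Pi\<^sub>M {0..T} (\<lambda>_. borel :: (real \<times> real) measure))"
      "(\<lambda>w. snd (w T)) \<in> borel_measurable (Pi\<^sub>M {0..T} (\<lambda>_. borel :: (real \<times> real) measure))"
      by measurable
    show ?thesis unfolding f_def by (rule borel_measurable_indicator') measurable
  qed
  let ?E = "{q\<in>space Q. u < b1 1 q - c1 \<and> a * u < \<rho> * b1 1 q + \<kappa> * b2 1 q - c2}"
  have E: "?E \<in> sets Q" by measurable
  let ?V = "\<lambda>q. (\<lambda>s. (u * (b1 (1 - s / T) q - b1 1 q), u * (b2 (1 - s / T) q - b2 1 q)))"
  have "emeasure Q ?E = (\<integral>\<^sup>+q. indicator ?E q \<partial>Q)" using E by simp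
  also have "\<dots> = (\<integral>\<^sup>+q. f (\<lambda>s\<in>{0..T}. ?V q s) \<partial>Q)"
  proof (rule nn_integral_cong_AE)
    show "AE q in Q. indicator ?E q = f (\<lambda>s\<in>{0..T}. ?V q s)"
      using start_at_zero AE_space
    proof eventually_elim
      fix q assume b0: "b1 0 q = 0 \<and> b2 0 q = 0" and q: "q \<in> space Q"
      have k: "u < X - d \<longleftrightarrow> T < u * X - d * u" "a * u < X - d \<longleftrightarrow> a * T < u * X - d * u" for X d
      proof -
        have "u < X - d \<longleftrightarrow> u * u < u * (X - d)" using u by simp
        then show "u < X - d \<longleftrightarrow> T < u * X - d * u" by (simp add: T_def power2_eq_square algebra_simps)
        have "a * u < X - d \<longleftrightarrow> u * (a * u) < u * (X - d)" using u by simp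
        then show "a * u < X - d \<longleftrightarrow> a * T < u * X - d * u" by (simp add: T_def power2_eq_square algebra_simps)
      qed
      have "(u < b1 1 q - c1 \<and> a * u < \<rho> * b1 1 q + \<kappa> * b2 1 q - c2) \<longleftrightarrow>
         T < - fst (?V q T) - c1 * u \<and> a * T < - (\<rho> * fst (?V q T) + \<kappa> * snd (?V q T)) - c2 * u"
        unfolding k using b0 T by (simp add: algebra_simps)
      then show "indicator ?E q = f (\<lambda>s\<in>{0..T}. ?V q s)" using q T by (simp add: f_def indicator_def)
    qed
  qed
  also have "\<dots> = (\<integral>\<^sup>+x. (\<integral>\<^sup>+v. ennreal (terminal_weight c1 u x v) * (\<integral>\<^sup>+q. f (\<lambda>s\<in>{0..T}.
       (br1 T s q - (1 + c1 / u + x / T) * s, br2 T s q - v / u * s)) \<partial>Q) \<partial>lborel) \<partial>lborel)"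
    using bridge_disintegration_local[OF u, of f c1] f by (simp add: T_def)
  also have "\<dots> = (\<integral>\<^sup>+x. (\<integral>\<^sup>+v. ennreal (terminal_weight c1 u x v) *
       indicator {0<..} x * indicator {0<..} (second_excess a c1 c2 u x v) \<partial>lborel) \<partial>lborel)"
  proof (intro nn_integral_cong)
    fix x v
    let ?g = "\<lambda>q s. (br1 T s q - (1 + c1 / u + x / T) * s, br2 T s q - v / u * s)"
    have "f (\<lambda>s\<in>{0..T}. ?g q s) = indicator {0<..} x * indicator {0<..} (second_excess a c1 c2 u x v)" for q
    proof -
      have z: "br1 T T q = 0" "br2 T T q = 0" using T by (simp_all add: br1_def br2_def)
      have e1: "- fst (?g q T) - c1 * u - T = x"
        using T u unfolding z fst_conv by (simp add: T_def field_simps power2_eq_square)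
      have e2: "- (\<rho> * fst (?g q T) + \<kappa> * snd (?g q T)) - c2 * u - a * T = second_excess a c1 c2 u x v"
        using T u unfolding z fst_conv snd_conv second_excess_def by (simp add: T_def field_simps power2_eq_square)
      have "(T < - fst (?g q T) - c1 * u \<and> a * T < - (\<rho> * fst (?g q T) + \<kappa> * snd (?g q T)) - c2 * u) \<longleftrightarrow>
         0 < x \<and> 0 < second_excess a c1 c2 u x v"
        using e1 e2 by linarith
      then show ?thesis using T by (simp add: f_def indicator_def)
    qed
    then show "ennreal (terminal_weight c1 u x v) * (\<integral>\<^sup>+q. f (\<lambda>s\<in>{0..T}. ?g q s) \<partial>Q) =
       ennreal (terminal_weight c1 u x v) * indicator {0<..} x * indicator {0<..} (second_excess a c1 c2 u x v)"
      by (simp add: Q.emeasure_space_1 mult.assoc)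
  qed
  finally show ?thesis .
qed

end

section \<open>Stability of occupation-time probabilities\<close>

lemma (in prob_space) prob_diff_le_symdiff:
  assumes [measurable]: "Measurable.pred M P" "Measurable.pred M P'"
  shows "\<bar>prob {q\<in>space M. P q} - prob {q\<in>space M. P' q}\<bar> \<le> prob {q\<in>space M. P q \<noteq> P' q}"
proof -
  have "prob {q\<in>space M. P q} \<le> prob {q\<in>space M. P' q} + prob {q\<in>space M. P q \<noteq> P' q}"
    by (rule order_trans[OF finite_measure_mono measure_Un_le]) auto
  moreover have "prob {q\<in>space M. P' q} \<le> prob {q\<in>space M. P q} + prob {q\<in>space M. P q \<noteq> P' q}"
    by (rule order_trans[OF finite_measure_mono measure_Un_le]) auto
  ultimately show ?thesis by linarith
qed

text \<open>
  Continuity from above, in the form in which it controls the exceptional set where a random variable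
  is close to a value that it attains with probability 0.
\<close>

lemma (in prob_space) shrinking_neighbourhood:
  fixes P :: "nat \<Rightarrow> 'a \<Rightarrow> bool"
  assumes meas[measurable]: "\<And>n. Measurable.pred M (P n)"
    and dec: "\<And>m n q. m \<le> n \<Longrightarrow> P n q \<Longrightarrow> P m q"
    and null: "prob {q\<in>space M. \<forall>n. P n q} = 0" and e: "0 < e"
  obtains n where "prob {q\<in>space M. P n q} < e"
proof -
  have "(\<lambda>n. prob {q\<in>space M. P n q}) \<longlonglongrightarrow> prob (\<Inter>n. {q\<in>space M. P n q})"
    by (rule finite_Lim_measure_decseq) (auto simp: decseq_def dest: dec)
  also have "(\<Inter>n. {q\<in>space M. P n q}) = {q\<in>space M. \<forall>n. P n q}" by auto
  finally have "(\<lambda>n. prob {q\<in>space M. P n q}) \<longlonglongrightarrow> 0" using null by simp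
  from order_tendstoD(2)[OF this e] that show ?thesis
    by (auto simp: eventually_sequentially)
qed

text \<open>
  The sign of \<open>X\<close> can only be changed by a perturbation \<open>R\<close> of absolute value at least \<open>\<bar>X\<bar>\<close>; either
  \<open>\<bar>X\<bar>\<close> is small, which is unlikely since \<open>X\<close> has no atom at 0, or \<open>\<bar>R\<bar>\<close> is large, which is unlikely by
  Markov's inequality.
\<close>

lemma (in prob_space) sign_stable:
  fixes R :: "real \<Rightarrow> 'a \<Rightarrow> real"
  assumes [measurable]: "X \<in> borel_measurable M"
    and null: "prob {q\<in>space M. X q = 0} = 0"
    and int: "\<And>u. integrable M (R u)"
    and h: "\<forall>\<^sub>F u in at_top. expectation (\<lambda>q. \<bar>R u q\<bar>) \<le> h u" "(h \<longlongrightarrow> 0) at_top"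
  shows "((\<lambda>u. prob {q\<in>space M. (0 < X q + R u q) \<noteq> (0 < X q)}) \<longlongrightarrow> 0) at_top"
proof (rule tendstoI)
  have [measurable]: "R u \<in> borel_measurable M" for u using int by (rule borel_measurable_integrable)
  fix e :: real assume e: "0 < e"
  obtain n where n: "prob {q\<in>space M. \<bar>X q\<bar> < 1 / real (Suc n)} < e / 2"
  proof (rule shrinking_neighbourhood[where P="\<lambda>n q. \<bar>X q\<bar> < 1 / real (Suc n)" and e="e / 2"])
    show "\<bar>X q\<bar> < 1 / real (Suc m)" if "m \<le> n" "\<bar>X q\<bar> < 1 / real (Suc n)" for m n q
      by (rule less_le_trans[OF that(2)]) (use that(1) in \<open>simp add: frac_le\<close>)
    have "(\<forall>n. \<bar>X q\<bar> < 1 / real (Suc n)) \<longleftrightarrow> X q = 0" for q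
    proof
      assume *: "\<forall>n. \<bar>X q\<bar> < 1 / real (Suc n)"
      show "X q = 0"
      proof (rule ccontr)
        assume "X q \<noteq> 0"
        then obtain n where "inverse (real (Suc n)) < \<bar>X q\<bar>" using reals_Archimedean[of "\<bar>X q\<bar>"] by auto
        with *[rule_format, of n] show False by (simp add: inverse_eq_divide)
      qed
    qed simp
    then show "prob {q\<in>space M. \<forall>n. \<bar>X q\<bar> < 1 / real (Suc n)} = 0" using null by simp
  qed (use e in auto)
  define d where "d = 1 / real (Suc n)"
  have d: "0 < d" by (simp add: d_def)
  have "\<forall>\<^sub>F u in at_top. h u < e / 2 * d"
    using h(2) d e by (intro order_tendstoD(2)) auto
  with h(1) show "\<forall>\<^sub>F u in at_top. dist (prob {q\<in>space M. (0 < X q + R u q) \<noteq> (0 < X q)}) 0 < e"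
  proof eventually_elim
    fix u assume u: "expectation (\<lambda>q. \<bar>R u q\<bar>) \<le> h u" "h u < e / 2 * d"
    have "prob {q\<in>space M. (0 < X q + R u q) \<noteq> (0 < X q)} \<le>
      prob ({q\<in>space M. \<bar>X q\<bar> < d} \<union> {q\<in>space M. d \<le> \<bar>R u q\<bar>})"
      by (rule finite_measure_mono) auto
    also have "\<dots> \<le> prob {q\<in>space M. \<bar>X q\<bar> < d} + prob {q\<in>space M. d \<le> \<bar>R u q\<bar>}"
      by (rule measure_Un_le) auto
    also have "prob {q\<in>space M. d \<le> \<bar>R u q\<bar>} \<le> expectation (\<lambda>q. \<bar>R u q\<bar>) / d"
      by (rule integral_Markov_inequality_measure[where A="{}"]) (use int d in auto)
    also have "\<dots> < e / 2" using u d by (simp add: field_simps)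
    finally show "dist (prob {q\<in>space M. (0 < X q + R u q) \<noteq> (0 < X q)}) 0 < e"
      using n by (simp add: d_def)
  qed
qed

text \<open>
  The mean of the Lebesgue measure \<open>D u\<close> of the times at which \<open>A u\<close> and \<open>A0\<close> differ is the integral over
  \<open>s\<close> of the probabilities that they differ at time \<open>s\<close>, and tends to 0 by dominated convergence. If \<open>D u\<close> is
  smaller than \<open>d\<close>, the two occupation times can lie on different sides of \<open>L\<close> only if the limiting one
  is within \<open>d\<close> of \<open>L\<close>.
\<close>

lemma (in prob_space) occupation_prob_tendsto:
  fixes A :: "real \<Rightarrow> real \<Rightarrow> 'a \<Rightarrow> bool" and A0 :: "real \<Rightarrow> 'a \<Rightarrow> bool" and L :: real
  assumes A: "\<And>u. Measurable.pred (lborel \<Otimes>\<^sub>M M) (\<lambda>z. A u (fst z) (snd z))"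
    and A0: "Measurable.pred (lborel \<Otimes>\<^sub>M M) (\<lambda>z. A0 (fst z) (snd z))"
    and g: "integrable lborel g"
    and bound: "\<forall>\<^sub>F u in at_top. \<forall>s. prob {q\<in>space M. A u s q} \<le> g s"
    and conv: "AE s in lborel. ((\<lambda>u. prob {q\<in>space M. A u s q \<noteq> A0 s q}) \<longlongrightarrow> 0) at_top"
    and L: "0 < L"
    and null: "prob {q\<in>space M. (\<integral>\<^sup>+s. indicator {s. A0 s q} s \<partial>lborel) = ennreal L} = 0"
  shows "((\<lambda>u. prob {q\<in>space M. ennreal L < (\<integral>\<^sup>+s. indicator {s. A u s q} s \<partial>lborel)}) \<longlongrightarrow>
          prob {q\<in>space M. ennreal L < (\<integral>\<^sup>+s. indicator {s. A0 s q} s \<partial>lborel)}) at_top"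
proof -
  interpret LM: pair_sigma_finite lborel M ..
  have m1[measurable (raw)]: "Measurable.pred R (\<lambda>r. A u (f r) (h r))"
    if "f \<in> borel_measurable R" "h \<in> R \<rightarrow>\<^sub>M M" for f h u and R :: "'r measure"
    using measurable_compose[OF measurable_Pair[of f R lborel h M] A[of u]] that by simp
  have m0[measurable (raw)]: "Measurable.pred R (\<lambda>r. A0 (f r) (h r))"
    if "f \<in> borel_measurable R" "h \<in> R \<rightarrow>\<^sub>M M" for f h and R :: "'r measure"
    using measurable_compose[OF measurable_Pair[of f R lborel h M] A0] that by simp
  let ?F = "\<lambda>u q. \<integral>\<^sup>+s. indicator {s. A u s q} s \<partial>lborel"
  let ?G = "\<lambda>q. \<integral>\<^sup>+s. indicator {s. A0 s q} s \<partial>lborel"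
  let ?D = "\<lambda>u q. \<integral>\<^sup>+s. indicator {s. A u s q \<noteq> A0 s q} s \<partial>lborel"
  let ?p = "\<lambda>u s. prob {q\<in>space M. A u s q \<noteq> A0 s q}"
  have FD: "?F u q \<le> ?G q + ?D u q" "?G q \<le> ?F u q + ?D u q" if "q \<in> space M" for u q
  proof -
    have [measurable]: "(\<lambda>_. q) \<in> borel \<rightarrow>\<^sub>M M" using that by simp
    show "?F u q \<le> ?G q + ?D u q" (is "?LHS \<le> ?RHS")
    proof -
      have "?LHS \<le> (\<integral>\<^sup>+s. indicator {s. A0 s q} s + indicator {s. A u s q \<noteq> A0 s q} s \<partial>lborel)"
        by (intro nn_integral_mono) (auto split: split_indicator)
      also have "\<dots> = ?RHS" by (rule nn_integral_add) measurable
      finally show ?thesis .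
    qed
    show "?G q \<le> ?F u q + ?D u q" (is "?LHS \<le> ?RHS")
    proof -
      have "?LHS \<le> (\<integral>\<^sup>+s. indicator {s. A u s q} s + indicator {s. A u s q \<noteq> A0 s q} s \<partial>lborel)"
        by (intro nn_integral_mono) (auto split: split_indicator)
      also have "\<dots> = ?RHS" by (rule nn_integral_add) measurable
      finally show ?thesis .
    qed
  qed
  have pm[measurable]: "?p u \<in> borel_measurable lborel" for u
  proof -
    have "(\<lambda>s. emeasure M (Pair s -` {z\<in>space (lborel \<Otimes>\<^sub>M M). A u (fst z) (snd z) \<noteq> A0 (fst z) (snd z)})) \<in> borel_measurable lborel"
      by (rule measurable_emeasure_Pair) measurable
    also have "(\<lambda>s. emeasure M (Pair s -` {z\<in>space (lborel \<Otimes>\<^sub>M M). A u (fst z) (snd z) \<noteq> A0 (fst z) (snd z)})) =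
       (\<lambda>s. emeasure M {q\<in>space M. A u s q \<noteq> A0 s q})"
      by (intro ext arg_cong[where f="emeasure M"]) (auto simp: space_pair_measure)
    finally show ?thesis unfolding measure_def by measurable
  qed
  \<comment> \<open>the bound passes to the limit, since the probabilities of \<open>A u\<close> converge to that of \<open>A0\<close>\<close>
  have A0_bound: "AE s in lborel. prob {q\<in>space M. A0 s q} \<le> g s"
    using conv
  proof eventually_elim
    fix s assume c: "((\<lambda>u. ?p u s) \<longlongrightarrow> 0) at_top"
    show "prob {q\<in>space M. A0 s q} \<le> g s"
    proof (rule tendsto_le[OF _ _ tendsto_const])
      show "((\<lambda>u. g s + ?p u s) \<longlongrightarrow> g s) at_top" using tendsto_add[OF tendsto_const c, of "g s"] by simp
      show "\<forall>\<^sub>F u in at_top. prob {q\<in>space M. A0 s q} \<le> g s + ?p u s"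
        using bound
      proof eventually_elim
        fix u assume b: "\<forall>s. prob {q\<in>space M. A u s q} \<le> g s"
        have "\<bar>prob {q\<in>space M. A u s q} - prob {q\<in>space M. A0 s q}\<bar> \<le> ?p u s"
          by (rule prob_diff_le_symdiff) measurable
        with b[rule_format, of s] show "prob {q\<in>space M. A0 s q} \<le> g s + ?p u s" by linarith
      qed
    qed simp
  qed
  have pbound: "\<forall>\<^sub>F u in at_top. AE s in lborel. norm (?p u s) \<le> 2 * g s"
    using bound
  proof eventually_elim
    fix u assume b: "\<forall>s. prob {q\<in>space M. A u s q} \<le> g s"
    show "AE s in lborel. norm (?p u s) \<le> 2 * g s"
      using A0_bound
    proof eventually_elim
      fix s assume b0: "prob {q\<in>space M. A0 s q} \<le> g s"
      have "?p u s \<le> prob ({q\<in>space M. A u s q} \<union> {q\<in>space M. A0 s q})"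
        by (rule finite_measure_mono) auto
      also have "\<dots> \<le> prob {q\<in>space M. A u s q} + prob {q\<in>space M. A0 s q}"
        by (rule measure_Un_le) auto
      finally show "norm (?p u s) \<le> 2 * g s" using b[rule_format, of s] b0 by simp
    qed
  qed
  have lim: "((\<lambda>u. LINT s|lborel. ?p u s) \<longlongrightarrow> (LINT s|(lborel::real measure). 0)) at_top"
    by (rule integral_dominated_convergence_at_top[where w="\<lambda>s. 2 * g s"])
       (use g conv pbound in auto)
  have ED: "\<forall>\<^sub>F u in at_top. (\<integral>\<^sup>+q. ?D u q \<partial>M) = ennreal (LINT s|lborel. ?p u s)"
    using pbound
  proof eventually_elim
    fix u assume b: "AE s in lborel. norm (?p u s) \<le> 2 * g s"
    have int: "integrable lborel (?p u)"
      by (rule Bochner_Integration.integrable_bound[of lborel "\<lambda>s. 2 * g s"]) (use g b in auto)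
    have "(\<integral>\<^sup>+q. ?D u q \<partial>M) = (\<integral>\<^sup>+s. (\<integral>\<^sup>+q. indicator {s. A u s q \<noteq> A0 s q} s \<partial>M) \<partial>lborel)"
      by (rule LM.Fubini') measurable
    also have "\<dots> = (\<integral>\<^sup>+s. ennreal (?p u s) \<partial>lborel)"
    proof (rule nn_integral_cong)
      fix s
      have "(\<integral>\<^sup>+q. indicator {s. A u s q \<noteq> A0 s q} s \<partial>M) = (\<integral>\<^sup>+q. indicator {q\<in>space M. A u s q \<noteq> A0 s q} q \<partial>M)"
        by (intro nn_integral_cong) (simp add: indicator_def)
      also have "\<dots> = ennreal (?p u s)"
        by (subst nn_integral_indicator) (auto simp: emeasure_eq_measure)
      finally show "(\<integral>\<^sup>+q. indicator {s. A u s q \<noteq> A0 s q} s \<partial>M) = ennreal (?p u s)" .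
    qed
    also have "\<dots> = ennreal (LINT s|lborel. ?p u s)"
      by (rule nn_integral_eq_integral[OF int]) simp
    finally show "(\<integral>\<^sup>+q. ?D u q \<partial>M) = ennreal (LINT s|lborel. ?p u s)" .
  qed
  show ?thesis
  proof (rule tendstoI)
    fix e :: real assume e: "0 < e"
    have [measurable]: "?G \<in> borel_measurable M" "?F u \<in> borel_measurable M" "?D u \<in> borel_measurable M" for u
      by measurable
    obtain n where n: "prob {q\<in>space M. ennreal L \<le> ?G q + ennreal (1 / real (Suc n)) \<and> ?G q \<le> ennreal L + ennreal (1 / real (Suc n))} < e / 2"
    proof (rule shrinking_neighbourhood[where P="\<lambda>n q. ennreal L \<le> ?G q + ennreal (1 / real (Suc n)) \<and> ?G q \<le> ennreal L + ennreal (1 / real (Suc n))" and e="e / 2"])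
      fix m n :: nat and q assume "m \<le> n" and *: "ennreal L \<le> ?G q + ennreal (1 / real (Suc n)) \<and> ?G q \<le> ennreal L + ennreal (1 / real (Suc n))"
      have "ennreal (1 / real (Suc n)) \<le> ennreal (1 / real (Suc m))"
        using \<open>m \<le> n\<close> by (intro ennreal_leI) (simp add: frac_le)
      with * show "ennreal L \<le> ?G q + ennreal (1 / real (Suc m)) \<and> ?G q \<le> ennreal L + ennreal (1 / real (Suc m))"
        by (meson add_left_mono order_trans)
    next
      have "?G q = ennreal L" if *: "\<forall>n. ennreal L \<le> ?G q + ennreal (1 / real (Suc n)) \<and> ?G q \<le> ennreal L + ennreal (1 / real (Suc n))" for q
      proof -
        have t: "(\<lambda>n. c + ennreal (1 / real (Suc n))) \<longlonglongrightarrow> c + ennreal 0" for c :: ennreal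
          by (intro tendsto_intros tendsto_ennrealI LIMSEQ_Suc lim_1_over_n)
        have "ennreal L \<le> ?G q + ennreal 0"
          by (rule LIMSEQ_le_const[OF t]) (use * in auto)
        moreover have "?G q \<le> ennreal L + ennreal 0"
          by (rule LIMSEQ_le_const[OF t]) (use * in auto)
        ultimately show ?thesis by simp
      qed
      then have "prob {q\<in>space M. \<forall>n. ennreal L \<le> ?G q + ennreal (1 / real (Suc n)) \<and> ?G q \<le> ennreal L + ennreal (1 / real (Suc n))} \<le>
         prob {q\<in>space M. ?G q = ennreal L}"
        by (intro finite_measure_mono) auto
      then show "prob {q\<in>space M. \<forall>n. ennreal L \<le> ?G q + ennreal (1 / real (Suc n)) \<and> ?G q \<le> ennreal L + ennreal (1 / real (Suc n))} = 0"
        using null by (simp add: measure_le_0_iff)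
    qed (use e in auto)
    define d where "d = 1 / real (Suc n)"
    have d: "0 < d" by (simp add: d_def)
    have "\<forall>\<^sub>F u in at_top. (LINT s|lborel. ?p u s) < e / 2 * d"
      using lim d e by (intro order_tendstoD(2)[of _ 0]) auto
    with ED show "\<forall>\<^sub>F u in at_top. dist (prob {q\<in>space M. ennreal L < ?F u q}) (prob {q\<in>space M. ennreal L < ?G q}) < e"
    proof eventually_elim
      fix u assume ED: "(\<integral>\<^sup>+q. ?D u q \<partial>M) = ennreal (LINT s|lborel. ?p u s)" and small: "(LINT s|lborel. ?p u s) < e / 2 * d"
      let ?near = "{q\<in>space M. ennreal L \<le> ?G q + ennreal d \<and> ?G q \<le> ennreal L + ennreal d}"
      have "\<bar>prob {q\<in>space M. ennreal L < ?F u q} - prob {q\<in>space M. ennreal L < ?G q}\<bar> \<le>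
          prob {q\<in>space M. (ennreal L < ?F u q) \<noteq> (ennreal L < ?G q)}"
        by (rule prob_diff_le_symdiff) measurable
      also have "\<dots> \<le> prob (?near \<union> {q\<in>space M. ennreal d \<le> ?D u q})"
      proof (rule finite_measure_mono)
        show "{q\<in>space M. (ennreal L < ?F u q) \<noteq> (ennreal L < ?G q)} \<subseteq> ?near \<union> {q\<in>space M. ennreal d \<le> ?D u q}"
        proof
          fix q assume q: "q \<in> {q\<in>space M. (ennreal L < ?F u q) \<noteq> (ennreal L < ?G q)}"
          then have sp: "q \<in> space M" by simp
          show "q \<in> ?near \<union> {q\<in>space M. ennreal d \<le> ?D u q}"
          proof (cases "ennreal d \<le> ?D u q")
            case True then show ?thesis using sp by simp
          next
            case False
            then have D: "?D u q \<le> ennreal d" by simp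
            have "?F u q \<le> ?G q + ennreal d" "?G q \<le> ?F u q + ennreal d"
              using FD[OF sp, of u] D by (meson add_left_mono order_trans)+
            moreover have "ennreal L \<le> ?G q \<Longrightarrow> ennreal L \<le> ?G q + ennreal d" "?G q \<le> ennreal L \<Longrightarrow> ?G q \<le> ennreal L + ennreal d"
              by (simp_all add: add_increasing2)
            moreover have "?F u q \<le> ennreal L \<Longrightarrow> ?F u q + ennreal d \<le> ennreal L + ennreal d" by (rule add_right_mono)
            ultimately have "ennreal L \<le> ?G q + ennreal d \<and> ?G q \<le> ennreal L + ennreal d"
              using q by (cases "ennreal L < ?F u q"; cases "ennreal L < ?G q") (auto simp: not_less intro: order_trans less_imp_le)
            then show ?thesis using sp by simp
          qed
        qed
      qed measurable
      also have "\<dots> \<le> prob ?near + prob {q\<in>space M. ennreal d \<le> ?D u q}"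
        by (rule measure_Un_le) measurable
      also have "prob {q\<in>space M. ennreal d \<le> ?D u q} \<le> (LINT s|lborel. ?p u s) / d"
      proof -
        have "emeasure M {q\<in>space M. 1 \<le> ennreal (1 / d) * ?D u q} \<le> ennreal (1 / d) * (\<integral>\<^sup>+q. ?D u q * indicator (space M) q \<partial>M)"
          by (rule nn_integral_Markov_inequality) measurable
        also have "(\<integral>\<^sup>+q. ?D u q * indicator (space M) q \<partial>M) = ennreal (LINT s|lborel. ?p u s)"
          by (subst ED[symmetric]) (intro nn_integral_cong, simp)
        also have "{q\<in>space M. 1 \<le> ennreal (1 / d) * ?D u q} = {q\<in>space M. ennreal d \<le> ?D u q}"
        proof -
          have "1 \<le> ennreal (1 / d) * X \<longleftrightarrow> ennreal d \<le> X" for X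
            using d by (cases X) (simp_all add: ennreal_mult[symmetric] ennreal_1[symmetric] ennreal_mult_top divide_simps del: ennreal_1)
          then show ?thesis by simp
        qed
        finally show ?thesis
          using d by (simp add: emeasure_eq_measure ennreal_mult[symmetric])
      qed
      also have "\<dots> < e / 2" using small d by (simp add: field_simps)
      finally show "dist (prob {q\<in>space M. ennreal L < ?F u q}) (prob {q\<in>space M. ennreal L < ?G q}) < e"
        using n by (simp add: dist_real_def d_def)
    qed
  qed
qed

text \<open>
  If the time spent above two levels is the same finite number, the path spends no time strictly
  between them. By continuity it then never takes a value strictly between them, so by the
  intermediate value theorem it stays above the lower level for all time (as \<open>L > 0\<close>, it is somewhere
  above the upper one), and the occupation time is infinite.
\<close>

lemma occupation_level_unique:
  fixes m :: "real \<Rightarrow> real"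
  assumes m: "continuous_on {0..} m" and L: "0 < L" and r: "r1 < r2"
    and e1: "(\<integral>\<^sup>+s. indicator {s. 0 \<le> s \<and> r1 < m s} s \<partial>lborel) = ennreal L"
    and e2: "(\<integral>\<^sup>+s. indicator {s. 0 \<le> s \<and> r2 < m s} s \<partial>lborel) = ennreal L"
  shows False
proof -
  let ?S = "\<lambda>r. {s. 0 \<le> s \<and> r < m s}"
  have mm: "?S r \<in> sets borel" for r
  proof -
    have "open {x. r < x}" by (simp add: open_Collect_less)
    then obtain U where U: "open U" "U \<inter> {0..} = {0..} \<inter> m -` {x. r < x}"
      using m unfolding continuous_on_open_invariant by (metis Int_commute)
    have "?S r = U \<inter> {0..}" using U by auto
    then show ?thesis using U(1) by auto
  qed
  have em: "emeasure lborel (?S r1) = ennreal L" "emeasure lborel (?S r2) = ennreal L"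
    using e1 e2 mm by simp_all
  have "?S r2 \<subseteq> ?S r1" using r by auto
  then have d0: "emeasure lborel (?S r1 - ?S r2) = 0"
    using emeasure_Diff[of lborel "?S r2" "?S r1"] mm em by simp
  have gap: False if s: "0 \<le> s" "r1 < m s" "m s < r2" for s
  proof -
    define e where "e = min (m s - r1) (r2 - m s)"
    have "0 < e" using s by (simp add: e_def)
    then obtain d where d: "0 < d" "\<And>x. 0 \<le> x \<Longrightarrow> dist x s < d \<Longrightarrow> dist (m x) (m s) < e"
      using m s(1) unfolding continuous_on_iff by (metis atLeast_iff)
    have "{s..<s + d} \<subseteq> ?S r1 - ?S r2"
    proof
      fix x assume x: "x \<in> {s..<s + d}"
      then have "dist (m x) (m s) < e" using s by (intro d) (auto simp: dist_real_def)
      then show "x \<in> ?S r1 - ?S r2" using x s by (auto simp: e_def dist_real_def abs_less_iff)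
    qed
    then have "emeasure lborel {s..<s + d} \<le> emeasure lborel (?S r1 - ?S r2)"
      using mm by (intro emeasure_mono) auto
    then show False using d0 d(1) by simp
  qed
  obtain s2 where s2: "0 \<le> s2" "r2 < m s2"
  proof -
    have "?S r2 \<noteq> {}"
    proof
      assume "?S r2 = {}"
      then have "emeasure lborel (?S r2) = 0" by (simp only: emeasure_empty)
      then show False using em(2) L by simp
    qed
    then show ?thesis using that by auto
  qed
  define r where "r = (r1 + r2) / 2"
  have r': "r1 < r" "r < r2" using r by (simp_all add: r_def)
  show False
  proof (cases "\<forall>s\<ge>0. r1 < m s")
    case True
    then have "?S r1 = {0..}" by auto
    then have "emeasure lborel {0::real..} = ennreal L" using em(1) by simp
    moreover have "emeasure lborel {0..L + 1} \<le> emeasure lborel {0::real..}" by (rule emeasure_mono) auto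
    ultimately show False using L by (simp add: ennreal_le_iff)
  next
    case False
    then obtain s1 where s1: "0 \<le> s1" "m s1 \<le> r1" by (auto simp: not_less)
    have c: "continuous_on {min s1 s2..max s1 s2} m"
      by (rule continuous_on_subset[OF m]) (use s1 s2 in auto)
    have "m s1 \<le> r" "r \<le> m s2" using r' s1 s2 by auto
    then have "\<exists>s. min s1 s2 \<le> s \<and> s \<le> max s1 s2 \<and> m s = r"
      using IVT'[of m s1 r s2] IVT2'[of m s1 r s2] c
      by (cases "s1 \<le> s2") (auto simp: min_def max_def)
    then obtain s where "min s1 s2 \<le> s" "m s = r" by auto
    then show False using gap[of s] r' s1 s2 by (auto simp: min_def split: if_splits)
  qed
qed

text \<open>
  For fixed \<open>q\<close> at most one \<open>x\<close> is exceptional, so the exceptional set is null by Fubini's theorem.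
\<close>

lemma (in prob_space) occupation_level_null:
  fixes m :: "real \<Rightarrow> 'a \<Rightarrow> real"
  assumes m: "(\<lambda>z. m (fst z) (snd z)) \<in> borel_measurable (borel \<Otimes>\<^sub>M M)"
    and cont: "\<And>q. q \<in> space M \<Longrightarrow> continuous_on {0..} (\<lambda>s. m s q)" and L: "0 < L"
  shows "(\<integral>\<^sup>+x. emeasure M {q\<in>space M. (\<integral>\<^sup>+s. indicator {s. 0 \<le> s \<and> 0 < x + m s q} s \<partial>lborel) = ennreal L} \<partial>lborel) = 0"
proof -
  interpret LM: pair_sigma_finite lborel M ..
  define F where "F x q = (\<integral>\<^sup>+s. indicator {s. 0 \<le> s \<and> 0 < x + m s q} s \<partial>lborel)" for x q
  have [measurable]: "(\<lambda>z. m (snd z) (snd (fst z))) \<in> borel_measurable ((lborel \<Otimes>\<^sub>M M) \<Otimes>\<^sub>M lborel)"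
  proof -
    have "(\<lambda>z. (snd z, snd (fst z))) \<in> (lborel \<Otimes>\<^sub>M M) \<Otimes>\<^sub>M lborel \<rightarrow>\<^sub>M borel \<Otimes>\<^sub>M M" by measurable
    from measurable_compose[OF this m] show ?thesis by simp
  qed
  have "(\<lambda>z. F (fst z) (snd z)) \<in> borel_measurable (lborel \<Otimes>\<^sub>M M)" unfolding F_def by measurable
  then have F[measurable]: "Measurable.pred (lborel \<Otimes>\<^sub>M M) (\<lambda>z. F (fst z) (snd z) = ennreal L)" by measurable
  have Fq: "{q\<in>space M. F x q = ennreal L} \<in> sets M" for x
  proof -
    have "(\<lambda>q. (x, q)) \<in> M \<rightarrow>\<^sub>M lborel \<Otimes>\<^sub>M M" by simp
    from measurable_compose[OF this F] have "Measurable.pred M (\<lambda>q. F x q = ennreal L)" unfolding fst_conv snd_conv .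
    then show ?thesis by (rule predE)
  qed
  have "(\<integral>\<^sup>+x. emeasure M {q\<in>space M. F x q = ennreal L} \<partial>lborel) =
     (\<integral>\<^sup>+x. (\<integral>\<^sup>+q. indicator {z\<in>space (lborel \<Otimes>\<^sub>M M). F (fst z) (snd z) = ennreal L} (x, q) \<partial>M) \<partial>lborel)"
  proof (rule nn_integral_cong)
    fix x
    have "(\<integral>\<^sup>+q. indicator {z\<in>space (lborel \<Otimes>\<^sub>M M). F (fst z) (snd z) = ennreal L} (x, q) \<partial>M) =
        (\<integral>\<^sup>+q. indicator {q\<in>space M. F x q = ennreal L} q \<partial>M)"
      by (rule nn_integral_cong) (simp add: indicator_def space_pair_measure)
    also have "\<dots> = emeasure M {q\<in>space M. F x q = ennreal L}" by (rule nn_integral_indicator[OF Fq])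
    finally show "emeasure M {q\<in>space M. F x q = ennreal L} =
      (\<integral>\<^sup>+q. indicator {z\<in>space (lborel \<Otimes>\<^sub>M M). F (fst z) (snd z) = ennreal L} (x, q) \<partial>M)" ..
  qed
  also have "\<dots> = (\<integral>\<^sup>+q. (\<integral>\<^sup>+x. indicator {z\<in>space (lborel \<Otimes>\<^sub>M M). F (fst z) (snd z) = ennreal L} (x, q) \<partial>lborel) \<partial>M)"
    by (rule LM.Fubini'[symmetric]) simp
  also have "\<dots> = (\<integral>\<^sup>+q. 0 \<partial>M)"
  proof (rule nn_integral_cong)
    fix q assume q: "q \<in> space M"
    have uniq: "x = x'" if "F x q = ennreal L" "F x' q = ennreal L" for x x'
    proof (rule ccontr)
      have *: False if "x < x'" "F x q = ennreal L" "F x' q = ennreal L" for x x'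
      proof -
        have e: "(0 < y + m s q) = (- y < m s q)" for y s by linarith
        have "- x' < - x" using that(1) by simp
        from occupation_level_unique[OF cont[OF q] L this that(3)[unfolded F_def e] that(2)[unfolded F_def e]] show False .
      qed
      assume "x \<noteq> x'"
      then consider "x < x'" | "x' < x" by linarith
      then show False
      proof cases
        case 1 show ?thesis by (rule *[OF 1 that])
      next
        case 2 show ?thesis by (rule *[OF 2 that(2) that(1)])
      qed
    qed
    show "(\<integral>\<^sup>+x. indicator {z\<in>space (lborel \<Otimes>\<^sub>M M). F (fst z) (snd z) = ennreal L} (x, q) \<partial>lborel) = 0"
    proof (cases "\<exists>x. F x q = ennreal L")
      case True
      then obtain x0 where x0: "F x0 q = ennreal L" by auto
      have "(\<integral>\<^sup>+x. indicator {z\<in>space (lborel \<Otimes>\<^sub>M M). F (fst z) (snd z) = ennreal L} (x, q) \<partial>lborel) =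
          (\<integral>\<^sup>+x. indicator {x0} x \<partial>lborel)"
      proof (rule nn_integral_cong)
        fix x
        have "F x q = ennreal L \<longleftrightarrow> x = x0" using x0 uniq by blast
        then show "indicator {z\<in>space (lborel \<Otimes>\<^sub>M M). F (fst z) (snd z) = ennreal L} (x, q) = (indicator {x0} x :: ennreal)"
          using q by (simp add: indicator_def space_pair_measure)
      qed
      then show ?thesis by simp
    next
      case False
      then show ?thesis by (simp add: indicator_def)
    qed
  qed
  finally show ?thesis by (simp add: F_def)
qed

lemma (in prob_space) prob_section_measurable:
  assumes P: "Measurable.pred (R \<Otimes>\<^sub>M M) (\<lambda>z. P (fst z) (snd z))"
  shows "(\<lambda>r. prob {q\<in>space M. P r q}) \<in> borel_measurable R"
proof -
  let ?S = "{z\<in>space (R \<Otimes>\<^sub>M M). P (fst z) (snd z)}"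
  have "?S \<in> sets (R \<Otimes>\<^sub>M M)" using P by (rule predE)
  then have m: "(\<lambda>r. emeasure M (Pair r -` ?S)) \<in> borel_measurable R"
    by (rule measurable_emeasure_Pair)
  have e: "emeasure M (Pair r -` ?S) = ennreal (prob {q\<in>space M. P r q})" if "r \<in> space R" for r
  proof -
    have "Pair r -` ?S = {q\<in>space M. P r q}" using that by (auto simp: space_pair_measure)
    then show ?thesis by (simp add: emeasure_eq_measure)
  qed
  from m have "(\<lambda>r. ennreal (prob {q\<in>space M. P r q})) \<in> borel_measurable R"
    by (rule measurable_cong[THEN iffD1, rotated]) (rule e)
  then have "(\<lambda>r. enn2real (ennreal (prob {q\<in>space M. P r q}))) \<in> borel_measurable R" by measurable
  then show ?thesis by simp
qed

section \<open>Bounds for the exceedance probability of the bridge\<close>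

lemma exponential_integral:
  assumes "0 < \<delta>"
  shows "has_bochner_integral lborel (\<lambda>s::real. exp (- \<delta> * s) * indicator {0..} s) (1 / \<delta>)"
proof -
  have "has_bochner_integral lborel (\<lambda>x. exponential_density \<delta> x) 1"
    using prob_space.emeasure_space_1[OF prob_space_exponential_density[OF assms]] assms
    by (intro has_bochner_integral_nn_integral) (auto simp: emeasure_density exponential_density_nonneg)
  then have "has_bochner_integral lborel (\<lambda>x. (1 / \<delta>) * exponential_density \<delta> x) (1 / \<delta> * 1)"
    by (rule has_bochner_integral_mult_right)
  also have "(\<lambda>x. (1 / \<delta>) * exponential_density \<delta> x) = (\<lambda>s. exp (- \<delta> * s) * indicator {0..} s)"
    using assms by (auto simp: exponential_density_def indicator_def fun_eq_iff mult.commute)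
  finally show ?thesis by simp
qed

lemma exponential_integral_open:
  assumes "0 < \<delta>"
  shows "has_bochner_integral lborel (\<lambda>s::real. exp (- \<delta> * s) * indicator {0<..} s) (1 / \<delta>)"
proof -
  have "AE x in lborel. x \<noteq> (0::real)" by (rule AE_lborel_singleton)
  then have ae: "AE s in lborel. exp (- \<delta> * s) * indicator {0..} s = exp (- \<delta> * s) * indicator {0<..} (s::real)"
    by eventually_elim (auto simp: indicator_def)
  show ?thesis
    by (rule has_bochner_integral_cong_AE[THEN iffD1, OF _ _ ae exponential_integral[OF assms]]) auto
qed

context brownian_pair
begin

lemma nn_integral_Q_prod:
  assumes [measurable]: "g \<in> borel_measurable N" "h \<in> borel_measurable N"
  shows "(\<integral>\<^sup>+q. g (fst q) * h (snd q) \<partial>Q) = (\<integral>\<^sup>+\<omega>. g \<omega> \<partial>N) * (\<integral>\<^sup>+\<omega>. h \<omega> \<partial>N)"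
proof -
  have "(\<lambda>q. g (fst q) * h (snd q)) \<in> borel_measurable (N \<Otimes>\<^sub>M N)" by measurable
  from N.nn_integral_fst[OF this]
  have "(\<integral>\<^sup>+q. g (fst q) * h (snd q) \<partial>Q) = (\<integral>\<^sup>+x. (\<integral>\<^sup>+y. g x * h y \<partial>N) \<partial>N)"
    unfolding Q_def by simp
  also have "\<dots> = (\<integral>\<^sup>+x. g x * (\<integral>\<^sup>+y. h y \<partial>N) \<partial>N)"
    by (intro nn_integral_cong nn_integral_cmult) simp
  also have "\<dots> = (\<integral>\<^sup>+\<omega>. g \<omega> \<partial>N) * (\<integral>\<^sup>+\<omega>. h \<omega> \<partial>N)"
    by (rule nn_integral_multc) simp
  finally show ?thesis .
qed

lemma abs_moment_Q:
  assumes t: "0 < t"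
  shows "integrable Q (b1 t)" "integrable Q (b2 t)"
    "Q.expectation (\<lambda>q. \<bar>b1 t q\<bar>) \<le> sqrt t" "Q.expectation (\<lambda>q. \<bar>b2 t q\<bar>) \<le> sqrt t"
proof -
  have [measurable]: "B1 t \<in> borel_measurable N" "B2 t \<in> borel_measurable N"
    using standard_brownian_motionD(4)[OF B1] standard_brownian_motionD(4)[OF B2] t by auto
  have "(\<integral>\<^sup>+q. ennreal \<bar>b1 t q\<bar> \<partial>Q) = (\<integral>\<^sup>+\<omega>. ennreal \<bar>B1 t \<omega>\<bar> \<partial>N)"
    using nn_integral_Q_prod[of "\<lambda>\<omega>. ennreal \<bar>B1 t \<omega>\<bar>" "\<lambda>_. 1"] t by (simp add: b1_def max_absorb2 N.emeasure_space_1)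
  also have "\<dots> \<le> ennreal (sqrt t)" by (rule standard_brownian_abs_moment[OF B1 t])
  finally have 1: "(\<integral>\<^sup>+q. ennreal \<bar>b1 t q\<bar> \<partial>Q) \<le> ennreal (sqrt t)" .
  have "(\<integral>\<^sup>+q. ennreal \<bar>b2 t q\<bar> \<partial>Q) = (\<integral>\<^sup>+\<omega>. ennreal \<bar>B2 t \<omega>\<bar> \<partial>N)"
    using nn_integral_Q_prod[of "\<lambda>_. 1" "\<lambda>\<omega>. ennreal \<bar>B2 t \<omega>\<bar>"] t by (simp add: b2_def max_absorb2 N.emeasure_space_1)
  also have "\<dots> \<le> ennreal (sqrt t)" by (rule standard_brownian_abs_moment[OF B2 t])
  finally have 2: "(\<integral>\<^sup>+q. ennreal \<bar>b2 t q\<bar> \<partial>Q) \<le> ennreal (sqrt t)" .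
  show i1: "integrable Q (b1 t)"
    by (rule integrableI_bounded) (use 1 in \<open>auto intro: le_less_trans\<close>)
  show i2: "integrable Q (b2 t)"
    by (rule integrableI_bounded) (use 2 in \<open>auto intro: le_less_trans\<close>)
  show "Q.expectation (\<lambda>q. \<bar>b1 t q\<bar>) \<le> sqrt t"
    using 1 i1 t by (subst (asm) nn_integral_eq_integral) auto
  show "Q.expectation (\<lambda>q. \<bar>b2 t q\<bar>) \<le> sqrt t"
    using 2 i2 t by (subst (asm) nn_integral_eq_integral) auto
qed

lemma no_atom_b1:
  assumes s: "0 < s" shows "Q.prob {q\<in>space Q. c + b1 s q = 0} = 0"
proof -
  have [measurable]: "B1 s \<in> borel_measurable N" using standard_brownian_motionD(4)[OF B1] s by auto
  have "emeasure Q {q\<in>space Q. c + b1 s q = 0} = (\<integral>\<^sup>+q. indicator {\<omega>\<in>space N. B1 s \<omega> = - c} (fst q) * 1 \<partial>Q)"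
  proof -
    have S: "{q\<in>space Q. c + b1 s q = 0} \<in> sets Q" by measurable
    have "(\<integral>\<^sup>+q. indicator {q\<in>space Q. c + b1 s q = 0} q \<partial>Q) = (\<integral>\<^sup>+q. indicator {\<omega>\<in>space N. B1 s \<omega> = - c} (fst q) * 1 \<partial>Q)"
    proof (rule nn_integral_cong)
      fix q assume "q \<in> space Q"
      moreover from this have "fst q \<in> space N" by (auto simp: Q_def space_pair_measure)
      moreover have "c + b1 s q = 0 \<longleftrightarrow> B1 s (fst q) = - c" using s by (auto simp: b1_def max_absorb2)
      ultimately show "indicator {q\<in>space Q. c + b1 s q = 0} q = (indicator {\<omega>\<in>space N. B1 s \<omega> = - c} (fst q) * 1 :: ennreal)"
        by (simp add: indicator_def)
    qed
    with nn_integral_indicator[OF S] show ?thesis by simp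
  qed
  also have "\<dots> = 0"
    by (subst nn_integral_Q_prod) (simp_all add: standard_brownian_no_atom[OF B1 s])
  finally show ?thesis by (simp add: measure_def)
qed

lemma no_atom_b2:
  assumes s: "0 < s" and d: "d \<noteq> 0" shows "Q.prob {q\<in>space Q. c + (k * b1 s q + d * b2 s q) = 0} = 0"
proof -
  have [measurable]: "B1 s \<in> borel_measurable N" "B2 s \<in> borel_measurable N"
    using standard_brownian_motionD(4)[OF B1] standard_brownian_motionD(4)[OF B2] s by auto
  have S: "{q\<in>space Q. c + (k * b1 s q + d * b2 s q) = 0} \<in> sets (N \<Otimes>\<^sub>M N)"
    unfolding Q_def[symmetric] by measurable
  have "emeasure Q {q\<in>space Q. c + (k * b1 s q + d * b2 s q) = 0} =
      (\<integral>\<^sup>+\<omega>. emeasure N (Pair \<omega> -` {q\<in>space Q. c + (k * b1 s q + d * b2 s q) = 0}) \<partial>N)"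
    unfolding Q_def by (rule N.emeasure_pair_measure_alt[OF S[unfolded Q_def]])
  also have "\<dots> = (\<integral>\<^sup>+\<omega>. 0 \<partial>N)"
  proof (rule nn_integral_cong)
    fix \<omega> assume \<omega>: "\<omega> \<in> space N"
    have "Pair \<omega> -` {q\<in>space Q. c + (k * b1 s q + d * b2 s q) = 0} = {\<omega>'\<in>space N. B2 s \<omega>' = (- c - k * B1 s \<omega>) / d}"
      using \<omega> s d by (auto simp: Q_def space_pair_measure b1_def b2_def max_absorb2 field_simps)
    then show "emeasure N (Pair \<omega> -` {q\<in>space Q. c + (k * b1 s q + d * b2 s q) = 0}) = 0"
      by (simp add: standard_brownian_no_atom[OF B2 s])
  qed
  finally show ?thesis by (simp add: measure_def)
qed

text \<open>
  The perturbations that occur are affine in the values of the two motions at the times \<open>s\<close> and \<open>u\<^sup>2\<close>.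
  The value at time \<open>u\<^sup>2\<close> has mean absolute value at most \<open>u\<close>, hence the hypothesis on \<open>\<gamma> u * u\<close>.
\<close>

lemma affine_sign_stable:
  fixes \<alpha> \<beta>1 \<beta>2 \<gamma>1 \<gamma>2 :: "real \<Rightarrow> real"
  assumes s: "0 < s" and X: "X \<in> borel_measurable Q" "Q.prob {q\<in>space Q. X q = 0} = 0"
    and lims: "(\<alpha> \<longlongrightarrow> 0) at_top" "(\<beta>1 \<longlongrightarrow> 0) at_top" "(\<beta>2 \<longlongrightarrow> 0) at_top"
      "((\<lambda>u. \<gamma>1 u * u) \<longlongrightarrow> 0) at_top" "((\<lambda>u. \<gamma>2 u * u) \<longlongrightarrow> 0) at_top"
    and Y: "\<forall>\<^sub>F u in at_top. \<forall>q. (0 < Y u q) \<longleftrightarrow>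
       0 < X q + (\<alpha> u + \<beta>1 u * b1 s q + \<beta>2 u * b2 s q + \<gamma>1 u * b1 (u\<^sup>2) q + \<gamma>2 u * b2 (u\<^sup>2) q)"
  shows "((\<lambda>u. Q.prob {q\<in>space Q. (0 < Y u q) \<noteq> (0 < X q)}) \<longlongrightarrow> 0) at_top"
proof -
  \<comment> \<open>the value 0 at \<open>u = 0\<close> makes \<open>R u\<close> integrable for every \<open>u\<close>\<close>
  define R where "R u q = (if u = 0 then 0 else \<alpha> u + \<beta>1 u * b1 s q + \<beta>2 u * b2 s q + \<gamma>1 u * b1 (u\<^sup>2) q + \<gamma>2 u * b2 (u\<^sup>2) q)" for u q
  have "((\<lambda>u. Q.prob {q\<in>space Q. (0 < X q + R u q) \<noteq> (0 < X q)}) \<longlongrightarrow> 0) at_top"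
  proof (rule Q.sign_stable[OF X])
    show int: "integrable Q (R u)" for u
    proof (cases "u = 0")
      case False
      then have "0 < u\<^sup>2" by simp
      then show ?thesis using False unfolding R_def
        by (simp add: abs_moment_Q[OF s] abs_moment_Q(1,2))
    qed (simp add: R_def[abs_def])
    let ?h = "\<lambda>u. \<bar>\<alpha> u\<bar> + \<bar>\<beta>1 u\<bar> * sqrt s + \<bar>\<beta>2 u\<bar> * sqrt s + \<bar>\<gamma>1 u * u\<bar> + \<bar>\<gamma>2 u * u\<bar>"
    show "(?h \<longlongrightarrow> 0) at_top"
    proof -
      have "(?h \<longlongrightarrow> \<bar>0\<bar> + \<bar>0\<bar> * sqrt s + \<bar>0\<bar> * sqrt s + \<bar>0\<bar> + \<bar>0\<bar>) at_top"
        by (intro tendsto_add tendsto_mult tendsto_rabs tendsto_const lims)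
      then show ?thesis by simp
    qed
    show "\<forall>\<^sub>F u in at_top. Q.expectation (\<lambda>q. \<bar>R u q\<bar>) \<le> ?h u"
      using eventually_gt_at_top[of 0]
    proof eventually_elim
      fix u :: real assume u: "0 < u"
      then have u2: "0 < u\<^sup>2" by simp
      note i = abs_moment_Q(1,2)[OF s] abs_moment_Q(1,2)[OF u2]
      have "Q.expectation (\<lambda>q. \<bar>R u q\<bar>) \<le> Q.expectation (\<lambda>q. \<bar>\<alpha> u\<bar> + \<bar>\<beta>1 u\<bar> * \<bar>b1 s q\<bar> + \<bar>\<beta>2 u\<bar> * \<bar>b2 s q\<bar>
          + \<bar>\<gamma>1 u\<bar> * \<bar>b1 (u\<^sup>2) q\<bar> + \<bar>\<gamma>2 u\<bar> * \<bar>b2 (u\<^sup>2) q\<bar>)"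
      proof (rule integral_mono)
        show "integrable Q (\<lambda>q. \<bar>R u q\<bar>)" using int by simp
        show "integrable Q (\<lambda>q. \<bar>\<alpha> u\<bar> + \<bar>\<beta>1 u\<bar> * \<bar>b1 s q\<bar> + \<bar>\<beta>2 u\<bar> * \<bar>b2 s q\<bar>
          + \<bar>\<gamma>1 u\<bar> * \<bar>b1 (u\<^sup>2) q\<bar> + \<bar>\<gamma>2 u\<bar> * \<bar>b2 (u\<^sup>2) q\<bar>)" using i by simp
        fix q
        show "\<bar>R u q\<bar> \<le> \<bar>\<alpha> u\<bar> + \<bar>\<beta>1 u\<bar> * \<bar>b1 s q\<bar> + \<bar>\<beta>2 u\<bar> * \<bar>b2 s q\<bar>
          + \<bar>\<gamma>1 u\<bar> * \<bar>b1 (u\<^sup>2) q\<bar> + \<bar>\<gamma>2 u\<bar> * \<bar>b2 (u\<^sup>2) q\<bar>"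
          using u unfolding R_def abs_mult[symmetric] by simp
      qed
      also have "\<dots> = \<bar>\<alpha> u\<bar> + \<bar>\<beta>1 u\<bar> * Q.expectation (\<lambda>q. \<bar>b1 s q\<bar>) + \<bar>\<beta>2 u\<bar> * Q.expectation (\<lambda>q. \<bar>b2 s q\<bar>)
          + \<bar>\<gamma>1 u\<bar> * Q.expectation (\<lambda>q. \<bar>b1 (u\<^sup>2) q\<bar>) + \<bar>\<gamma>2 u\<bar> * Q.expectation (\<lambda>q. \<bar>b2 (u\<^sup>2) q\<bar>)"
        using i by (simp add: Q.prob_space)
      also have "\<dots> \<le> \<bar>\<alpha> u\<bar> + \<bar>\<beta>1 u\<bar> * sqrt s + \<bar>\<beta>2 u\<bar> * sqrt s + \<bar>\<gamma>1 u\<bar> * sqrt (u\<^sup>2) + \<bar>\<gamma>2 u\<bar> * sqrt (u\<^sup>2)"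
        by (intro add_mono mult_left_mono abs_moment_Q s u2) auto
      also have "\<dots> = ?h u" using u by (simp add: abs_mult)
      finally show "Q.expectation (\<lambda>q. \<bar>R u q\<bar>) \<le> ?h u" .
    qed
  qed
  then show ?thesis
  proof (rule Lim_transform_eventually)
    show "\<forall>\<^sub>F u in at_top. Q.prob {q\<in>space Q. (0 < X q + R u q) \<noteq> (0 < X q)} = Q.prob {q\<in>space Q. (0 < Y u q) \<noteq> (0 < X q)}"
      using Y eventually_gt_at_top[of 0]
    proof eventually_elim
      fix u :: real
      assume h: "\<forall>q. (0 < Y u q) \<longleftrightarrow>
        0 < X q + (\<alpha> u + \<beta>1 u * b1 s q + \<beta>2 u * b2 s q + \<gamma>1 u * b1 (u\<^sup>2) q + \<gamma>2 u * b2 (u\<^sup>2) q)" and u: "0 < u"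
      have "(0 < X q + R u q) = (0 < Y u q)" for q
        using h[rule_format, of q] u by (simp add: R_def)
      then show "Q.prob {q\<in>space Q. (0 < X q + R u q) \<noteq> (0 < X q)} = Q.prob {q\<in>space Q. (0 < Y u q) \<noteq> (0 < X q)}"
        by simp
    qed
  qed
qed

text \<open>
  Minus the growth rate of the exponential moment, that is, \<open>exp (- s * drift_gap a \<theta>1 \<theta>2)\<close> is the mean of
  \<open>exp (\<theta>1 (W1 s - s) + \<theta>2 (W2 s - a s))\<close> for the correlated pair \<open>(W1, W2)\<close>. The set where it is
  positive is the interior of an ellipse through the origin with centre \<open>\<lambda>\<close>.
\<close>

definition drift_gap :: "real \<Rightarrow> real \<Rightarrow> real \<Rightarrow> real" where
  "drift_gap a \<theta>1 \<theta>2 = \<theta>1 + a * \<theta>2 - (\<theta>1\<^sup>2 + 2 * \<rho> * \<theta>1 * \<theta>2 + \<theta>2\<^sup>2) / 2"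

text \<open>
  The exponential Chebyshev inequality with exponent \<open>\<theta> / p\<close>, where \<open>p = 1 - s / T\<close>. The excess \<open>x\<close>
  enters \<open>in_quadrant\<close> as \<open>p x\<close>, and the division by \<open>p\<close> restores the factor \<open>exp (\<theta>1 x + \<theta>2 y)\<close>.
  The variance of the bridge carries a factor \<open>p\<close> as well, so that the time-dependent rate becomes
  \<open>s / p\<close> times the gap, which is at least \<open>s \<delta>\<close>.
\<close>

lemma in_quadrant_bound:
  assumes T: "0 < T" and th: "0 \<le> \<theta>1" "0 \<le> \<theta>2" and gap: "0 < \<delta>" "\<delta> \<le> drift_gap a \<theta>1 \<theta>2"
  shows "Q.prob {q\<in>space Q. 0 \<le> s \<and> s \<le> T \<and> in_quadrant a T x y s q} \<le>
    exp (\<theta>1 * x + \<theta>2 * y) * (exp (- \<delta> * s) * indicator {0..} s)"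
proof (cases "0 \<le> s \<and> s < T")
  case False
  \<comment> \<open>at \<open>s = T\<close> the bridge vanishes and the first condition reads \<open>0 < - T\<close>\<close>
  have "\<not> in_quadrant a T x y T q" for q
    using T by (simp add: in_quadrant_def br1_def)
  then have e: "{q\<in>space Q. 0 \<le> s \<and> s \<le> T \<and> in_quadrant a T x y s q} = {}" using False by (auto simp: not_less)
  show ?thesis unfolding e by simp
next
  case True
  define p where "p = 1 - s / T"
  have p: "0 < p" "p \<le> 1" using True T by (simp_all add: p_def)
  define k1 k2 where "k1 = (\<theta>1 + \<rho> * \<theta>2) / p" and "k2 = \<kappa> * \<theta>2 / p"
  let ?S = "{q\<in>space Q. in_quadrant a T x y s q}"
  \<comment> \<open>\<open>k1\<close> and \<open>k2\<close> are the coefficients of the two independent bridges, \<open>c\<close> collects the deterministic part\<close>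
  define c where "c = exp (\<theta>1 * x + \<theta>2 * y - (s / p) * (\<theta>1 + a * \<theta>2))"
  let ?Br = "\<lambda>B \<omega>. B s \<omega> - s / T * B T \<omega>"
  have [measurable]: "B1 s \<in> borel_measurable N" "B2 s \<in> borel_measurable N" "B1 T \<in> borel_measurable N" "B2 T \<in> borel_measurable N"
    using standard_brownian_motionD(4)[OF B1] standard_brownian_motionD(4)[OF B2] True T by auto
  have S: "?S \<in> sets Q" unfolding in_quadrant_def by measurable
  have "emeasure Q ?S = (\<integral>\<^sup>+q. indicator ?S q \<partial>Q)" using S by simp
  also have "\<dots> \<le> (\<integral>\<^sup>+q. (ennreal c * ennreal (exp (k1 * ?Br B1 (fst q)))) * ennreal (exp (k2 * ?Br B2 (snd q))) \<partial>Q)"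
  proof (rule nn_integral_mono)
    fix q assume q: "q \<in> space Q"
    have br: "br1 T s q = ?Br B1 (fst q)" "br2 T s q = ?Br B2 (snd q)"
      using True T by (simp_all add: br1_def br2_def b1_def b2_def max_absorb2)
    have "1 \<le> c * exp (k1 * br1 T s q) * exp (k2 * br2 T s q)" if "in_quadrant a T x y s q"
    proof -
      have "0 \<le> \<theta>1 / p * (x - s - s * x / T + br1 T s q) + \<theta>2 / p * (y - a * s - s * y / T + (\<rho> * br1 T s q + \<kappa> * br2 T s q))"
        using that th p unfolding in_quadrant_def
        by (intro add_nonneg_nonneg[OF mult_nonneg_nonneg mult_nonneg_nonneg]) auto
      also have "\<dots> = \<theta>1 * x + \<theta>2 * y - (s / p) * (\<theta>1 + a * \<theta>2) + k1 * br1 T s q + k2 * br2 T s q"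
      proof -
        have e: "x - s - s * x / T = p * x - s" "y - a * s - s * y / T = p * y - a * s"
          by (simp_all add: p_def algebra_simps)
        show ?thesis unfolding e k1_def k2_def using p by (simp add: field_simps)
      qed
      finally have "exp 0 \<le> exp (\<theta>1 * x + \<theta>2 * y - (s / p) * (\<theta>1 + a * \<theta>2) + k1 * br1 T s q + k2 * br2 T s q)" by simp
      then show ?thesis by (simp add: c_def exp_add)
    qed
    then have "indicator ?S q \<le> ennreal (c * exp (k1 * br1 T s q) * exp (k2 * br2 T s q))"
      by (auto simp: indicator_def simp flip: ennreal_1 intro!: ennreal_leI)
    then show "indicator ?S q \<le> (ennreal c * ennreal (exp (k1 * ?Br B1 (fst q)))) * ennreal (exp (k2 * ?Br B2 (snd q)))"
      unfolding br by (simp add: ennreal_mult c_def)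
  qed
  also have "\<dots> = (ennreal c * ennreal (exp (k1\<^sup>2 * s * (1 - s / T) / 2))) * ennreal (exp (k2\<^sup>2 * s * (1 - s / T) / 2))"
  proof -
    have sT: "s \<in> {0..T}" using True by simp
    show ?thesis
      by (subst nn_integral_Q_prod, measurable, subst nn_integral_cmult, measurable)
         (simp only: brownian_bridge_exp_moment[OF B1 T sT] brownian_bridge_exp_moment[OF B2 T sT])
  qed
  also have "\<dots> = ennreal (exp (\<theta>1 * x + \<theta>2 * y - (s / p) * drift_gap a \<theta>1 \<theta>2))"
  proof -
    have k: "k1\<^sup>2 + k2\<^sup>2 = (\<theta>1\<^sup>2 + 2 * \<rho> * \<theta>1 * \<theta>2 + \<theta>2\<^sup>2) / p\<^sup>2"
    proof -
      have "(\<kappa> * \<theta>2)\<^sup>2 = (1 - \<rho>\<^sup>2) * \<theta>2\<^sup>2" by (simp add: power_mult_distrib \<kappa>_sq)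
      then show ?thesis
        unfolding k1_def k2_def power_divide by (simp add: add_divide_distrib[symmetric] power2_sum algebra_simps power_mult_distrib)
    qed
    have q: "(k1\<^sup>2 + k2\<^sup>2) * s * p / 2 = (s / p) * ((\<theta>1\<^sup>2 + 2 * \<rho> * \<theta>1 * \<theta>2 + \<theta>2\<^sup>2) / 2)"
      unfolding k using p by (simp add: power2_eq_square)
    have "\<theta>1 * x + \<theta>2 * y - (s / p) * (\<theta>1 + a * \<theta>2) + k1\<^sup>2 * s * p / 2 + k2\<^sup>2 * s * p / 2 =
        \<theta>1 * x + \<theta>2 * y - (s / p) * drift_gap a \<theta>1 \<theta>2"
    proof -
      have "k1\<^sup>2 * s * p / 2 + k2\<^sup>2 * s * p / 2 = (k1\<^sup>2 + k2\<^sup>2) * s * p / 2" by (simp add: algebra_simps add_divide_distrib)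
      then show ?thesis unfolding q drift_gap_def by (simp add: algebra_simps)
    qed
    then show ?thesis
      unfolding c_def p_def[symmetric] by (simp add: ennreal_mult[symmetric] exp_add[symmetric] add.assoc)
  qed
  also have "\<dots> \<le> ennreal (exp (\<theta>1 * x + \<theta>2 * y) * exp (- \<delta> * s))"
  proof (rule ennreal_leI)
    have "\<delta> * s \<le> drift_gap a \<theta>1 \<theta>2 * (s / p)"
      using True p gap by (intro mult_mono) (auto simp: field_simps mult_left_le_one_le)
    then show "exp (\<theta>1 * x + \<theta>2 * y - (s / p) * drift_gap a \<theta>1 \<theta>2) \<le> exp (\<theta>1 * x + \<theta>2 * y) * exp (- \<delta> * s)"
      by (simp add: exp_add[symmetric] mult.commute)
  qed
  finally have "Q.prob ?S \<le> exp (\<theta>1 * x + \<theta>2 * y) * exp (- \<delta> * s)" by (simp add: Q.emeasure_eq_measure)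
  then show ?thesis using True by simp
qed

definition exceed_prob :: "real \<Rightarrow> real \<Rightarrow> real \<Rightarrow> real \<Rightarrow> real \<Rightarrow> real" where
  "exceed_prob L a T x y = Q.prob {q\<in>space Q. ennreal L < bridge_occupation a T x y q}"

lemma bridge_occupation_alt:
  "bridge_occupation a T x y q = (\<integral>\<^sup>+s. indicator {s. 0 \<le> s \<and> s \<le> T \<and> in_quadrant a T x y s q} s \<partial>lborel)"
  unfolding bridge_occupation_def by (intro nn_integral_cong) (auto simp: indicator_def)

lemma in_quadrant_measurable[measurable (raw)]:
  assumes [measurable]: "f \<in> borel_measurable R" "g \<in> R \<rightarrow>\<^sub>M Q" "x \<in> borel_measurable R" "y \<in> borel_measurable R"
  shows "Measurable.pred R (\<lambda>r. in_quadrant a T (x r) (y r) (f r) (g r))"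
  unfolding in_quadrant_def by measurable

text \<open>
  Markov's inequality for the occupation time, whose mean is the integral over \<open>s\<close> of the preceding
  bound.
\<close>

lemma exceed_prob_bound:
  assumes T: "0 < T" and L: "0 < L" and th: "0 \<le> \<theta>1" "0 \<le> \<theta>2" and gap: "0 < \<delta>" "\<delta> \<le> drift_gap a \<theta>1 \<theta>2"
  shows "exceed_prob L a T x y \<le> exp (\<theta>1 * x + \<theta>2 * y) / (L * \<delta>)"
proof -
  interpret LQ: pair_sigma_finite lborel Q ..
  define A where "A s q = (0 \<le> s \<and> s \<le> T \<and> in_quadrant a T x y s q)" for s q
  have A[measurable (raw)]: "Measurable.pred R (\<lambda>r. A (f r) (g r))"
    if [measurable]: "f \<in> borel_measurable R" "g \<in> R \<rightarrow>\<^sub>M Q" for f g R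
    unfolding A_def by measurable
  have Am[measurable]: "Measurable.pred (lborel \<Otimes>\<^sub>M Q) (\<lambda>z. A (fst z) (snd z))"
    unfolding A_def by measurable
  define F where "F q = (\<integral>\<^sup>+s. indicator {s. A s q} s \<partial>lborel)" for q
  have F[measurable]: "F \<in> borel_measurable Q" unfolding F_def A_def by measurable
  have "(\<integral>\<^sup>+q. F q \<partial>Q) = (\<integral>\<^sup>+s. (\<integral>\<^sup>+q. indicator {s. A s q} s \<partial>Q) \<partial>lborel)"
    unfolding F_def by (rule LQ.Fubini') (unfold A_def, measurable)
  also have "\<dots> \<le> (\<integral>\<^sup>+s. ennreal (exp (\<theta>1 * x + \<theta>2 * y) * (exp (- \<delta> * s) * indicator {0..} s)) \<partial>lborel)"
  proof (rule nn_integral_mono)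
    fix s :: real
    have S: "{q\<in>space Q. A s q} \<in> sets Q" unfolding A_def by measurable
    have "(\<integral>\<^sup>+q. indicator {s. A s q} s \<partial>Q) = (\<integral>\<^sup>+q. indicator {q\<in>space Q. A s q} q \<partial>Q)"
      by (intro nn_integral_cong) (simp add: indicator_def)
    also have "\<dots> = ennreal (Q.prob {q\<in>space Q. A s q})"
      using nn_integral_indicator[OF S] by (simp add: Q.emeasure_eq_measure)
    also have "\<dots> \<le> ennreal (exp (\<theta>1 * x + \<theta>2 * y) * (exp (- \<delta> * s) * indicator {0..} s))"
      unfolding A_def by (intro ennreal_leI in_quadrant_bound[OF T th gap])
    finally show "(\<integral>\<^sup>+q. indicator {s. A s q} s \<partial>Q) \<le> ennreal (exp (\<theta>1 * x + \<theta>2 * y) * (exp (- \<delta> * s) * indicator {0..} s))" .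
  qed
  also have "\<dots> = ennreal (exp (\<theta>1 * x + \<theta>2 * y) / \<delta>)"
    using exponential_integral[OF gap(1)] gap
    by (subst nn_integral_eq_integral) (auto simp: indicator_def has_bochner_integral_iff)
  finally have EF: "(\<integral>\<^sup>+q. F q \<partial>Q) \<le> ennreal (exp (\<theta>1 * x + \<theta>2 * y) / \<delta>)" .
  have "emeasure Q {q\<in>space Q. ennreal L < F q} \<le> emeasure Q {q\<in>space Q. 1 \<le> ennreal (1 / L) * F q}"
  proof (rule emeasure_mono)
    show "{q\<in>space Q. ennreal L < F q} \<subseteq> {q\<in>space Q. 1 \<le> ennreal (1 / L) * F q}"
    proof safe
      fix q assume "ennreal L < F q"
      then have "ennreal (1 / L) * ennreal L \<le> ennreal (1 / L) * F q" by (intro mult_left_mono) auto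
      then show "1 \<le> ennreal (1 / L) * F q" using L by (simp add: ennreal_mult[symmetric])
    qed
  qed measurable
  also have "\<dots> \<le> ennreal (1 / L) * (\<integral>\<^sup>+q. F q * indicator (space Q) q \<partial>Q)"
    by (rule nn_integral_Markov_inequality) measurable
  also have "(\<integral>\<^sup>+q. F q * indicator (space Q) q \<partial>Q) = (\<integral>\<^sup>+q. F q \<partial>Q)" by (intro nn_integral_cong) simp
  also have "ennreal (1 / L) * (\<integral>\<^sup>+q. F q \<partial>Q) \<le> ennreal (1 / L) * ennreal (exp (\<theta>1 * x + \<theta>2 * y) / \<delta>)"
    by (intro mult_left_mono EF) auto
  also have "\<dots> = ennreal (exp (\<theta>1 * x + \<theta>2 * y) / (L * \<delta>))" using L gap by (simp add: ennreal_mult[symmetric])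
  finally show ?thesis
    using L gap unfolding exceed_prob_def bridge_occupation_alt F_def A_def by (simp add: Q.emeasure_eq_measure)
qed

text \<open>
  With \<open>\<theta>2 = 0\<close> the slopes 1/2 and 3/2 are admissible, both with gap 3/8; the one that is smaller in
  the direction of \<open>x\<close> gives a bound whose product with \<open>exp (- x)\<close> is integrable.
\<close>

lemma exceed_prob_bound_one:
  assumes T: "0 < T" and L: "0 < L"
  shows "exceed_prob L a T x y \<le> exp (x - \<bar>x\<bar> / 2) * (8 / (3 * L))"
proof -
  define s :: real where "s = (if x \<le> 0 then 1 else -1)"
  have s: "s = 1 \<or> s = -1" by (simp add: s_def)
  then have gap: "drift_gap a (1 + s / 2) 0 = 3 / 8" by (auto simp: drift_gap_def power2_eq_square)
  have "exceed_prob L a T x y \<le> exp ((1 + s / 2) * x + 0 * y) / (L * (3 / 8))"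
    by (rule exceed_prob_bound[OF T L]) (use s gap in auto)
  also have "(1 + s / 2) * x + 0 * y = x - \<bar>x\<bar> / 2" by (simp add: s_def algebra_simps)
  finally show ?thesis using L by (simp add: field_simps)
qed

end

section \<open>Limits of the exceedance probability\<close>

context brownian_pair
begin

definition lim_quadrant :: "real \<Rightarrow> real \<Rightarrow> real \<Rightarrow> real \<Rightarrow> 'b \<times> 'b \<Rightarrow> bool" where
  "lim_quadrant a x y s q \<longleftrightarrow> 0 < x - s + b1 s q \<and> 0 < y - a * s + (\<rho> * b1 s q + \<kappa> * b2 s q)"

definition occ2 :: "real \<Rightarrow> real \<Rightarrow> real \<Rightarrow> 'b \<times> 'b \<Rightarrow> ennreal" where
  "occ2 a x y q = (\<integral>\<^sup>+s. indicator {s. 0 \<le> s \<and> lim_quadrant a x y s q} s \<partial>lborel)"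

definition occ1 :: "real \<Rightarrow> 'b \<times> 'b \<Rightarrow> ennreal" where
  "occ1 x q = (\<integral>\<^sup>+s. indicator {s. 0 \<le> s \<and> 0 < x - s + b1 s q} s \<partial>lborel)"

definition limit_prob2 :: "real \<Rightarrow> real \<Rightarrow> real \<Rightarrow> real \<Rightarrow> real" where
  "limit_prob2 L a x y = Q.prob {q\<in>space Q. ennreal L < occ2 a x y q}"

definition limit_prob1 :: "real \<Rightarrow> real \<Rightarrow> real" where
  "limit_prob1 L x = Q.prob {q\<in>space Q. ennreal L < occ1 x q}"

lemma occ2_measurable[measurable (raw)]:
  assumes [measurable]: "x \<in> borel_measurable R" "y \<in> borel_measurable R" "h \<in> R \<rightarrow>\<^sub>M Q"
  shows "(\<lambda>r. occ2 a (x r) (y r) (h r)) \<in> borel_measurable R"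
  unfolding occ2_def lim_quadrant_def by measurable

lemma occ1_measurable[measurable (raw)]:
  assumes [measurable]: "x \<in> borel_measurable R" "h \<in> R \<rightarrow>\<^sub>M Q"
  shows "(\<lambda>r. occ1 (x r) (h r)) \<in> borel_measurable R"
  unfolding occ1_def by measurable

lemma limit_prob_measurable[measurable (raw)]:
  assumes [measurable]: "x \<in> borel_measurable R" "y \<in> borel_measurable R"
  shows "(\<lambda>r. limit_prob2 L a (x r) (y r)) \<in> borel_measurable R" "(\<lambda>r. limit_prob1 L (x r)) \<in> borel_measurable R"
  unfolding limit_prob2_def limit_prob1_def by (rule Q.prob_section_measurable, measurable)+

lemma exceed_prob_measurable[measurable (raw)]:
  assumes [measurable]: "x \<in> borel_measurable R" "y \<in> borel_measurable R"
  shows "(\<lambda>r. exceed_prob L a T (x r) (y r)) \<in> borel_measurable R"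
  unfolding exceed_prob_def bridge_occupation_alt by (rule Q.prob_section_measurable) measurable

lemma first_coordinate_stable:
  assumes s: "0 < s"
  shows "((\<lambda>u. Q.prob {q\<in>space Q. (0 < x - s - s * x / u\<^sup>2 + br1 (u\<^sup>2) s q) \<noteq> (0 < x - s + b1 s q)}) \<longlongrightarrow> 0) at_top"
proof (rule affine_sign_stable[OF s, where \<alpha>="\<lambda>u. - s * x / u\<^sup>2" and ?\<beta>1.0="\<lambda>_. 0" and ?\<beta>2.0="\<lambda>_. 0" and
      ?\<gamma>1.0="\<lambda>u. - s / u\<^sup>2" and ?\<gamma>2.0="\<lambda>_. 0"])
  show "Q.prob {q\<in>space Q. x - s + b1 s q = 0} = 0" by (rule no_atom_b1[OF s])
  show "((\<lambda>u. - s * x / u\<^sup>2) \<longlongrightarrow> 0) at_top" by real_asymp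
  show "((\<lambda>u. - s / u\<^sup>2 * u) \<longlongrightarrow> 0) at_top" by real_asymp
  show "\<forall>\<^sub>F u in at_top. \<forall>q. (0 < x - s - s * x / u\<^sup>2 + br1 (u\<^sup>2) s q) \<longleftrightarrow>
       0 < x - s + b1 s q + (- s * x / u\<^sup>2 + 0 * b1 s q + 0 * b2 s q + - s / u\<^sup>2 * b1 (u\<^sup>2) q + 0 * b2 (u\<^sup>2) q)"
    by (intro always_eventually allI) (simp add: br1_def algebra_simps)
qed (simp_all)

text \<open>
  The second excess \<open>Y u\<close> may depend on \<open>u\<close>, which covers both regimes: it is constant when both
  constraints bind, and of order \<open>u\<close> or \<open>u\<^sup>2\<close> when only the first one does. The event \<open>E s\<close> is the limit of
  the second constraint.
\<close>

lemma exceed_prob_tendsto: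
  fixes Y :: "real \<Rightarrow> real" and E :: "real \<Rightarrow> 'b \<times> 'b \<Rightarrow> bool"
  assumes L: "0 < L" and \<delta>: "0 < \<delta>"
    and E[measurable (raw)]: "Measurable.pred (borel \<Otimes>\<^sub>M Q) (\<lambda>z. E (fst z) (snd z))"
    and bound: "\<forall>\<^sub>F u in at_top. \<forall>s. Q.prob {q\<in>space Q. 0 \<le> s \<and> s \<le> u\<^sup>2 \<and> in_quadrant a (u\<^sup>2) x (Y u) s q} \<le>
       C * (exp (- \<delta> * s) * indicator {0..} s)"
    and conv: "\<And>s. 0 < s \<Longrightarrow> ((\<lambda>u. Q.prob {q\<in>space Q.
       (0 < Y u - a * s - s * Y u / u\<^sup>2 + (\<rho> * br1 (u\<^sup>2) s q + \<kappa> * br2 (u\<^sup>2) s q)) \<noteq> E s q}) \<longlongrightarrow> 0) at_top"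
    and null: "Q.prob {q\<in>space Q. (\<integral>\<^sup>+s. indicator {s. 0 \<le> s \<and> 0 < x - s + b1 s q \<and> E s q} s \<partial>lborel) = ennreal L} = 0"
  shows "((\<lambda>u. exceed_prob L a (u\<^sup>2) x (Y u)) \<longlongrightarrow>
    Q.prob {q\<in>space Q. ennreal L < (\<integral>\<^sup>+s. indicator {s. 0 \<le> s \<and> 0 < x - s + b1 s q \<and> E s q} s \<partial>lborel)}) at_top"
  unfolding exceed_prob_def bridge_occupation_alt
proof (rule Q.occupation_prob_tendsto[OF _ _ _ bound _ L null])
  have Em: "Measurable.pred R (\<lambda>r. E (f r) (h r))" if "f \<in> borel_measurable R" "h \<in> R \<rightarrow>\<^sub>M Q" for f h R
    using measurable_compose[OF measurable_Pair[OF that] E] by simp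
  show "Measurable.pred (lborel \<Otimes>\<^sub>M Q) (\<lambda>z. 0 \<le> fst z \<and> fst z \<le> u\<^sup>2 \<and> in_quadrant a (u\<^sup>2) x (Y u) (fst z) (snd z))" for u
    by measurable
  have [measurable]: "Measurable.pred (lborel \<Otimes>\<^sub>M Q) (\<lambda>z. E (fst z) (snd z))" by (rule Em) simp_all
  show "Measurable.pred (lborel \<Otimes>\<^sub>M Q) (\<lambda>z. 0 \<le> fst z \<and> 0 < x - fst z + b1 (fst z) (snd z) \<and> E (fst z) (snd z))"
    by measurable
  show "integrable lborel (\<lambda>s. C * (exp (- \<delta> * s) * indicator {0..} s))"
    using exponential_integral[OF \<delta>] by (intro integrable_mult_right) (simp add: has_bochner_integral_iff)
  have "AE s in lborel. s \<noteq> (0::real)" by (rule AE_lborel_singleton)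
  then show "AE s in lborel. ((\<lambda>u. Q.prob {q\<in>space Q. (0 \<le> s \<and> s \<le> u\<^sup>2 \<and> in_quadrant a (u\<^sup>2) x (Y u) s q) \<noteq>
      (0 \<le> s \<and> 0 < x - s + b1 s q \<and> E s q)}) \<longlongrightarrow> 0) at_top"
  proof eventually_elim
    fix s :: real assume "s \<noteq> 0"
    show "((\<lambda>u. Q.prob {q\<in>space Q. (0 \<le> s \<and> s \<le> u\<^sup>2 \<and> in_quadrant a (u\<^sup>2) x (Y u) s q) \<noteq>
      (0 \<le> s \<and> 0 < x - s + b1 s q \<and> E s q)}) \<longlongrightarrow> 0) at_top"
    proof (cases "0 < s")
      case False
      with \<open>s \<noteq> 0\<close> have "\<not> 0 \<le> s" by simp
      then show ?thesis by simp
    next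
      case True
      have Es[measurable]: "Measurable.pred Q (E s)" by (rule Em) simp_all
      let ?p1 = "\<lambda>u. Q.prob {q\<in>space Q. (0 < x - s - s * x / u\<^sup>2 + br1 (u\<^sup>2) s q) \<noteq> (0 < x - s + b1 s q)}"
      let ?p2 = "\<lambda>u. Q.prob {q\<in>space Q. (0 < Y u - a * s - s * Y u / u\<^sup>2 + (\<rho> * br1 (u\<^sup>2) s q + \<kappa> * br2 (u\<^sup>2) s q)) \<noteq> E s q}"
      show ?thesis
      proof (rule tendsto_sandwich[OF _ _ tendsto_const])
        show "((\<lambda>u. ?p1 u + ?p2 u) \<longlongrightarrow> 0) at_top"
          using tendsto_add[OF first_coordinate_stable[OF True, of x] conv[OF True]] by simp
        have "\<forall>\<^sub>F u in at_top. s \<le> u\<^sup>2" by real_asymp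
        then show "\<forall>\<^sub>F u in at_top. Q.prob {q\<in>space Q. (0 \<le> s \<and> s \<le> u\<^sup>2 \<and> in_quadrant a (u\<^sup>2) x (Y u) s q) \<noteq>
          (0 \<le> s \<and> 0 < x - s + b1 s q \<and> E s q)} \<le> ?p1 u + ?p2 u"
        proof eventually_elim
          fix u :: real assume u: "s \<le> u\<^sup>2"
          have "Q.prob {q\<in>space Q. (0 \<le> s \<and> s \<le> u\<^sup>2 \<and> in_quadrant a (u\<^sup>2) x (Y u) s q) \<noteq>
              (0 \<le> s \<and> 0 < x - s + b1 s q \<and> E s q)} \<le>
             Q.prob ({q\<in>space Q. (0 < x - s - s * x / u\<^sup>2 + br1 (u\<^sup>2) s q) \<noteq> (0 < x - s + b1 s q)} \<union>
               {q\<in>space Q. (0 < Y u - a * s - s * Y u / u\<^sup>2 + (\<rho> * br1 (u\<^sup>2) s q + \<kappa> * br2 (u\<^sup>2) s q)) \<noteq> E s q})"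
          proof (rule Q.finite_measure_mono)
            show "{q\<in>space Q. (0 \<le> s \<and> s \<le> u\<^sup>2 \<and> in_quadrant a (u\<^sup>2) x (Y u) s q) \<noteq>
              (0 \<le> s \<and> 0 < x - s + b1 s q \<and> E s q)} \<subseteq> {q\<in>space Q. (0 < x - s - s * x / u\<^sup>2 + br1 (u\<^sup>2) s q) \<noteq> (0 < x - s + b1 s q)} \<union>
               {q\<in>space Q. (0 < Y u - a * s - s * Y u / u\<^sup>2 + (\<rho> * br1 (u\<^sup>2) s q + \<kappa> * br2 (u\<^sup>2) s q)) \<noteq> E s q}"
              using u unfolding in_quadrant_def by blast
          qed measurable
          also have "\<dots> \<le> ?p1 u + ?p2 u" by (rule measure_Un_le) measurable
          finally show "Q.prob {q\<in>space Q. (0 \<le> s \<and> s \<le> u\<^sup>2 \<and> in_quadrant a (u\<^sup>2) x (Y u) s q) \<noteq>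
          (0 \<le> s \<and> 0 < x - s + b1 s q \<and> E s q)} \<le> ?p1 u + ?p2 u" .
        qed
      qed simp
    qed
  qed
qed

lemma exceed_prob_tendsto_two:
  assumes L: "0 < L" and th: "0 \<le> \<theta>1" "0 \<le> \<theta>2" and gap: "0 < drift_gap a \<theta>1 \<theta>2"
    and null: "Q.prob {q\<in>space Q. occ2 a x y q = ennreal L} = 0"
  shows "((\<lambda>u. exceed_prob L a (u\<^sup>2) x y) \<longlongrightarrow> limit_prob2 L a x y) at_top"
  unfolding limit_prob2_def occ2_def lim_quadrant_def
proof (rule exceed_prob_tendsto[OF L gap, where C="exp (\<theta>1 * x + \<theta>2 * y)"])
  show "\<forall>\<^sub>F u in at_top. \<forall>s. Q.prob {q\<in>space Q. 0 \<le> s \<and> s \<le> u\<^sup>2 \<and> in_quadrant a (u\<^sup>2) x y s q} \<le>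
       exp (\<theta>1 * x + \<theta>2 * y) * (exp (- drift_gap a \<theta>1 \<theta>2 * s) * indicator {0..} s)"
    using eventually_gt_at_top[of 0]
    by eventually_elim (intro allI in_quadrant_bound th gap order_refl, simp)
  show "Q.prob {q\<in>space Q. (\<integral>\<^sup>+s. indicator {s. 0 \<le> s \<and> 0 < x - s + b1 s q \<and> 0 < y - a * s + (\<rho> * b1 s q + \<kappa> * b2 s q)} s \<partial>lborel) = ennreal L} = 0"
    using null unfolding occ2_def lim_quadrant_def .
  fix s :: real assume s: "0 < s"
  show "((\<lambda>u. Q.prob {q\<in>space Q. (0 < y - a * s - s * y / u\<^sup>2 + (\<rho> * br1 (u\<^sup>2) s q + \<kappa> * br2 (u\<^sup>2) s q)) \<noteq>
      (0 < y - a * s + (\<rho> * b1 s q + \<kappa> * b2 s q))}) \<longlongrightarrow> 0) at_top"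
  proof (rule affine_sign_stable[OF s, where \<alpha>="\<lambda>u. - s * y / u\<^sup>2" and ?\<beta>1.0="\<lambda>_. 0" and ?\<beta>2.0="\<lambda>_. 0" and
      ?\<gamma>1.0="\<lambda>u. - s * \<rho> / u\<^sup>2" and ?\<gamma>2.0="\<lambda>u. - s * \<kappa> / u\<^sup>2"])
    show "Q.prob {q\<in>space Q. y - a * s + (\<rho> * b1 s q + \<kappa> * b2 s q) = 0} = 0"
      by (rule no_atom_b2[OF s]) (use \<kappa>_pos in simp)
    show "((\<lambda>u. - s * y / u\<^sup>2) \<longlongrightarrow> 0) at_top" by real_asymp
    show "((\<lambda>u. - s * \<rho> / u\<^sup>2 * u) \<longlongrightarrow> 0) at_top" by real_asymp
    show "((\<lambda>u. - s * \<kappa> / u\<^sup>2 * u) \<longlongrightarrow> 0) at_top" by real_asymp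
    show "\<forall>\<^sub>F u in at_top. \<forall>q. (0 < y - a * s - s * y / u\<^sup>2 + (\<rho> * br1 (u\<^sup>2) s q + \<kappa> * br2 (u\<^sup>2) s q)) \<longleftrightarrow>
       0 < y - a * s + (\<rho> * b1 s q + \<kappa> * b2 s q) + (- s * y / u\<^sup>2 + 0 * b1 s q + 0 * b2 s q + - s * \<rho> / u\<^sup>2 * b1 (u\<^sup>2) q + - s * \<kappa> / u\<^sup>2 * b2 (u\<^sup>2) q)"
      by (intro always_eventually allI) (simp add: br1_def br2_def algebra_simps)
  qed simp_all
qed measurable

text \<open>
  The second constraint is divided by \<open>u\<^sup>2\<close> if \<open>a < \<rho>\<close> and by \<open>u\<close> if \<open>a = \<rho>\<close>; in both cases it tends to a
  deterministic condition that does not depend on \<open>s\<close>.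
\<close>

lemma exceed_prob_tendsto_one:
  assumes L: "0 < L" and a: "a \<le> \<rho>"
    and v: "a = \<rho> \<Longrightarrow> \<rho> * c1 - c2 + \<kappa> * v \<noteq> 0"
    and null: "Q.prob {q\<in>space Q. occ1 x q = ennreal L} = 0"
  shows "((\<lambda>u. exceed_prob L a (u\<^sup>2) x (second_excess a c1 c2 u x v)) \<longlongrightarrow>
    (if a < \<rho> \<or> 0 < \<rho> * c1 - c2 + \<kappa> * v then limit_prob1 L x else 0)) at_top"
proof -
  define c where "c = \<rho> * c1 - c2 + \<kappa> * v"
  define e where "e \<longleftrightarrow> a < \<rho> \<or> 0 < c"
  have gap: "drift_gap a 1 0 = 1 / 2" by (simp add: drift_gap_def)
  have "((\<lambda>u. exceed_prob L a (u\<^sup>2) x (second_excess a c1 c2 u x v)) \<longlongrightarrow>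
    Q.prob {q\<in>space Q. ennreal L < (\<integral>\<^sup>+s. indicator {s. 0 \<le> s \<and> 0 < x - s + b1 s q \<and> e} s \<partial>lborel)}) at_top"
  proof (rule exceed_prob_tendsto[OF L, where C="exp x" and \<delta>="1/2"])
    show "\<forall>\<^sub>F u in at_top. \<forall>s. Q.prob {q\<in>space Q. 0 \<le> s \<and> s \<le> u\<^sup>2 \<and> in_quadrant a (u\<^sup>2) x (second_excess a c1 c2 u x v) s q} \<le>
       exp x * (exp (- (1/2) * s) * indicator {0..} s)"
      using eventually_gt_at_top[of 0]
    proof eventually_elim
      fix u :: real assume "0 < u"
      then show "\<forall>s. Q.prob {q\<in>space Q. 0 \<le> s \<and> s \<le> u\<^sup>2 \<and> in_quadrant a (u\<^sup>2) x (second_excess a c1 c2 u x v) s q} \<le>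
       exp x * (exp (- (1/2) * s) * indicator {0..} s)"
        using in_quadrant_bound[of "u\<^sup>2" 1 0 "1/2" a] gap by simp
    qed
    show "Q.prob {q\<in>space Q. (\<integral>\<^sup>+s. indicator {s. 0 \<le> s \<and> 0 < x - s + b1 s q \<and> e} s \<partial>lborel) = ennreal L} = 0"
    proof (cases e)
      case True
      then show ?thesis using null unfolding occ1_def by simp
    next
      case False
      then show ?thesis using L by simp
    qed
    fix s :: real assume s: "0 < s"
    let ?Y = "\<lambda>u. second_excess a c1 c2 u x v"
    let ?Z = "\<lambda>u q. ?Y u - a * s - s * ?Y u / u\<^sup>2 + (\<rho> * br1 (u\<^sup>2) s q + \<kappa> * br2 (u\<^sup>2) s q)"
    show "((\<lambda>u. Q.prob {q\<in>space Q. (0 < ?Z u q) \<noteq> e}) \<longlongrightarrow> 0) at_top"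
    proof (cases "a < \<rho>")
      case True
      have "((\<lambda>u. Q.prob {q\<in>space Q. (0 < ?Z u q) \<noteq> (0 < \<rho> - a)}) \<longlongrightarrow> 0) at_top"
      proof (rule affine_sign_stable[OF s, where \<alpha>="\<lambda>u. c / u + \<rho> * x / u\<^sup>2 - s * ((\<rho> - a) * u\<^sup>2 + u * c + \<rho> * x) / u^4 - a * s / u\<^sup>2"
          and ?\<beta>1.0="\<lambda>u. \<rho> / u\<^sup>2" and ?\<beta>2.0="\<lambda>u. \<kappa> / u\<^sup>2" and
          ?\<gamma>1.0="\<lambda>u. - s * \<rho> / u^4" and ?\<gamma>2.0="\<lambda>u. - s * \<kappa> / u^4"])
        show "((\<lambda>u. c / u + \<rho> * x / u\<^sup>2 - s * ((\<rho> - a) * u\<^sup>2 + u * c + \<rho> * x) / u^4 - a * s / u\<^sup>2) \<longlongrightarrow> 0) at_top" by real_asymp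
        show "((\<lambda>u. \<rho> / u\<^sup>2) \<longlongrightarrow> 0) at_top" "((\<lambda>u. \<kappa> / u\<^sup>2) \<longlongrightarrow> 0) at_top" by real_asymp+
        show "((\<lambda>u. - s * \<rho> / u^4 * u) \<longlongrightarrow> 0) at_top" "((\<lambda>u. - s * \<kappa> / u^4 * u) \<longlongrightarrow> 0) at_top" by real_asymp+
        show "\<forall>\<^sub>F u in at_top. \<forall>q. (0 < ?Z u q) \<longleftrightarrow> 0 < \<rho> - a +
           (c / u + \<rho> * x / u\<^sup>2 - s * ((\<rho> - a) * u\<^sup>2 + u * c + \<rho> * x) / u^4 - a * s / u\<^sup>2 + \<rho> / u\<^sup>2 * b1 s q + \<kappa> / u\<^sup>2 * b2 s q
            + - s * \<rho> / u^4 * b1 (u\<^sup>2) q + - s * \<kappa> / u^4 * b2 (u\<^sup>2) q)"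
          using eventually_gt_at_top[of 0]
        proof eventually_elim
          fix u :: real assume u: "0 < u"
          have "?Z u q = u\<^sup>2 * (\<rho> - a +
           (c / u + \<rho> * x / u\<^sup>2 - s * ((\<rho> - a) * u\<^sup>2 + u * c + \<rho> * x) / u^4 - a * s / u\<^sup>2 + \<rho> / u\<^sup>2 * b1 s q + \<kappa> / u\<^sup>2 * b2 s q
            + - s * \<rho> / u^4 * b1 (u\<^sup>2) q + - s * \<kappa> / u^4 * b2 (u\<^sup>2) q))" for q
            using u unfolding second_excess_def c_def[symmetric] br1_def br2_def
            by (simp add: field_simps power2_eq_square power4_eq_xxxx)
          then show "\<forall>q. (0 < ?Z u q) \<longleftrightarrow> 0 < \<rho> - a +
           (c / u + \<rho> * x / u\<^sup>2 - s * ((\<rho> - a) * u\<^sup>2 + u * c + \<rho> * x) / u^4 - a * s / u\<^sup>2 + \<rho> / u\<^sup>2 * b1 s q + \<kappa> / u\<^sup>2 * b2 s q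
            + - s * \<rho> / u^4 * b1 (u\<^sup>2) q + - s * \<kappa> / u^4 * b2 (u\<^sup>2) q)"
            using u by (simp only: zero_less_mult_iff) simp
        qed
      qed (use True in simp_all)
      then show ?thesis using True by (simp add: e_def)
    next
      case False
      then have aq: "a = \<rho>" using a by simp
      have c0: "c \<noteq> 0" using v[OF aq] by (simp add: c_def)
      have "((\<lambda>u. Q.prob {q\<in>space Q. (0 < ?Z u q) \<noteq> (0 < c)}) \<longlongrightarrow> 0) at_top"
      proof (rule affine_sign_stable[OF s, where \<alpha>="\<lambda>u. \<rho> * x / u - s * (u * c + \<rho> * x) / u^3 - a * s / u"
          and ?\<beta>1.0="\<lambda>u. \<rho> / u" and ?\<beta>2.0="\<lambda>u. \<kappa> / u" and
          ?\<gamma>1.0="\<lambda>u. - s * \<rho> / u^3" and ?\<gamma>2.0="\<lambda>u. - s * \<kappa> / u^3"])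
        show "((\<lambda>u. \<rho> * x / u - s * (u * c + \<rho> * x) / u^3 - a * s / u) \<longlongrightarrow> 0) at_top" by real_asymp
        show "((\<lambda>u. \<rho> / u) \<longlongrightarrow> 0) at_top" "((\<lambda>u. \<kappa> / u) \<longlongrightarrow> 0) at_top" by real_asymp+
        show "((\<lambda>u. - s * \<rho> / u^3 * u) \<longlongrightarrow> 0) at_top" "((\<lambda>u. - s * \<kappa> / u^3 * u) \<longlongrightarrow> 0) at_top" by real_asymp+
        show "\<forall>\<^sub>F u in at_top. \<forall>q. (0 < ?Z u q) \<longleftrightarrow> 0 < c +
           (\<rho> * x / u - s * (u * c + \<rho> * x) / u^3 - a * s / u + \<rho> / u * b1 s q + \<kappa> / u * b2 s q
            + - s * \<rho> / u^3 * b1 (u\<^sup>2) q + - s * \<kappa> / u^3 * b2 (u\<^sup>2) q)"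
          using eventually_gt_at_top[of 0]
        proof eventually_elim
          fix u :: real assume u: "0 < u"
          have "?Z u q = u * (c +
           (\<rho> * x / u - s * (u * c + \<rho> * x) / u^3 - a * s / u + \<rho> / u * b1 s q + \<kappa> / u * b2 s q
            + - s * \<rho> / u^3 * b1 (u\<^sup>2) q + - s * \<kappa> / u^3 * b2 (u\<^sup>2) q))" for q
            using u aq unfolding second_excess_def c_def[symmetric] br1_def br2_def
            by (simp add: field_simps power2_eq_square power3_eq_cube)
          then show "\<forall>q. (0 < ?Z u q) \<longleftrightarrow> 0 < c +
           (\<rho> * x / u - s * (u * c + \<rho> * x) / u^3 - a * s / u + \<rho> / u * b1 s q + \<kappa> / u * b2 s q
            + - s * \<rho> / u^3 * b1 (u\<^sup>2) q + - s * \<kappa> / u^3 * b2 (u\<^sup>2) q)"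
            using u by (simp only: zero_less_mult_iff) simp
        qed
      qed (use c0 in simp_all)
      then show ?thesis using aq by (simp add: e_def)
    qed
  qed simp_all
  also have "Q.prob {q\<in>space Q. ennreal L < (\<integral>\<^sup>+s. indicator {s. 0 \<le> s \<and> 0 < x - s + b1 s q \<and> e} s \<partial>lborel)} =
     (if e then limit_prob1 L x else 0)"
    by (cases e) (simp_all add: limit_prob1_def occ1_def)
  finally show ?thesis by (simp only: e_def c_def)
qed

lemma occ1_level_null:
  assumes "0 < L" shows "AE x in lborel. Q.prob {q\<in>space Q. occ1 x q = ennreal L} = 0"
proof -
  have m: "(\<lambda>z. - fst z + b1 (fst z) (snd z)) \<in> borel_measurable (borel \<Otimes>\<^sub>M Q)" by measurable
  have "(\<integral>\<^sup>+x. emeasure Q {q\<in>space Q. (\<integral>\<^sup>+s. indicator {s. 0 \<le> s \<and> 0 < x + (- s + b1 s q)} s \<partial>lborel) = ennreal L} \<partial>lborel) = 0"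
    by (rule Q.occupation_level_null[OF m _ assms]) (intro continuous_intros b1_continuous)
  then have "(\<integral>\<^sup>+x. ennreal (Q.prob {q\<in>space Q. occ1 x q = ennreal L}) \<partial>lborel) = 0"
    by (simp add: occ1_def Q.emeasure_eq_measure algebra_simps)
  moreover have "(\<lambda>x. Q.prob {q\<in>space Q. occ1 x q = ennreal L}) \<in> borel_measurable lborel"
    by (rule Q.prob_section_measurable) measurable
  ultimately show ?thesis by (subst (asm) nn_integral_0_iff_AE) auto
qed

text \<open>
  Along each diagonal \<open>y = x + d\<close> the quadrant condition is \<open>0 < x + m s\<close> for the minimum \<open>m\<close> of two
  continuous paths, so that the one-parameter result applies; the shear \<open>(x, d) \<mapsto> (x, x + d)\<close>
  preserves null sets.
\<close>

lemma occ2_level_null: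
  assumes "0 < L" shows "AE p in lborel \<Otimes>\<^sub>M lborel. Q.prob {q\<in>space Q. occ2 a (fst p) (snd p) q = ennreal L} = 0"
proof -
  let ?e = "\<lambda>x y. Q.prob {q\<in>space Q. occ2 a x y q = ennreal L}"
  have e[measurable (raw)]: "(\<lambda>r. ?e (f r) (g r)) \<in> borel_measurable R"
    if [measurable]: "f \<in> borel_measurable R" "g \<in> borel_measurable R" for f g and R :: "'r measure"
    by (rule Q.prob_section_measurable) measurable
  have em: "(\<lambda>p. ?e (fst p) (snd p)) \<in> borel_measurable (lborel \<Otimes>\<^sub>M lborel)"
    by (rule Q.prob_section_measurable) measurable
  have em': "(\<lambda>p. ?e (fst p) (fst p + snd p)) \<in> borel_measurable (lborel \<Otimes>\<^sub>M lborel)"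
    by (rule Q.prob_section_measurable) measurable
  have es: "?e x \<in> borel_measurable borel" for x
    by (rule Q.prob_section_measurable) measurable
  have "(\<integral>\<^sup>+p. ennreal (?e (fst p) (snd p)) \<partial>(lborel \<Otimes>\<^sub>M lborel)) = (\<integral>\<^sup>+x. (\<integral>\<^sup>+y. ennreal (?e x y) \<partial>lborel) \<partial>lborel)"
    using em by (subst lborel.nn_integral_fst[symmetric]) simp_all
  also have "\<dots> = (\<integral>\<^sup>+x. (\<integral>\<^sup>+d. ennreal (?e x (x + d)) \<partial>lborel) \<partial>lborel)"
  proof (rule nn_integral_cong)
    fix x :: real
    show "(\<integral>\<^sup>+y. ennreal (?e x y) \<partial>lborel) = (\<integral>\<^sup>+d. ennreal (?e x (x + d)) \<partial>lborel)"
      using nn_integral_real_affine[of "\<lambda>y. ennreal (?e x y)" 1 x] es[of x] by simp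
  qed
  also have "\<dots> = (\<integral>\<^sup>+d. (\<integral>\<^sup>+x. ennreal (?e x (x + d)) \<partial>lborel) \<partial>lborel)"
    by (rule lborel_pair.Fubini'[symmetric]) (use em' in \<open>simp add: case_prod_beta'\<close>)
  also have "\<dots> = (\<integral>\<^sup>+d. 0 \<partial>(lborel :: real measure))"
  proof (rule nn_integral_cong)
    fix d :: real
    let ?m = "\<lambda>s q. min (- s + b1 s q) (d - a * s + (\<rho> * b1 s q + \<kappa> * b2 s q))"
    have m: "(\<lambda>z. ?m (fst z) (snd z)) \<in> borel_measurable (borel \<Otimes>\<^sub>M Q)" by measurable
    have key: "0 < x + ?m s q \<longleftrightarrow> lim_quadrant a x (x + d) s q" for x s q
    proof -
      have "0 < x + min A B \<longleftrightarrow> 0 < x + A \<and> 0 < x + B" for A B :: real by linarith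
      from this[of "- s + b1 s q"] show ?thesis
        unfolding lim_quadrant_def by (simp add: algebra_simps)
    qed
    have z: "(\<integral>\<^sup>+x. emeasure Q {q\<in>space Q. (\<integral>\<^sup>+s. indicator {s. 0 \<le> s \<and> 0 < x + ?m s q} s \<partial>lborel) = ennreal L} \<partial>lborel) = 0"
      by (rule Q.occupation_level_null[OF m _ assms]) (intro continuous_intros b1_continuous b2_continuous)
    show "(\<integral>\<^sup>+x. ennreal (?e x (x + d)) \<partial>lborel) = 0"
      using z unfolding key occ2_def[symmetric] Q.emeasure_eq_measure .
  qed
  finally have "(\<integral>\<^sup>+p. ennreal (?e (fst p) (snd p)) \<partial>(lborel \<Otimes>\<^sub>M lborel)) = 0" by simp
  then show ?thesis using em by (subst (asm) nn_integral_0_iff_AE) auto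
qed

text \<open>
  On \<open>[0, L + 1]\<close> a continuous path is bounded, so that for large levels it stays in the quadrant
  during this whole interval.
\<close>

lemma limit_prob2_pos: "\<exists>n. \<forall>x\<ge>n. \<forall>y\<ge>n. 0 < limit_prob2 L a x y"
proof -
  have mono: "occ2 a x y q \<le> occ2 a x' y' q" if "x \<le> x'" "y \<le> y'" for x x' y y' q
    unfolding occ2_def by (rule nn_integral_mono) (use that in \<open>auto simp: lim_quadrant_def indicator_def\<close>)
  let ?A = "\<lambda>n::nat. {q\<in>space Q. ennreal L < occ2 a (real n) (real n) q}"
  have "\<exists>n. ennreal L < occ2 a (real n) (real n) q" if q: "q \<in> space Q" for q
  proof -
    define l where "l = max L 0 + 1"
    have l: "0 < l" "L < l" by (auto simp: l_def)
    let ?f = "\<lambda>s. \<bar>- s + b1 s q\<bar> + \<bar>- a * s + (\<rho> * b1 s q + \<kappa> * b2 s q)\<bar>"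
    have "continuous_on {0..l} ?f" by (intro continuous_intros b1_continuous b2_continuous q)
    then have "bounded (?f ` {0..l})" by (intro compact_imp_bounded compact_continuous_image) auto
    then obtain K where "\<forall>z\<in>?f ` {0..l}. norm z \<le> K" unfolding bounded_iff by blast
    then have K: "norm (?f s) \<le> K" if "s \<in> {0..l}" for s using that by blast
    obtain n :: nat where n: "K < real n" using reals_Archimedean2 by auto
    have "{0..l} \<subseteq> {s. 0 \<le> s \<and> lim_quadrant a (real n) (real n) s q}"
    proof
      fix s assume s: "s \<in> {0..l}"
      then show "s \<in> {s. 0 \<le> s \<and> lim_quadrant a (real n) (real n) s q}"
        using K[OF s] n unfolding lim_quadrant_def by auto
    qed
    then have "(\<integral>\<^sup>+s. indicator {0..l} s \<partial>lborel) \<le> occ2 a (real n) (real n) q"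
      unfolding occ2_def by (intro nn_integral_mono) (auto simp: indicator_def)
    then have "ennreal l \<le> occ2 a (real n) (real n) q" using l by simp
    moreover have "ennreal L < ennreal l" using l by (simp add: ennreal_less_iff ennreal_lessI)
    ultimately show ?thesis by (meson less_le_trans)
  qed
  then have U: "(\<Union>n. ?A n) = space Q" by auto
  have "(\<lambda>n. Q.prob (?A n)) \<longlonglongrightarrow> Q.prob (\<Union>n. ?A n)"
  proof (rule Q.finite_Lim_measure_incseq)
    show "incseq ?A"
    proof (rule incseq_SucI)
      fix n show "?A n \<subseteq> ?A (Suc n)"
        using mono[of "real n" "real (Suc n)" "real n" "real (Suc n)"] by (auto intro: less_le_trans)
    qed
    show "range ?A \<subseteq> Q.events"
    proof safe
      fix n show "?A n \<in> Q.events" by measurable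
    qed
  qed
  then have "(\<lambda>n. Q.prob (?A n)) \<longlonglongrightarrow> 1" unfolding U Q.prob_space .
  from order_tendstoD(1)[OF this, of 0] obtain n where n: "0 < Q.prob (?A n)"
    by (auto simp: eventually_sequentially)
  show ?thesis
  proof (intro exI[of _ "real n"] allI impI)
    fix x y assume "real n \<le> x" "real n \<le> y"
    then have "Q.prob (?A n) \<le> limit_prob2 L a x y"
      unfolding limit_prob2_def
      by (intro Q.finite_measure_mono) (auto intro: less_le_trans mono)
    then show "0 < limit_prob2 L a x y" using n by simp
  qed
qed

lemma limit_prob1_pos: "\<exists>n. \<forall>x\<ge>n. 0 < limit_prob1 L x"
proof -
  obtain n where n: "\<And>x y. n \<le> x \<Longrightarrow> n \<le> y \<Longrightarrow> 0 < limit_prob2 L 0 x y" using limit_prob2_pos[of L 0] by auto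
  have "limit_prob2 L 0 x n \<le> limit_prob1 L x" for x
  proof -
    have "occ2 0 x n q \<le> occ1 x q" for q
      unfolding occ1_def occ2_def by (intro nn_integral_mono) (auto simp: lim_quadrant_def indicator_def)
    then show ?thesis unfolding limit_prob1_def limit_prob2_def
      by (intro Q.finite_measure_mono) (auto intro: less_le_trans)
  qed
  then show ?thesis using n by (metis less_le_trans order_refl)
qed

end

section \<open>Dominated convergence\<close>

lemma has_bochner_integral_lborel_product:
  fixes f g :: "real \<Rightarrow> real"
  assumes f: "integrable lborel f" "\<And>x. 0 \<le> f x" and g: "integrable lborel g" "\<And>x. 0 \<le> g x"
  shows "has_bochner_integral (lborel \<Otimes>\<^sub>M lborel) (\<lambda>p. f (fst p) * g (snd p)) (integral\<^sup>L lborel f * integral\<^sup>L lborel g)"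
proof (rule has_bochner_integral_nn_integral)
  have [measurable]: "f \<in> borel_measurable borel" "g \<in> borel_measurable borel"
    using f(1) g(1) by (auto dest: borel_measurable_integrable)
  show m: "(\<lambda>p. f (fst p) * g (snd p)) \<in> borel_measurable (lborel \<Otimes>\<^sub>M lborel)" by measurable
  show "AE p in lborel \<Otimes>\<^sub>M lborel. 0 \<le> f (fst p) * g (snd p)" using f g by simp
  show "0 \<le> integral\<^sup>L lborel f * integral\<^sup>L lborel g" using f g by simp
  have "(\<integral>\<^sup>+p. ennreal (f (fst p) * g (snd p)) \<partial>(lborel \<Otimes>\<^sub>M lborel)) = (\<integral>\<^sup>+x. (\<integral>\<^sup>+y. ennreal (f x * g y) \<partial>lborel) \<partial>lborel)"
    using m by (subst lborel.nn_integral_fst[symmetric]) simp_all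
  also have "\<dots> = (\<integral>\<^sup>+x. ennreal (f x) * ennreal (integral\<^sup>L lborel g) \<partial>lborel)"
    using f g by (simp add: ennreal_mult nn_integral_cmult nn_integral_eq_integral)
  also have "\<dots> = ennreal (integral\<^sup>L lborel f * integral\<^sup>L lborel g)"
    using f g by (simp add: nn_integral_multc nn_integral_eq_integral ennreal_mult)
  finally show "(\<integral>\<^sup>+p. ennreal (f (fst p) * g (snd p)) \<partial>(lborel \<Otimes>\<^sub>M lborel)) = ennreal (integral\<^sup>L lborel f * integral\<^sup>L lborel g)" .
qed

lemma integrable_exp_abs:
  assumes "0 < \<epsilon>" shows "integrable lborel (\<lambda>x::real. exp (- \<epsilon> * \<bar>x\<bar>))"
proof -
  have i: "integrable lborel (\<lambda>s::real. exp (- \<epsilon> * s) * indicator {0<..} s)"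
    using exponential_integral_open[OF assms] by (auto simp: has_bochner_integral_iff)
  have j: "integrable lborel (\<lambda>s::real. exp (- \<epsilon> * (0 + -1 * s)) * indicator {0<..} (0 + -1 * s))"
    using lborel_integrable_real_affine[OF i, of "-1" 0] by simp
  show ?thesis
  proof (rule Bochner_Integration.integrable_bound[OF Bochner_Integration.integrable_add[OF i j]])
    have "AE x in lborel. x \<noteq> (0::real)" by (rule AE_lborel_singleton)
    then show "AE x in lborel. norm (exp (- \<epsilon> * \<bar>x\<bar>)) \<le> norm (exp (- \<epsilon> * x) * indicator {0<..} x + exp (- \<epsilon> * (0 + - 1 * x)) * indicator {0<..} (0 + - 1 * x))"
      by eventually_elim (auto simp: indicator_def)
  qed simp
qed

text \<open>
  Dominated convergence for a quotient of two integrals with a common prefactor \<open>C\<close>, which may decay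
  at any rate.
\<close>

lemma ratio_tendsto_one:
  fixes f g :: "real \<Rightarrow> 'p \<Rightarrow> real"
  assumes f: "\<And>u. f u \<in> borel_measurable M" "\<And>u p. 0 \<le> f u p" and g: "\<And>u. g u \<in> borel_measurable M" "\<And>u p. 0 \<le> g u p"
    and f0: "f0 \<in> borel_measurable M" and g0: "g0 \<in> borel_measurable M" and w: "integrable M w"
    and fb: "\<forall>\<^sub>F u in at_top. \<forall>p. f u p \<le> w p" and gb: "\<forall>\<^sub>F u in at_top. \<forall>p. g u p \<le> w p"
    and fl: "AE p in M. ((\<lambda>u. f u p) \<longlongrightarrow> f0 p) at_top" and gl: "AE p in M. ((\<lambda>u. g u p) \<longlongrightarrow> g0 p) at_top"
    and C: "\<forall>\<^sub>F u in at_top. 0 < C u"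
    and A: "\<forall>\<^sub>F u in at_top. 0 \<le> A u \<and> ennreal (A u) = ennreal (C u) * (\<integral>\<^sup>+p. ennreal (f u p) \<partial>M)"
    and B: "\<forall>\<^sub>F u in at_top. 0 \<le> B u \<and> ennreal (B u) = ennreal (C u) * (\<integral>\<^sup>+p. ennreal (g u p) \<partial>M)"
    and K: "integral\<^sup>L M f0 = K * integral\<^sup>L M g0" "integral\<^sup>L M f0 \<noteq> 0"
  shows "((\<lambda>u. A u / (K * B u)) \<longlongrightarrow> 1) at_top"
proof -
  have fb': "\<forall>\<^sub>F u in at_top. AE p in M. norm (f u p) \<le> w p" using fb by eventually_elim (use f in auto)
  have gb': "\<forall>\<^sub>F u in at_top. AE p in M. norm (g u p) \<le> w p" using gb by eventually_elim (use g in auto)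
  have F: "((\<lambda>u. integral\<^sup>L M (f u)) \<longlongrightarrow> integral\<^sup>L M f0) at_top"
    by (rule integral_dominated_convergence_at_top[OF f0 f(1) w fl fb'])
  have G: "((\<lambda>u. integral\<^sup>L M (g u)) \<longlongrightarrow> integral\<^sup>L M g0) at_top"
    by (rule integral_dominated_convergence_at_top[OF g0 g(1) w gl gb'])
  have nz: "K * integral\<^sup>L M g0 \<noteq> 0" using K by auto
  have "((\<lambda>u. integral\<^sup>L M (f u) / (K * integral\<^sup>L M (g u))) \<longlongrightarrow> integral\<^sup>L M f0 / (K * integral\<^sup>L M g0)) at_top"
    by (intro tendsto_divide tendsto_mult tendsto_const F G nz)
  then have lim: "((\<lambda>u. integral\<^sup>L M (f u) / (K * integral\<^sup>L M (g u))) \<longlongrightarrow> 1) at_top" using K nz by simp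
  have eq: "a = c * integral\<^sup>L M h"
    if "0 \<le> a" "ennreal a = ennreal c * (\<integral>\<^sup>+p. ennreal (h p) \<partial>M)" "0 < c" "h \<in> borel_measurable M" "\<And>p. 0 \<le> h p" "AE p in M. norm (h p) \<le> w p" for a c h
  proof -
    have "integrable M h" by (rule Bochner_Integration.integrable_bound[OF w that(4)]) (use that(6) in \<open>eventually_elim, auto\<close>)
    then have "ennreal a = ennreal (c * integral\<^sup>L M h)" using that by (simp add: nn_integral_eq_integral ennreal_mult)
    then show ?thesis using that by simp
  qed
  show ?thesis using lim
  proof (rule Lim_transform_eventually)
    show "\<forall>\<^sub>F u in at_top. integral\<^sup>L M (f u) / (K * integral\<^sup>L M (g u)) = A u / (K * B u)"
      using A B C fb' gb'
    proof eventually_elim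
      fix u assume *: "0 \<le> A u \<and> ennreal (A u) = ennreal (C u) * (\<integral>\<^sup>+p. ennreal (f u p) \<partial>M)"
        "0 \<le> B u \<and> ennreal (B u) = ennreal (C u) * (\<integral>\<^sup>+p. ennreal (g u p) \<partial>M)"
        "0 < C u" "AE p in M. norm (f u p) \<le> w p" "AE p in M. norm (g u p) \<le> w p"
      have "A u = C u * integral\<^sup>L M (f u)" by (rule eq) (use * f in auto)
      moreover have "B u = C u * integral\<^sup>L M (g u)" by (rule eq) (use * g in auto)
      ultimately show "integral\<^sup>L M (f u) / (K * integral\<^sup>L M (g u)) = A u / (K * B u)"
        using \<open>0 < C u\<close> by simp
    qed
  qed
qed

lemma integrable_dominated_limit:
  fixes f :: "real \<Rightarrow> 'p \<Rightarrow> real"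
  assumes f0: "f0 \<in> borel_measurable M" and nn: "\<And>u p. 0 \<le> f u p" and w: "integrable M w"
    and fb: "\<forall>\<^sub>F u in at_top. \<forall>p. f u p \<le> w p"
    and fl: "AE p in M. ((\<lambda>u. f u p) \<longlongrightarrow> f0 p) at_top"
  shows "integrable M f0"
proof (rule Bochner_Integration.integrable_bound[OF w f0])
  show "AE p in M. norm (f0 p) \<le> norm (w p)"
    using fl
  proof eventually_elim
    fix p assume l: "((\<lambda>u. f u p) \<longlongrightarrow> f0 p) at_top"
    have "f0 p \<le> w p" by (rule tendsto_upperbound[OF l]) (use fb in \<open>auto elim: eventually_mono\<close>)
    moreover have "0 \<le> f0 p" by (rule tendsto_lowerbound[OF l]) (use nn in auto)
    ultimately show "norm (f0 p) \<le> norm (w p)" by simp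
  qed
qed

lemma positive_integral_on_orthant:
  fixes f0 :: "real \<times> real \<Rightarrow> real"
  assumes i: "integrable (lborel \<Otimes>\<^sub>M lborel) f0" and nn: "\<And>p. 0 \<le> f0 p"
    and pos: "\<And>x y. m \<le> x \<Longrightarrow> n \<le> y \<Longrightarrow> 0 < f0 (x, y)"
  shows "0 < integral\<^sup>L (lborel \<Otimes>\<^sub>M lborel) f0"
proof (rule ccontr)
  assume "\<not> ?thesis"
  moreover have "0 \<le> integral\<^sup>L (lborel \<Otimes>\<^sub>M lborel) f0" using nn by simp
  ultimately have "integral\<^sup>L (lborel \<Otimes>\<^sub>M lborel) f0 = 0" by simp
  then have "AE p in lborel \<Otimes>\<^sub>M lborel. f0 p = 0"
    using integral_nonneg_eq_0_iff_AE[OF i] nn by simp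
  then have "AE p in lborel \<Otimes>\<^sub>M lborel. p \<notin> {m..m+1} \<times> {n..n+1}"
  proof eventually_elim
    fix p assume "f0 p = 0" then show "p \<notin> {m..m+1} \<times> {n..n+1}"
      using pos[of "fst p" "snd p"] by (cases p) auto
  qed
  then have "emeasure (lborel \<Otimes>\<^sub>M lborel) ({m..m+1} \<times> {n..n+1}) = 0"
    by (subst (asm) AE_iff_measurable[of "{m..m+1} \<times> {n..n+1}"]) (auto simp: space_pair_measure)
  then show False by (simp add: lborel.emeasure_pair_measure_Times)
qed

context brownian_pair
begin

definition ruin_prob :: "real \<Rightarrow> real \<Rightarrow> real \<Rightarrow> real \<Rightarrow> real \<Rightarrow> real" where
  "ruin_prob L a c1 c2 u = Q.prob {q\<in>space Q. (\<integral>\<^sup>+t\<in>{0..1}. indicator {t. u < b1 t q - c1 * t \<and> a * u < \<rho> * b1 t q + \<kappa> * b2 t q - c2 * t} t \<partial>lborel) > ennreal (L / u\<^sup>2)}"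

definition terminal_prob :: "real \<Rightarrow> real \<Rightarrow> real \<Rightarrow> real \<Rightarrow> real" where
  "terminal_prob a c1 c2 u = Q.prob {q\<in>space Q. u < b1 1 q - c1 \<and> a * u < \<rho> * b1 1 q + \<kappa> * b2 1 q - c2}"

text \<open>
  The limiting integrands are products of a function of \<open>x\<close> and the density \<open>\<psi>\<close> of \<open>v\<close> restricted to the
  event that the second constraint holds in the limit. The integral of \<open>\<psi>\<close> cancels in the quotient.
\<close>

lemma parisian_one_coordinate:
  assumes L: "0 < L" and a: "a \<le> \<rho>"
  defines "K \<equiv> LINT x|lborel. exp (- x) * limit_prob1 L x"
  shows "integrable lborel (\<lambda>x. exp (- x) * limit_prob1 L x)" "0 < K"
    "((\<lambda>u. ruin_prob L a c1 c2 u / (K * terminal_prob a c1 c2 u)) \<longlongrightarrow> 1) at_top"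
proof -
  let ?LL = "lborel \<Otimes>\<^sub>M lborel :: (real \<times> real) measure"
  define C where "C u = exp (- u\<^sup>2 * (1 + c1 / u)\<^sup>2 / 2) / (u * sqrt (2 * pi))" for u
  define k where "k u x = exp (- x * (1 + c1 / u) - x\<^sup>2 / (2 * u\<^sup>2))" for u x :: real
  define f where "f u p = k u (fst p) * std_normal_density (snd p) * exceed_prob L a (u\<^sup>2) (fst p) (second_excess a c1 c2 u (fst p) (snd p))" for u p
  define g where "g u p = k u (fst p) * std_normal_density (snd p) * (indicator {0<..} (fst p) * indicator {0<..} (second_excess a c1 c2 u (fst p) (snd p)))" for u p
  define e where "e v \<longleftrightarrow> a < \<rho> \<or> 0 < \<rho> * c1 - c2 + \<kappa> * v" for v
  define \<psi> where "\<psi> v = std_normal_density v * of_bool (e v)" for v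
  define f0 where "f0 p = exp (- fst p) * limit_prob1 L (fst p) * \<psi> (snd p)" for p
  define g0 where "g0 p = exp (- 1 * fst p) * indicator {0<..} (fst p) * \<psi> (snd p)" for p
  define w where "w p = (exp (- (1/4) * \<bar>fst p\<bar>) * (1 + 8 / (3 * L))) * std_normal_density (snd p)" for p :: "real \<times> real"
  have em[measurable]: "Measurable.pred borel e" unfolding e_def by measurable
  have [measurable]: "\<psi> \<in> borel_measurable borel" unfolding \<psi>_def by measurable
  have k0: "0 < k u x" for u x by (simp add: k_def)
  have km[measurable (raw)]: "(\<lambda>r. k u (h r)) \<in> borel_measurable R" if [measurable]: "h \<in> borel_measurable R" for h u and R :: "'r measure"
    unfolding k_def by measurable
  have fm: "f u \<in> borel_measurable ?LL" for u unfolding f_def second_excess_def k_def by measurable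
  have gm: "g u \<in> borel_measurable ?LL" for u unfolding g_def second_excess_def k_def by measurable
  have f0m: "f0 \<in> borel_measurable ?LL" unfolding f0_def by measurable
  have g0m: "g0 \<in> borel_measurable ?LL" unfolding g0_def by measurable
  have fnn: "0 \<le> f u p" for u p using k0[of u "fst p"] by (simp add: f_def exceed_prob_def)
  have gnn: "0 \<le> g u p" for u p using k0[of u "fst p"] by (simp add: g_def)
  have wi: "integrable ?LL w"
    using has_bochner_integral_lborel_product[of "\<lambda>x. exp (- (1/4) * \<bar>x\<bar>) * (1 + 8 / (3 * L))" std_normal_density]
      integrable_exp_abs[of "1/4"] L unfolding w_def by (auto simp: has_bochner_integral_iff)
  have \<psi>i: "integrable lborel \<psi>"
    by (rule Bochner_Integration.integrable_bound[of lborel std_normal_density]) (auto simp: \<psi>_def)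
  have \<psi>nn: "0 \<le> \<psi> v" for v by (simp add: \<psi>_def)
  have \<psi>pos: "0 < integral\<^sup>L lborel \<psi>"
  proof (rule ccontr)
    assume "\<not> ?thesis"
    moreover have "0 \<le> integral\<^sup>L lborel \<psi>" using \<psi>nn by simp
    ultimately have "integral\<^sup>L lborel \<psi> = 0" by simp
    then have "AE v in lborel. \<psi> v = 0" using integral_nonneg_eq_0_iff_AE[OF \<psi>i] \<psi>nn by simp
    moreover define v0 where "v0 = (1 + c2 - \<rho> * c1) / \<kappa>"
    ultimately have "AE v in lborel. v \<notin> {v0..v0+1}"
    proof (elim AE_mp, intro AE_I2 impI)
      fix v assume z: "\<psi> v = 0"
      show "v \<notin> {v0..v0+1}"
      proof
        assume "v \<in> {v0..v0+1}"
        then have "1 + c2 - \<rho> * c1 \<le> \<kappa> * v" using \<kappa>_pos by (auto simp: v0_def field_simps)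
        then have "e v" by (simp add: e_def)
        then show False using z normal_density_pos[of 1 0 v] by (simp add: \<psi>_def)
      qed
    qed
    then have "emeasure lborel {v0..v0+1} = 0" by (subst (asm) AE_iff_measurable[of "{v0..v0+1}"]) auto
    then show False by simp
  qed
  have ex: "exceed_prob L a (u\<^sup>2) x y \<le> exp (x - \<bar>x\<bar> / 2) * (8 / (3 * L))" if "0 < u" for u x y
    by (rule exceed_prob_bound_one[OF _ L]) (use that in simp)
  have kb: "k u x \<le> exp (- x + \<bar>x\<bar> / 4)" if u: "0 < u" "4 * \<bar>c1\<bar> \<le> u" for u x
  proof -
    have "- x * (c1 / u) \<le> \<bar>- x * (c1 / u)\<bar>" by (rule abs_ge_self)
    also have "\<dots> = \<bar>x\<bar> * (\<bar>c1\<bar> / u)" using u by (simp add: abs_mult)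
    also have "\<dots> \<le> \<bar>x\<bar> * (1 / 4)" using u by (intro mult_left_mono) (auto simp: field_simps)
    finally have *: "- x * (c1 / u) \<le> \<bar>x\<bar> * (1 / 4)" .
    have "- x * (1 + c1 / u) - x\<^sup>2 / (2 * u\<^sup>2) \<le> - x + \<bar>x\<bar> / 4"
    proof -
      have "- x * (1 + c1 / u) = - x + - x * (c1 / u)" by (simp add: algebra_simps)
      moreover have "0 \<le> x\<^sup>2 / (2 * u\<^sup>2)" by simp
      ultimately show ?thesis using * by linarith
    qed
    then show ?thesis by (simp add: k_def)
  qed
  have evu: "\<forall>\<^sub>F u in at_top. 0 < u \<and> 4 * \<bar>c1\<bar> \<le> (u::real)"
    by (intro eventually_conj eventually_gt_at_top eventually_ge_at_top)
  have cut: "exp (- x + \<bar>x\<bar> / 4) * z \<le> exp (- (1/4) * \<bar>x\<bar>) * (1 + 8 / (3 * L))"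
    if "z \<le> exp (x - \<bar>x\<bar> / 2) * z'" "z' \<le> 1 + 8 / (3 * L)" for x z z'
  proof -
    have "exp (- x + \<bar>x\<bar> / 4) * z \<le> exp (- x + \<bar>x\<bar> / 4) * (exp (x - \<bar>x\<bar> / 2) * z')"
      using that by (intro mult_left_mono) auto
    also have "\<dots> = exp (- (1/4) * \<bar>x\<bar>) * z'" by (simp add: exp_add[symmetric] mult.assoc[symmetric])
    also have "\<dots> \<le> exp (- (1/4) * \<bar>x\<bar>) * (1 + 8 / (3 * L))" using that by (intro mult_left_mono) auto
    finally show ?thesis .
  qed
  have fb: "\<forall>\<^sub>F u in at_top. \<forall>p. f u p \<le> w p"
    using evu
  proof (eventually_elim, intro allI)
    fix u :: real and p :: "real \<times> real" assume u: "0 < u \<and> 4 * \<bar>c1\<bar> \<le> u"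
    let ?P = "exceed_prob L a (u\<^sup>2) (fst p) (second_excess a c1 c2 u (fst p) (snd p))"
    have "k u (fst p) * ?P \<le> exp (- fst p + \<bar>fst p\<bar> / 4) * ?P"
      using u by (intro mult_right_mono kb) (auto simp: exceed_prob_def)
    also have "\<dots> \<le> exp (- (1/4) * \<bar>fst p\<bar>) * (1 + 8 / (3 * L))"
      by (rule cut[OF ex]) (use u in auto)
    finally have "k u (fst p) * ?P * std_normal_density (snd p) \<le> w p"
      unfolding w_def by (rule mult_right_mono) simp
    then show "f u p \<le> w p" by (simp add: f_def mult_ac)
  qed
  have gb: "\<forall>\<^sub>F u in at_top. \<forall>p. g u p \<le> w p"
    using evu
  proof (eventually_elim, intro allI)
    fix u :: real and p :: "real \<times> real" assume u: "0 < u \<and> 4 * \<bar>c1\<bar> \<le> u"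
    let ?P = "indicator {0<..} (fst p) * indicator {0<..} (second_excess a c1 c2 u (fst p) (snd p)) :: real"
    have "k u (fst p) * ?P \<le> exp (- fst p + \<bar>fst p\<bar> / 4) * ?P"
      using u by (intro mult_right_mono kb) auto
    also have "\<dots> \<le> exp (- (1/4) * \<bar>fst p\<bar>) * (1 + 8 / (3 * L))"
      by (rule cut[of _ _ 1]) (use L in \<open>auto simp: indicator_def\<close>)
    finally have "k u (fst p) * ?P * std_normal_density (snd p) \<le> w p"
      unfolding w_def by (rule mult_right_mono) simp
    then show "g u p \<le> w p" by (simp add: g_def mult_ac)
  qed
  have kl: "((\<lambda>u. k u x) \<longlongrightarrow> exp (- x)) at_top" for x unfolding k_def by real_asymp
  have AEx: "AE p in ?LL. Q.prob {q\<in>space Q. occ1 (fst p) q = ennreal L} = 0"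
  proof (rule lborel_pair.AE_pair_measure)
    have "(\<lambda>p. Q.prob {q\<in>space Q. occ1 (fst p) q = ennreal L}) \<in> borel_measurable ?LL"
      by (rule Q.prob_section_measurable) measurable
    then show "{p\<in>space ?LL. Q.prob {q\<in>space Q. occ1 (fst p) q = ennreal L} = 0} \<in> sets ?LL" by measurable
    show "AE x in lborel. AE y in lborel. Q.prob {q\<in>space Q. occ1 (fst (x, y)) q = ennreal L} = 0"
      using occ1_level_null[OF L] by eventually_elim simp
  qed
  have AEv: "AE p in ?LL. \<rho> * c1 - c2 + \<kappa> * snd p \<noteq> 0"
  proof (rule lborel_pair.AE_pair_measure)
    show "{p\<in>space ?LL. \<rho> * c1 - c2 + \<kappa> * snd p \<noteq> 0} \<in> sets ?LL" by measurable
    have "AE v in lborel. v \<noteq> (c2 - \<rho> * c1) / \<kappa>" by (rule AE_lborel_singleton)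
    then have "AE y in lborel. \<rho> * c1 - c2 + \<kappa> * y \<noteq> 0"
      by eventually_elim (use \<kappa>_pos in \<open>auto simp: field_simps\<close>)
    then show "AE x in lborel. AE y in lborel. \<rho> * c1 - c2 + \<kappa> * snd (x, y) \<noteq> 0" by simp
  qed
  have fl: "AE p in ?LL. ((\<lambda>u. f u p) \<longlongrightarrow> f0 p) at_top"
    using AEx AEv
  proof eventually_elim
    fix p :: "real \<times> real" assume n: "Q.prob {q\<in>space Q. occ1 (fst p) q = ennreal L} = 0" and v: "\<rho> * c1 - c2 + \<kappa> * snd p \<noteq> 0"
    have "((\<lambda>u. f u p) \<longlongrightarrow> exp (- fst p) * std_normal_density (snd p) * (if a < \<rho> \<or> 0 < \<rho> * c1 - c2 + \<kappa> * snd p then limit_prob1 L (fst p) else 0)) at_top"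
      unfolding f_def by (intro tendsto_mult kl tendsto_const exceed_prob_tendsto_one[OF L a v n])
    also have "exp (- fst p) * std_normal_density (snd p) * (if a < \<rho> \<or> 0 < \<rho> * c1 - c2 + \<kappa> * snd p then limit_prob1 L (fst p) else 0) = f0 p"
      by (simp add: f0_def \<psi>_def e_def)
    finally show "((\<lambda>u. f u p) \<longlongrightarrow> f0 p) at_top" .
  qed
  have gl: "AE p in ?LL. ((\<lambda>u. g u p) \<longlongrightarrow> g0 p) at_top"
    using AEv
  proof eventually_elim
    fix p :: "real \<times> real" assume v: "\<rho> * c1 - c2 + \<kappa> * snd p \<noteq> 0"
    let ?c = "\<rho> * c1 - c2 + \<kappa> * snd p"
    have "\<forall>\<^sub>F u in at_top. (0 < second_excess a c1 c2 u (fst p) (snd p)) = e (snd p)"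
    proof (cases "a < \<rho>")
      case True
      then have "0 < \<rho> - a" by simp
      then have "\<forall>\<^sub>F u in at_top. 0 < (\<rho> - a) * u\<^sup>2 + u * ?c + \<rho> * fst p" by real_asymp
      then show ?thesis by eventually_elim (use True in \<open>simp add: second_excess_def e_def\<close>)
    next
      case False
      then have aq: "a = \<rho>" using a by simp
      show ?thesis
      proof (cases "0 < ?c")
        case True
        then have "\<forall>\<^sub>F u in at_top. 0 < u * ?c + \<rho> * fst p" by real_asymp
        then show ?thesis by eventually_elim (use True aq in \<open>simp add: second_excess_def e_def\<close>)
      next
        case False
        then have "?c < 0" using v by simp
        then have "\<forall>\<^sub>F u in at_top. u * ?c + \<rho> * fst p < 0" by real_asymp
        then show ?thesis by eventually_elim (use False aq in \<open>simp add: second_excess_def e_def\<close>)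
      qed
    qed
    then have "\<forall>\<^sub>F u in at_top. k u (fst p) * std_normal_density (snd p) * (indicator {0<..} (fst p) * of_bool (e (snd p))) = g u p"
      by eventually_elim (simp add: g_def indicator_def)
    moreover have "((\<lambda>u. k u (fst p) * std_normal_density (snd p) * (indicator {0<..} (fst p) * of_bool (e (snd p)))) \<longlongrightarrow> g0 p) at_top"
    proof -
      have "g0 p = exp (- fst p) * std_normal_density (snd p) * (indicator {0<..} (fst p) * of_bool (e (snd p)))"
        by (simp add: g0_def \<psi>_def mult_ac)
      then show ?thesis by (simp only:) (intro tendsto_mult kl tendsto_const)
    qed
    ultimately show "((\<lambda>u. g u p) \<longlongrightarrow> g0 p) at_top" by (rule Lim_transform_eventually[rotated])
  qed
  have f0i: "integrable ?LL f0" by (rule integrable_dominated_limit[OF f0m fnn wi fb fl])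
  have g0b: "has_bochner_integral ?LL g0 (1 * integral\<^sup>L lborel \<psi>)"
    using has_bochner_integral_lborel_product[of "\<lambda>x. exp (- 1 * x) * indicator {0<..} x" \<psi>] exponential_integral_open[of 1] \<psi>i \<psi>nn
    unfolding g0_def by (auto simp: has_bochner_integral_iff)
  show Ki: "integrable lborel (\<lambda>x. exp (- x) * limit_prob1 L x)"
  proof (rule Bochner_Integration.integrable_bound[of lborel "\<lambda>x. exp (- (1/2) * \<bar>x\<bar>) * (8 / (3 * L))"])
    show "integrable lborel (\<lambda>x. exp (- (1/2) * \<bar>x\<bar>) * (8 / (3 * L)))"
      by (intro integrable_mult_left integrable_exp_abs) simp
    show "AE x in lborel. norm (exp (- x) * limit_prob1 L x) \<le> norm (exp (- (1/2) * \<bar>x\<bar>) * (8 / (3 * L)))"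
      using occ1_level_null[OF L]
    proof eventually_elim
      fix x assume n: "Q.prob {q\<in>space Q. occ1 x q = ennreal L} = 0"
      \<comment> \<open>the limit is the same for every \<open>a < \<rho>\<close>, and \<open>\<rho> - 1\<close> is such a value\<close>
      have "\<rho> - 1 \<le> \<rho>" "\<rho> - 1 < \<rho>" by simp_all
      from exceed_prob_tendsto_one[OF L this(1) _ n, of 0 0 0] this(2)
      have l: "((\<lambda>u. exceed_prob L (\<rho> - 1) (u\<^sup>2) x (second_excess (\<rho> - 1) 0 0 u x 0)) \<longlongrightarrow> limit_prob1 L x) at_top" by simp
      have "limit_prob1 L x \<le> exp (x - \<bar>x\<bar> / 2) * (8 / (3 * L))"
      proof (rule tendsto_upperbound[OF l])
        show "\<forall>\<^sub>F u in at_top. exceed_prob L (\<rho> - 1) (u\<^sup>2) x (second_excess (\<rho> - 1) 0 0 u x 0) \<le> exp (x - \<bar>x\<bar> / 2) * (8 / (3 * L))"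
          using eventually_gt_at_top[of 0]
        proof eventually_elim
          fix u :: real assume u: "0 < u"
          show "exceed_prob L (\<rho> - 1) (u\<^sup>2) x (second_excess (\<rho> - 1) 0 0 u x 0) \<le> exp (x - \<bar>x\<bar> / 2) * (8 / (3 * L))"
            by (rule exceed_prob_bound_one[OF _ L]) (use u in simp)
        qed
      qed simp
      then have "exp (- x) * limit_prob1 L x \<le> exp (- x) * (exp (x - \<bar>x\<bar> / 2) * (8 / (3 * L)))" by (rule mult_left_mono) simp
      also have "\<dots> = exp (- (1/2) * \<bar>x\<bar>) * (8 / (3 * L))" by (simp add: exp_add[symmetric] mult.assoc[symmetric])
      finally show "norm (exp (- x) * limit_prob1 L x) \<le> norm (exp (- (1/2) * \<bar>x\<bar>) * (8 / (3 * L)))"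
        using L by (simp add: limit_prob1_def)
    qed
  qed simp
  have f0b: "has_bochner_integral ?LL f0 (K * integral\<^sup>L lborel \<psi>)"
    using has_bochner_integral_lborel_product[OF Ki _ \<psi>i \<psi>nn] unfolding f0_def K_def by (simp add: limit_prob1_def)
  obtain n where n: "\<And>x. n \<le> x \<Longrightarrow> 0 < limit_prob1 L x" using limit_prob1_pos by blast
  have "0 < integral\<^sup>L ?LL f0"
  proof (rule positive_integral_on_orthant[OF f0i, where m=n and n="(1 + c2 - \<rho> * c1) / \<kappa>"])
    show "0 \<le> f0 p" for p by (simp add: f0_def \<psi>nn limit_prob1_def)
    fix x y assume x: "n \<le> x" and y: "(1 + c2 - \<rho> * c1) / \<kappa> \<le> y"
    have "1 + c2 - \<rho> * c1 \<le> \<kappa> * y" using y \<kappa>_pos by (simp add: field_simps)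
    then have "e y" by (simp add: e_def)
    then show "0 < f0 (x, y)" using n[OF x] normal_density_pos[of 1 0 y] by (simp add: f0_def \<psi>_def)
  qed
  then have Kp: "0 < K * integral\<^sup>L lborel \<psi>" using f0b by (simp add: has_bochner_integral_iff)
  then show "0 < K" using \<psi>pos by (simp add: zero_less_mult_iff)
  show "((\<lambda>u. ruin_prob L a c1 c2 u / (K * terminal_prob a c1 c2 u)) \<longlongrightarrow> 1) at_top"
  proof (rule ratio_tendsto_one[where C=C, OF fm fnn gm gnn f0m g0m wi fb gb fl gl])
    show "\<forall>\<^sub>F u in at_top. 0 < C u" using eventually_gt_at_top[of 0] by eventually_elim (simp add: C_def)
    show "integral\<^sup>L ?LL f0 = K * integral\<^sup>L ?LL g0" using f0b g0b by (simp add: has_bochner_integral_iff)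
    show "integral\<^sup>L ?LL f0 \<noteq> 0" using f0b Kp unfolding has_bochner_integral_iff by (metis less_irrefl)
    have tw: "terminal_weight c1 u x v = C u * (k u x * std_normal_density v)" for u x v
      by (simp add: terminal_weight_def C_def k_def)
    have C0: "0 \<le> C u" if "0 < u" for u using that by (simp add: C_def)
    show "\<forall>\<^sub>F u in at_top. 0 \<le> ruin_prob L a c1 c2 u \<and> ennreal (ruin_prob L a c1 c2 u) = ennreal (C u) * (\<integral>\<^sup>+p. ennreal (f u p) \<partial>?LL)"
      using eventually_gt_at_top[of 0]
    proof eventually_elim
      fix u :: real assume u: "0 < u"
      have "ennreal (ruin_prob L a c1 c2 u) = (\<integral>\<^sup>+x. (\<integral>\<^sup>+v. ennreal (C u) * ennreal (f u (x, v)) \<partial>lborel) \<partial>lborel)"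
        unfolding ruin_prob_def Q.emeasure_eq_measure[symmetric] ruin_prob_disintegration[OF u less_imp_le[OF L]]
        using C0[OF u] k0 by (simp add: tw f_def exceed_prob_def Q.emeasure_eq_measure ennreal_mult[symmetric] less_imp_le mult.assoc)
      also have "\<dots> = (\<integral>\<^sup>+p. ennreal (C u) * ennreal (f u p) \<partial>?LL)"
        using fm[of u] by (subst lborel.nn_integral_fst[symmetric]) simp_all
      also have "\<dots> = ennreal (C u) * (\<integral>\<^sup>+p. ennreal (f u p) \<partial>?LL)"
        using fm[of u] by (intro nn_integral_cmult) simp
      finally show "0 \<le> ruin_prob L a c1 c2 u \<and> ennreal (ruin_prob L a c1 c2 u) = ennreal (C u) * (\<integral>\<^sup>+p. ennreal (f u p) \<partial>?LL)"
        by (simp add: ruin_prob_def)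
    qed
    show "\<forall>\<^sub>F u in at_top. 0 \<le> terminal_prob a c1 c2 u \<and> ennreal (terminal_prob a c1 c2 u) = ennreal (C u) * (\<integral>\<^sup>+p. ennreal (g u p) \<partial>?LL)"
      using eventually_gt_at_top[of 0]
    proof eventually_elim
      fix u :: real assume u: "0 < u"
      have "ennreal (terminal_prob a c1 c2 u) = (\<integral>\<^sup>+x. (\<integral>\<^sup>+v. ennreal (C u) * ennreal (g u (x, v)) \<partial>lborel) \<partial>lborel)"
        unfolding terminal_prob_def Q.emeasure_eq_measure[symmetric] terminal_prob_disintegration[OF u]
        using C0[OF u] k0 by (intro nn_integral_cong) (simp add: tw g_def indicator_def ennreal_mult[symmetric] less_imp_le)
      also have "\<dots> = (\<integral>\<^sup>+p. ennreal (C u) * ennreal (g u p) \<partial>?LL)"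
        using gm[of u] by (subst lborel.nn_integral_fst[symmetric]) simp_all
      also have "\<dots> = ennreal (C u) * (\<integral>\<^sup>+p. ennreal (g u p) \<partial>?LL)"
        using gm[of u] by (intro nn_integral_cmult) simp
      finally show "0 \<le> terminal_prob a c1 c2 u \<and> ennreal (terminal_prob a c1 c2 u) = ennreal (C u) * (\<integral>\<^sup>+p. ennreal (g u p) \<partial>?LL)"
        by (simp add: terminal_prob_def)
    qed
  qed
qed

end

context brownian_pair
begin

text \<open>
  The Gaussian density of the two end-point excesses \<open>(x, y)\<close>, normalised to 1 at the origin; with
  \<open>local_const\<close> it gives the density in the coordinates \<open>(x, y)\<close>.
\<close>

definition local_weight :: "real \<Rightarrow> real \<Rightarrow> real \<Rightarrow> real \<Rightarrow> real \<Rightarrow> real \<Rightarrow> real" where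
  "local_weight a c1 c2 u x y =
     exp (- x * (1 + c1 / u) - x\<^sup>2 / (2 * u\<^sup>2) - (y - \<rho> * x) * (lambda2 a \<rho> + (c2 - \<rho> * c1) / \<kappa>\<^sup>2 / u)
       - (y - \<rho> * x)\<^sup>2 / (2 * u\<^sup>2 * \<kappa>\<^sup>2))"

definition local_const :: "real \<Rightarrow> real \<Rightarrow> real \<Rightarrow> real \<Rightarrow> real" where
  "local_const a c1 c2 u = exp (- u\<^sup>2 * (1 + c1 / u)\<^sup>2 / 2) / (u * sqrt (2 * pi)) *
     (exp (- (((a - \<rho>) * u + c2 - \<rho> * c1) / \<kappa>)\<^sup>2 / 2) / sqrt (2 * pi)) / (u * \<kappa>)"

text \<open>
  When both constraints bind, \<open>v\<close> is replaced by \<open>y = second_excess a c1 c2 u x v\<close>. This is affine in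
  \<open>v\<close> with slope \<open>u \<kappa>\<close>, and the linear term of the resulting exponent is \<open>\<lambda>\<^sub>2\<close> up to \<open>O(1 / u)\<close>.
\<close>

lemma terminal_weight_localise:
  assumes u: "0 < u" and G[measurable]: "G \<in> borel_measurable borel"
  shows "(\<integral>\<^sup>+v. ennreal (terminal_weight c1 u x v) * G (second_excess a c1 c2 u x v) \<partial>lborel) =
    (\<integral>\<^sup>+y. ennreal (local_const a c1 c2 u) * (ennreal (local_weight a c1 c2 u x y) * G y) \<partial>lborel)"
proof -
  \<comment> \<open>\<open>v = t + c y\<close> solves \<open>second_excess a c1 c2 u x v = y\<close>\<close>
  define A where "A = ((a - \<rho>) * u + c2 - \<rho> * c1) / \<kappa>"
  define c where "c = 1 / (u * \<kappa>)"
  define t where "t = A - \<rho> * x * c"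
  have c: "0 < c" using u \<kappa>_pos by (simp add: c_def)
  have uk: "u * \<kappa> * c = 1" using u \<kappa>_pos by (simp add: c_def)
  have [measurable]: "(\<lambda>v. second_excess a c1 c2 u x v) \<in> borel_measurable borel" unfolding second_excess_def by measurable
  have [measurable]: "(\<lambda>v. terminal_weight c1 u x v) \<in> borel_measurable borel" unfolding terminal_weight_def by measurable
  have se: "second_excess a c1 c2 u x (t + c * y) = y" for y
  proof -
    have "u * (\<kappa> * (t + c * y)) = u * (\<kappa> * A) + (y - \<rho> * x) * (u * \<kappa> * c)" by (simp add: t_def algebra_simps)
    moreover have "\<kappa> * A = (a - \<rho>) * u + c2 - \<rho> * c1" using \<kappa>_pos by (simp add: A_def)
    ultimately show ?thesis unfolding second_excess_def uk
      by (simp add: distrib_left) (simp add: algebra_simps power2_eq_square)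
  qed
  have tw: "c * terminal_weight c1 u x (t + c * y) = local_const a c1 c2 u * local_weight a c1 c2 u x y" for y
  proof -
    have Ac: "A * c = lambda2 a \<rho> + (c2 - \<rho> * c1) / \<kappa>\<^sup>2 / u"
    proof -
      have "A * c = ((a - \<rho>) * u + c2 - \<rho> * c1) / (\<kappa>\<^sup>2 * u)" by (simp add: A_def c_def power2_eq_square)
      also have "\<dots> = (a - \<rho>) / \<kappa>\<^sup>2 + (c2 - \<rho> * c1) / \<kappa>\<^sup>2 / u" using u \<kappa>_pos by (simp add: field_simps)
      finally show ?thesis by (simp add: lambda2_def \<kappa>_sq)
    qed
    have c2': "c\<^sup>2 / 2 = 1 / (2 * u\<^sup>2 * \<kappa>\<^sup>2)" by (simp add: c_def power_divide power_mult_distrib)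
    have "- (t + c * y)\<^sup>2 / 2 = - A\<^sup>2 / 2 + (- (y - \<rho> * x) * (A * c) - (y - \<rho> * x)\<^sup>2 * (c\<^sup>2 / 2))"
      by (simp add: t_def power2_eq_square field_simps)
    then have "exp (- (t + c * y)\<^sup>2 / 2) = exp (- A\<^sup>2 / 2) *
        exp (- (y - \<rho> * x) * (lambda2 a \<rho> + (c2 - \<rho> * c1) / \<kappa>\<^sup>2 / u) - (y - \<rho> * x)\<^sup>2 / (2 * u\<^sup>2 * \<kappa>\<^sup>2))"
      unfolding Ac c2' by (simp only: exp_add times_divide_eq_right mult_1_right)
    then have e: "std_normal_density (t + c * y) = (exp (- A\<^sup>2 / 2) / sqrt (2 * pi)) *
        exp (- (y - \<rho> * x) * (lambda2 a \<rho> + (c2 - \<rho> * c1) / \<kappa>\<^sup>2 / u) - (y - \<rho> * x)\<^sup>2 / (2 * u\<^sup>2 * \<kappa>\<^sup>2))"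
      unfolding std_normal_density_def by simp
    have lw: "local_weight a c1 c2 u x y = exp (- x * (1 + c1 / u) - x\<^sup>2 / (2 * u\<^sup>2)) *
        exp (- (y - \<rho> * x) * (lambda2 a \<rho> + (c2 - \<rho> * c1) / \<kappa>\<^sup>2 / u) - (y - \<rho> * x)\<^sup>2 / (2 * u\<^sup>2 * \<kappa>\<^sup>2))"
    proof -
      have "p - q - m * b - r = (p - q) + (- m * b - r)" for p q m b r :: real by simp
      then show ?thesis unfolding local_weight_def exp_add[symmetric] by (rule arg_cong)
    qed
    show ?thesis unfolding terminal_weight_def e lw local_const_def A_def[symmetric] by (simp add: c_def mult_ac)
  qed
  have "(\<integral>\<^sup>+v. ennreal (terminal_weight c1 u x v) * G (second_excess a c1 c2 u x v) \<partial>lborel) =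
    ennreal c * (\<integral>\<^sup>+y. ennreal (terminal_weight c1 u x (t + c * y)) * G (second_excess a c1 c2 u x (t + c * y)) \<partial>lborel)"
    using c by (subst nn_integral_real_affine[where c=c and t=t]) simp_all
  also have "\<dots> = (\<integral>\<^sup>+y. ennreal (c * terminal_weight c1 u x (t + c * y)) * G y \<partial>lborel)"
    unfolding se using c by (subst nn_integral_cmult[symmetric]) (simp_all add: ennreal_mult' mult.assoc)
  also have "\<dots> = (\<integral>\<^sup>+y. ennreal (local_const a c1 c2 u) * (ennreal (local_weight a c1 c2 u x y) * G y) \<partial>lborel)"
  proof -
    have "0 \<le> local_const a c1 c2 u" "0 \<le> local_weight a c1 c2 u x y" for y
      using u \<kappa>_pos by (simp_all add: local_const_def local_weight_def)
    then show ?thesis unfolding tw by (simp add: ennreal_mult mult.assoc)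
  qed
  finally show ?thesis .
qed

text \<open>
  \<open>(\<lambda>\<^sub>1, \<lambda>\<^sub>2)\<close> is the inverse covariance matrix applied to \<open>(1, a)\<close>.
\<close>

lemma lambda_relations:
  "lambda1 a \<rho> + \<rho> * lambda2 a \<rho> = 1" "\<rho> * lambda1 a \<rho> + lambda2 a \<rho> = a"
proof -
  have n: "1 - \<rho>\<^sup>2 \<noteq> 0" using rho_sq by simp
  have "(1 - a * \<rho>) + \<rho> * (a - \<rho>) = 1 - \<rho>\<^sup>2" by (simp add: algebra_simps power2_eq_square)
  then have "((1 - a * \<rho>) + \<rho> * (a - \<rho>)) / (1 - \<rho>\<^sup>2) = 1" using n by simp
  then show "lambda1 a \<rho> + \<rho> * lambda2 a \<rho> = 1" by (simp add: lambda1_def lambda2_def add_divide_distrib)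
  have "\<rho> * (1 - a * \<rho>) + (a - \<rho>) = a * (1 - \<rho>\<^sup>2)" by (simp add: algebra_simps power2_eq_square)
  then have "(\<rho> * (1 - a * \<rho>) + (a - \<rho>)) / (1 - \<rho>\<^sup>2) = a" using n by simp
  then show "\<rho> * lambda1 a \<rho> + lambda2 a \<rho> = a" by (simp add: lambda1_def lambda2_def add_divide_distrib)
qed

lemma lambda_pos:
  assumes "\<rho> < a" "a \<le> 1" shows "0 < lambda1 a \<rho>" "0 < lambda2 a \<rho>"
proof -
  have n: "0 < 1 - \<rho>\<^sup>2" using rho_sq by simp
  have "a * \<rho> < 1"
  proof (cases "0 \<le> \<rho>")
    case True
    then have "a * \<rho> \<le> 1 * \<rho>" using assms by (intro mult_right_mono) auto
    then show ?thesis using rho by simp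
  next
    case False
    then have "a * \<rho> < \<rho> * \<rho>" using assms by (intro mult_strict_right_mono_neg) auto
    then show ?thesis using rho_sq by (simp add: power2_eq_square)
  qed
  then show "0 < lambda1 a \<rho>" "0 < lambda2 a \<rho>" using assms n by (simp_all add: lambda1_def lambda2_def)
qed

text \<open>
  At \<open>\<lambda>\<close> the quadratic form equals the linear one, so the gap is half of
  \<open>\<lambda>\<^sub>1 + a \<lambda>\<^sub>2 = ((1 - \<rho>\<^sup>2) + (a - \<rho>)\<^sup>2) / (1 - \<rho>\<^sup>2)\<close>.
\<close>

lemma drift_gap_lambda: "0 < drift_gap a (lambda1 a \<rho>) (lambda2 a \<rho>)"
proof -
  let ?l1 = "lambda1 a \<rho>" and ?l2 = "lambda2 a \<rho>"
  have n: "0 < 1 - \<rho>\<^sup>2" using rho_sq by simp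
  have "?l1\<^sup>2 + 2 * \<rho> * ?l1 * ?l2 + ?l2\<^sup>2 = ?l1 * (?l1 + \<rho> * ?l2) + ?l2 * (\<rho> * ?l1 + ?l2)"
    by (simp add: power2_eq_square algebra_simps)
  also have "\<dots> = ?l1 + a * ?l2" unfolding lambda_relations by simp
  finally have "drift_gap a ?l1 ?l2 = (?l1 + a * ?l2) - (?l1 + a * ?l2) / 2" by (simp only: drift_gap_def)
  also have "z - z / 2 = z / 2" for z :: real by simp
  finally have "drift_gap a ?l1 ?l2 = (?l1 + a * ?l2) / 2" .
  also have "?l1 + a * ?l2 = ((1 - \<rho>\<^sup>2) + (a - \<rho>)\<^sup>2) / (1 - \<rho>\<^sup>2)"
    by (simp add: lambda1_def lambda2_def add_divide_distrib[symmetric] power2_eq_square algebra_simps)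
  finally show ?thesis using n by (simp add: add_pos_nonneg)
qed

lemma drift_gap_stable:
  assumes "0 < l1" "0 < l2" "0 < drift_gap a l1 l2"
  obtains \<epsilon> \<delta> where "0 < \<epsilon>" "0 < \<delta>" "\<epsilon> \<le> l1" "\<epsilon> \<le> l2"
    "\<And>s1 s2. s1 \<in> {1, -1} \<Longrightarrow> s2 \<in> {1, -1} \<Longrightarrow> \<delta> \<le> drift_gap a (l1 + s1 * \<epsilon>) (l2 + s2 * \<epsilon>)"
proof -
  define \<delta> where "\<delta> = drift_gap a l1 l2 / 2"
  have d: "0 < \<delta>" "\<delta> < drift_gap a l1 l2" using assms by (simp_all add: \<delta>_def)
  have lim: "((\<lambda>e. drift_gap a (l1 + s1 * e) (l2 + s2 * e)) \<longlongrightarrow> drift_gap a l1 l2) (at_right 0)" for s1 s2 :: real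
    unfolding drift_gap_def by (auto intro!: tendsto_eq_intros)
  have "\<forall>\<^sub>F e in at_right 0. 0 < e \<and> e \<le> l1 \<and> e \<le> l2 \<and>
      \<delta> < drift_gap a (l1 + 1 * e) (l2 + 1 * e) \<and> \<delta> < drift_gap a (l1 + 1 * e) (l2 + -1 * e) \<and>
      \<delta> < drift_gap a (l1 + -1 * e) (l2 + 1 * e) \<and> \<delta> < drift_gap a (l1 + -1 * e) (l2 + -1 * e)"
    using order_tendstoD(1)[OF lim[of 1 1] d(2)] order_tendstoD(1)[OF lim[of 1 "-1"] d(2)]
      order_tendstoD(1)[OF lim[of "-1" 1] d(2)] order_tendstoD(1)[OF lim[of "-1" "-1"] d(2)]
      eventually_at_right_real[OF assms(1)] eventually_at_right_real[OF assms(2)]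
    by eventually_elim auto
  then obtain e where e: "0 < e \<and> e \<le> l1 \<and> e \<le> l2 \<and>
      \<delta> < drift_gap a (l1 + 1 * e) (l2 + 1 * e) \<and> \<delta> < drift_gap a (l1 + 1 * e) (l2 + -1 * e) \<and>
      \<delta> < drift_gap a (l1 + -1 * e) (l2 + 1 * e) \<and> \<delta> < drift_gap a (l1 + -1 * e) (l2 + -1 * e)"
    by (metis (no_types, lifting) eventually_happens trivial_limit_at_right_real)
  show ?thesis
    by (rule that[of e \<delta>]) (use e d in auto)
qed

text \<open>
  The integrand is dominated by a multiple of \<open>exp (- \<epsilon> (\<bar>x\<bar> + \<bar>y\<bar>) / 2)\<close>: the bound for the exceedance
  probability supplies \<open>exp (\<lambda>\<^sub>1 x + \<lambda>\<^sub>2 y - \<epsilon> (\<bar>x\<bar> + \<bar>y\<bar>))\<close>, and half of the gain pays for the \<open>O(1 / u)\<close>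
  error in the linear part of the density. The terminal weight \<open>exp (- \<lambda>\<^sub>1 x - \<lambda>\<^sub>2 y)\<close> integrates to
  \<open>1 / (\<lambda>\<^sub>1 \<lambda>\<^sub>2)\<close> over the positive quadrant.
\<close>

lemma parisian_two_coordinates:
  assumes L: "0 < L" and a: "\<rho> < a" "a \<le> 1"
  defines "J \<equiv> LINT p|(lborel \<Otimes>\<^sub>M lborel). exp (- lambda1 a \<rho> * fst p - lambda2 a \<rho> * snd p) * limit_prob2 L a (fst p) (snd p)"
  shows "integrable (lborel \<Otimes>\<^sub>M lborel) (\<lambda>p. exp (- lambda1 a \<rho> * fst p - lambda2 a \<rho> * snd p) * limit_prob2 L a (fst p) (snd p))"
    "0 < J"
    "((\<lambda>u. ruin_prob L a c1 c2 u / (lambda1 a \<rho> * lambda2 a \<rho> * J * terminal_prob a c1 c2 u)) \<longlongrightarrow> 1) at_top"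
proof -
  let ?LL = "lborel \<Otimes>\<^sub>M lborel :: (real \<times> real) measure"
  define l1 l2 where "l1 = lambda1 a \<rho>" and "l2 = lambda2 a \<rho>"
  have l: "0 < l1" "0 < l2" using lambda_pos[OF a] by (simp_all add: l1_def l2_def)
  obtain \<epsilon> \<delta> where \<epsilon>: "0 < \<epsilon>" "\<epsilon> \<le> l1" "\<epsilon> \<le> l2" and \<delta>: "0 < \<delta>"
    and gap: "\<And>s1 s2. s1 \<in> {1, -1} \<Longrightarrow> s2 \<in> {1, -1} \<Longrightarrow> \<delta> \<le> drift_gap a (l1 + s1 * \<epsilon>) (l2 + s2 * \<epsilon>)"
    using drift_gap_stable[OF l] drift_gap_lambda unfolding l1_def l2_def by metis
  define d where "d = (c2 - \<rho> * c1) / \<kappa>\<^sup>2"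
  define k where "k u p = local_weight a c1 c2 u (fst p) (snd p)" for u p
  define f where "f u p = k u p * exceed_prob L a (u\<^sup>2) (fst p) (snd p)" for u p
  define g where "g u p = k u p * (indicator {0<..} (fst p) * indicator {0<..} (snd p))" for u p
  define f0 where "f0 p = exp (- l1 * fst p - l2 * snd p) * limit_prob2 L a (fst p) (snd p)" for p
  define g0 where "g0 p = (exp (- l1 * fst p) * indicator {0<..} (fst p)) * (exp (- l2 * snd p) * indicator {0<..} (snd p))" for p
  define m where "m p = \<bar>fst p\<bar> + \<bar>snd p\<bar>" for p :: "real \<times> real"
  define w where "w p = (exp (- (\<epsilon> / 2) * \<bar>fst p\<bar>) * (1 + 1 / (L * \<delta>))) * exp (- (\<epsilon> / 2) * \<bar>snd p\<bar>)" for p :: "real \<times> real"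
  have w_alt: "w p = exp (- (\<epsilon> / 2) * m p) * (1 + 1 / (L * \<delta>))" for p
    by (simp add: w_def m_def exp_add[symmetric] algebra_simps)
  have k0: "0 < k u p" for u p by (simp add: k_def local_weight_def)
  have fm: "f u \<in> borel_measurable ?LL" for u unfolding f_def k_def local_weight_def by measurable
  have gm: "g u \<in> borel_measurable ?LL" for u unfolding g_def k_def local_weight_def by measurable
  have f0m: "f0 \<in> borel_measurable ?LL" unfolding f0_def by measurable
  have g0m: "g0 \<in> borel_measurable ?LL" unfolding g0_def by measurable
  have fnn: "0 \<le> f u p" for u p using k0[of u p] by (simp add: f_def exceed_prob_def)
  have gnn: "0 \<le> g u p" for u p using k0[of u p] by (simp add: g_def)
  have wi: "integrable ?LL w"
    using has_bochner_integral_lborel_product[of "\<lambda>x. exp (- (\<epsilon> / 2) * \<bar>x\<bar>) * (1 + 1 / (L * \<delta>))" "\<lambda>x. exp (- (\<epsilon> / 2) * \<bar>x\<bar>)"]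
      integrable_exp_abs[of "\<epsilon> / 2"] L \<epsilon> \<delta> unfolding w_def by (auto simp: has_bochner_integral_iff)
  have ex: "exceed_prob L a (u\<^sup>2) x y \<le> exp (l1 * x + l2 * y - \<epsilon> * m (x, y)) * (1 / (L * \<delta>))" if "0 < u" for u x y
  proof -
    \<comment> \<open>the smallest of the four admissible exponents\<close>
    define s1 s2 :: real where "s1 = (if x \<le> 0 then 1 else -1)" and "s2 = (if y \<le> 0 then 1 else -1)"
    have s: "s1 \<in> {1, -1}" "s2 \<in> {1, -1}" by (simp_all add: s1_def s2_def)
    have "exceed_prob L a (u\<^sup>2) x y \<le> exp ((l1 + s1 * \<epsilon>) * x + (l2 + s2 * \<epsilon>) * y) / (L * \<delta>)"
      by (rule exceed_prob_bound[OF _ L _ _ \<delta> gap[OF s]]) (use that s \<epsilon> l in auto)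
    also have "(l1 + s1 * \<epsilon>) * x + (l2 + s2 * \<epsilon>) * y = l1 * x + l2 * y - \<epsilon> * m (x, y)"
      by (simp add: m_def s1_def s2_def algebra_simps)
    finally show ?thesis by simp
  qed
  define K where "K = \<bar>c1\<bar> + \<bar>d\<bar> * (1 + \<bar>\<rho>\<bar>)"
  have kb: "k u p \<le> exp (- l1 * fst p - l2 * snd p + (\<epsilon> / 2) * m p)" if u: "0 < u" "2 * K / \<epsilon> \<le> u" for u p
  proof -
    let ?x = "fst p" and ?y = "snd p"
    have "- ?x * (c1 / u) - (?y - \<rho> * ?x) * (d / u) = (- ?x * c1 - (?y - \<rho> * ?x) * d) / u" by (simp add: diff_divide_distrib)
    also have "\<dots> \<le> (K * m p) / u"
    proof (rule divide_right_mono)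
      have "- ?x * c1 \<le> \<bar>?x\<bar> * \<bar>c1\<bar>" using abs_ge_self[of "- ?x * c1"] by (simp add: abs_mult)
      moreover have "- ((?y - \<rho> * ?x) * d) \<le> (\<bar>?y\<bar> + \<bar>\<rho>\<bar> * \<bar>?x\<bar>) * \<bar>d\<bar>"
      proof -
        have "- ((?y - \<rho> * ?x) * d) \<le> \<bar>?y - \<rho> * ?x\<bar> * \<bar>d\<bar>" using abs_ge_self[of "- ((?y - \<rho> * ?x) * d)"] by (simp add: abs_mult)
        also have "\<dots> \<le> (\<bar>?y\<bar> + \<bar>\<rho>\<bar> * \<bar>?x\<bar>) * \<bar>d\<bar>"
          using abs_triangle_ineq4[of ?y "\<rho> * ?x"] by (intro mult_right_mono) (auto simp: abs_mult)
        finally show ?thesis .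
      qed
      moreover have "\<bar>?x\<bar> * \<bar>c1\<bar> + (\<bar>?y\<bar> + \<bar>\<rho>\<bar> * \<bar>?x\<bar>) * \<bar>d\<bar> \<le> K * m p"
      proof -
        have "K * m p - (\<bar>?x\<bar> * \<bar>c1\<bar> + (\<bar>?y\<bar> + \<bar>\<rho>\<bar> * \<bar>?x\<bar>) * \<bar>d\<bar>) = \<bar>c1\<bar> * \<bar>?y\<bar> + \<bar>d\<bar> * \<bar>?x\<bar> + \<bar>d\<bar> * (\<bar>\<rho>\<bar> * \<bar>?y\<bar>)"
          by (simp add: K_def m_def algebra_simps)
        moreover have "0 \<le> \<bar>c1\<bar> * \<bar>?y\<bar> + \<bar>d\<bar> * \<bar>?x\<bar> + \<bar>d\<bar> * (\<bar>\<rho>\<bar> * \<bar>?y\<bar>)" by (intro add_nonneg_nonneg mult_nonneg_nonneg) auto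
        ultimately show ?thesis by linarith
      qed
      ultimately show "- ?x * c1 - (?y - \<rho> * ?x) * d \<le> K * m p" by linarith
    qed (use u in simp)
    also have "\<dots> \<le> (\<epsilon> / 2) * m p"
    proof -
      have "K / u \<le> \<epsilon> / 2" using u \<epsilon> by (simp add: field_simps)
      then have "K / u * m p \<le> (\<epsilon> / 2) * m p" by (rule mult_right_mono) (simp add: m_def)
      then show ?thesis by simp
    qed
    finally have *: "- ?x * (c1 / u) - (?y - \<rho> * ?x) * (d / u) \<le> (\<epsilon> / 2) * m p" .
    have q: "0 \<le> ?x\<^sup>2 / (2 * u\<^sup>2)" "0 \<le> (?y - \<rho> * ?x)\<^sup>2 / (2 * u\<^sup>2 * \<kappa>\<^sup>2)" by simp_all
    have "- ?x * (1 + c1 / u) - (?y - \<rho> * ?x) * (l2 + d / u) = - (1 - \<rho> * l2) * ?x - l2 * ?y + (- ?x * (c1 / u) - (?y - \<rho> * ?x) * (d / u))"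
      by (simp add: algebra_simps)
    also have "1 - \<rho> * l2 = l1" using lambda_relations(1)[of a] by (simp add: l1_def l2_def)
    finally have "- ?x * (1 + c1 / u) - ?x\<^sup>2 / (2 * u\<^sup>2) - (?y - \<rho> * ?x) * (l2 + d / u) - (?y - \<rho> * ?x)\<^sup>2 / (2 * u\<^sup>2 * \<kappa>\<^sup>2) \<le>
       - l1 * ?x - l2 * ?y + (\<epsilon> / 2) * m p" using * q by linarith
    then show ?thesis by (simp add: k_def local_weight_def l2_def d_def)
  qed
  have evu: "\<forall>\<^sub>F u in at_top. 0 < u \<and> 2 * K / \<epsilon> \<le> (u::real)"
    by (intro eventually_conj eventually_gt_at_top eventually_ge_at_top)
  have cut: "k u p * z \<le> w p"
    if u: "0 < u" "2 * K / \<epsilon> \<le> u" and z: "0 \<le> z" "z \<le> exp (l1 * fst p + l2 * snd p - \<epsilon> * m p) * z'" "z' \<le> 1 + 1 / (L * \<delta>)" for u p z z'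
  proof -
    have "k u p * z \<le> exp (- l1 * fst p - l2 * snd p + (\<epsilon> / 2) * m p) * (exp (l1 * fst p + l2 * snd p - \<epsilon> * m p) * z')"
      using z by (intro mult_mono kb u) auto
    also have "\<dots> = exp (- (\<epsilon> / 2) * m p) * z'"
      by (simp add: exp_add[symmetric] mult.assoc[symmetric] algebra_simps)
    also have "\<dots> \<le> w p" unfolding w_alt using z by (intro mult_left_mono) auto
    finally show ?thesis .
  qed
  have fb: "\<forall>\<^sub>F u in at_top. \<forall>p. f u p \<le> w p"
    using evu
  proof (eventually_elim, intro allI)
    fix u :: real and p :: "real \<times> real" assume u: "0 < u \<and> 2 * K / \<epsilon> \<le> u"
    show "f u p \<le> w p" unfolding f_def
      by (rule cut[of u _ _ "1 / (L * \<delta>)"]) (use u ex[of u "fst p" "snd p"] in \<open>auto simp: exceed_prob_def\<close>)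
  qed
  have gb: "\<forall>\<^sub>F u in at_top. \<forall>p. g u p \<le> w p"
    using evu
  proof (eventually_elim, intro allI)
    fix u :: real and p :: "real \<times> real" assume u: "0 < u \<and> 2 * K / \<epsilon> \<le> u"
    show "g u p \<le> w p" unfolding g_def
    proof (rule cut[of u _ _ 1])
      show "(indicator {0<..} (fst p) * indicator {0<..} (snd p) :: real) \<le> exp (l1 * fst p + l2 * snd p - \<epsilon> * m p) * 1"
      proof (cases "0 < fst p \<and> 0 < snd p")
        case True
        then have "0 \<le> (l1 - \<epsilon>) * fst p + (l2 - \<epsilon>) * snd p" using \<epsilon> by (intro add_nonneg_nonneg mult_nonneg_nonneg) auto
        then have "0 \<le> l1 * fst p + l2 * snd p - \<epsilon> * m p" using True by (simp add: m_def algebra_simps)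
        then show ?thesis using True by simp
      qed (auto simp: indicator_def)
    qed (use u L \<delta> in auto)
  qed
  have kl: "((\<lambda>u. k u p) \<longlongrightarrow> exp (- l1 * fst p - l2 * snd p)) at_top" for p
  proof -
    define X Y where "X = fst p" and "Y = snd p - \<rho> * fst p"
    have kap: "\<kappa> > 0" by (rule \<kappa>_pos)
    have "((\<lambda>u. exp (- X * (1 + c1 / u) - X\<^sup>2 / (2 * u\<^sup>2) - Y * (l2 + d / u) - Y\<^sup>2 / (2 * u\<^sup>2 * \<kappa>\<^sup>2))) \<longlongrightarrow> exp (- X - Y * l2)) at_top"
    proof (rule tendsto_exp)
      have "((\<lambda>u. - X * (1 + c1 / u) - X\<^sup>2 / (2 * u\<^sup>2) - Y * (l2 + d / u) - Y\<^sup>2 / (2 * u\<^sup>2 * \<kappa>\<^sup>2)) \<longlongrightarrow> - X * (1 + 0) - 0 - Y * (l2 + 0) - 0) at_top"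
      proof (intro tendsto_diff tendsto_mult tendsto_add tendsto_const)
        show "((\<lambda>u. c1 / u) \<longlongrightarrow> 0) at_top" "((\<lambda>u. d / u) \<longlongrightarrow> 0) at_top" "((\<lambda>u. X\<^sup>2 / (2 * u\<^sup>2)) \<longlongrightarrow> 0) at_top" by real_asymp+
        show "((\<lambda>u. Y\<^sup>2 / (2 * u\<^sup>2 * \<kappa>\<^sup>2)) \<longlongrightarrow> 0) at_top" using kap by real_asymp
      qed
      then show "((\<lambda>u. - X * (1 + c1 / u) - X\<^sup>2 / (2 * u\<^sup>2) - Y * (l2 + d / u) - Y\<^sup>2 / (2 * u\<^sup>2 * \<kappa>\<^sup>2)) \<longlongrightarrow> - X - Y * l2) at_top" by simp
    qed
    moreover have "- X - Y * l2 = - l1 * fst p - l2 * snd p"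
    proof -
      have "1 - \<rho> * l2 = l1" using lambda_relations(1)[of a] by (simp add: l1_def l2_def)
      then show ?thesis by (simp add: X_def Y_def algebra_simps flip: \<open>1 - \<rho> * l2 = l1\<close>)
    qed
    ultimately show ?thesis by (simp add: k_def local_weight_def X_def Y_def l2_def d_def)
  qed
  have fl: "AE p in ?LL. ((\<lambda>u. f u p) \<longlongrightarrow> f0 p) at_top"
    using occ2_level_null[OF L, of a]
  proof eventually_elim
    fix p :: "real \<times> real" assume n: "Q.prob {q\<in>space Q. occ2 a (fst p) (snd p) q = ennreal L} = 0"
    show "((\<lambda>u. f u p) \<longlongrightarrow> f0 p) at_top"
      unfolding f_def f0_def
      by (intro tendsto_mult kl exceed_prob_tendsto_two[OF L less_imp_le[OF l(1)] less_imp_le[OF l(2)] _ n])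
         (use drift_gap_lambda in \<open>simp add: l1_def l2_def\<close>)
  qed
  have gl: "AE p in ?LL. ((\<lambda>u. g u p) \<longlongrightarrow> g0 p) at_top"
  proof (rule AE_I2)
    fix p :: "real \<times> real"
    have "((\<lambda>u. g u p) \<longlongrightarrow> exp (- l1 * fst p - l2 * snd p) * (indicator {0<..} (fst p) * indicator {0<..} (snd p))) at_top"
      unfolding g_def by (intro tendsto_mult kl tendsto_const)
    then show "((\<lambda>u. g u p) \<longlongrightarrow> g0 p) at_top" by (simp add: g0_def exp_diff exp_minus field_simps)
  qed
  have f0i: "integrable ?LL f0" by (rule integrable_dominated_limit[OF f0m fnn wi fb fl])
  then show "integrable ?LL (\<lambda>p. exp (- lambda1 a \<rho> * fst p - lambda2 a \<rho> * snd p) * limit_prob2 L a (fst p) (snd p))"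
    by (simp add: f0_def[abs_def] l1_def l2_def)
  have J: "J = integral\<^sup>L ?LL f0" by (simp add: J_def f0_def[abs_def] l1_def l2_def)
  have g0b: "has_bochner_integral ?LL g0 (1 / l1 * (1 / l2))"
    using has_bochner_integral_lborel_product[of "\<lambda>x. exp (- l1 * x) * indicator {0<..} x" "\<lambda>x. exp (- l2 * x) * indicator {0<..} x"]
      exponential_integral_open[OF l(1)] exponential_integral_open[OF l(2)]
    unfolding g0_def by (auto simp: has_bochner_integral_iff)
  obtain n where n: "\<And>x y. n \<le> x \<Longrightarrow> n \<le> y \<Longrightarrow> 0 < limit_prob2 L a x y" using limit_prob2_pos by blast
  show Jp: "0 < J" unfolding J
  proof (rule positive_integral_on_orthant[OF f0i, where m=n and n=n])
    show "0 \<le> f0 p" for p by (simp add: f0_def limit_prob2_def)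
    show "0 < f0 (x, y)" if "n \<le> x" "n \<le> y" for x y using n[OF that] by (simp add: f0_def)
  qed
  have "((\<lambda>u. ruin_prob L a c1 c2 u / (l1 * l2 * J * terminal_prob a c1 c2 u)) \<longlongrightarrow> 1) at_top"
  proof (rule ratio_tendsto_one[where C="local_const a c1 c2", OF fm fnn gm gnn f0m g0m wi fb gb fl gl])
    have C: "0 < local_const a c1 c2 u" if "0 < u" for u using that \<kappa>_pos by (simp add: local_const_def)
    show "\<forall>\<^sub>F u in at_top. 0 < local_const a c1 c2 u" using eventually_gt_at_top[of 0] by eventually_elim (rule C)
    show "integral\<^sup>L ?LL f0 = l1 * l2 * J * integral\<^sup>L ?LL g0" using g0b l by (simp add: has_bochner_integral_iff J)
    show "integral\<^sup>L ?LL f0 \<noteq> 0" using Jp J by simp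
    show "\<forall>\<^sub>F u in at_top. 0 \<le> ruin_prob L a c1 c2 u \<and> ennreal (ruin_prob L a c1 c2 u) = ennreal (local_const a c1 c2 u) * (\<integral>\<^sup>+p. ennreal (f u p) \<partial>?LL)"
      using eventually_gt_at_top[of 0]
    proof eventually_elim
      fix u :: real assume u: "0 < u"
      have "ennreal (ruin_prob L a c1 c2 u) = (\<integral>\<^sup>+x. (\<integral>\<^sup>+v. ennreal (terminal_weight c1 u x v) * ennreal (exceed_prob L a (u\<^sup>2) x (second_excess a c1 c2 u x v)) \<partial>lborel) \<partial>lborel)"
        unfolding ruin_prob_def Q.emeasure_eq_measure[symmetric] ruin_prob_disintegration[OF u less_imp_le[OF L]]
        by (simp add: exceed_prob_def Q.emeasure_eq_measure)
      also have "\<dots> = (\<integral>\<^sup>+x. (\<integral>\<^sup>+y. ennreal (local_const a c1 c2 u) * ennreal (f u (x, y)) \<partial>lborel) \<partial>lborel)"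
      proof (rule nn_integral_cong)
        fix x :: real
        have "(\<integral>\<^sup>+v. ennreal (terminal_weight c1 u x v) * ennreal (exceed_prob L a (u\<^sup>2) x (second_excess a c1 c2 u x v)) \<partial>lborel) =
          (\<integral>\<^sup>+y. ennreal (local_const a c1 c2 u) * (ennreal (local_weight a c1 c2 u x y) * ennreal (exceed_prob L a (u\<^sup>2) x y)) \<partial>lborel)"
          by (rule terminal_weight_localise[OF u]) measurable
        also have "\<dots> = (\<integral>\<^sup>+y. ennreal (local_const a c1 c2 u) * ennreal (f u (x, y)) \<partial>lborel)"
          by (intro nn_integral_cong) (simp add: f_def k_def ennreal_mult exceed_prob_def local_weight_def)
        finally show "(\<integral>\<^sup>+v. ennreal (terminal_weight c1 u x v) * ennreal (exceed_prob L a (u\<^sup>2) x (second_excess a c1 c2 u x v)) \<partial>lborel) =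
          (\<integral>\<^sup>+y. ennreal (local_const a c1 c2 u) * ennreal (f u (x, y)) \<partial>lborel)" .
      qed
      also have "\<dots> = (\<integral>\<^sup>+p. ennreal (local_const a c1 c2 u) * ennreal (f u p) \<partial>?LL)"
        using fm[of u] by (subst lborel.nn_integral_fst[symmetric]) simp_all
      also have "\<dots> = ennreal (local_const a c1 c2 u) * (\<integral>\<^sup>+p. ennreal (f u p) \<partial>?LL)"
        using fm[of u] by (intro nn_integral_cmult) simp
      finally show "0 \<le> ruin_prob L a c1 c2 u \<and> ennreal (ruin_prob L a c1 c2 u) = ennreal (local_const a c1 c2 u) * (\<integral>\<^sup>+p. ennreal (f u p) \<partial>?LL)"
        by (simp add: ruin_prob_def)
    qed
    show "\<forall>\<^sub>F u in at_top. 0 \<le> terminal_prob a c1 c2 u \<and> ennreal (terminal_prob a c1 c2 u) = ennreal (local_const a c1 c2 u) * (\<integral>\<^sup>+p. ennreal (g u p) \<partial>?LL)"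
      using eventually_gt_at_top[of 0]
    proof eventually_elim
      fix u :: real assume u: "0 < u"
      have "ennreal (terminal_prob a c1 c2 u) = (\<integral>\<^sup>+x. (\<integral>\<^sup>+v. ennreal (terminal_weight c1 u x v) * (indicator {0<..} x * indicator {0<..} (second_excess a c1 c2 u x v)) \<partial>lborel) \<partial>lborel)"
        unfolding terminal_prob_def Q.emeasure_eq_measure[symmetric] terminal_prob_disintegration[OF u]
        by (simp add: mult.assoc)
      also have "\<dots> = (\<integral>\<^sup>+x. (\<integral>\<^sup>+y. ennreal (local_const a c1 c2 u) * ennreal (g u (x, y)) \<partial>lborel) \<partial>lborel)"
      proof (rule nn_integral_cong)
        fix x :: real
        have "(\<integral>\<^sup>+v. ennreal (terminal_weight c1 u x v) * (indicator {0<..} x * indicator {0<..} (second_excess a c1 c2 u x v)) \<partial>lborel) =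
          (\<integral>\<^sup>+y. ennreal (local_const a c1 c2 u) * (ennreal (local_weight a c1 c2 u x y) * (indicator {0<..} x * indicator {0<..} y)) \<partial>lborel)"
          by (rule terminal_weight_localise[OF u]) measurable
        also have "\<dots> = (\<integral>\<^sup>+y. ennreal (local_const a c1 c2 u) * ennreal (g u (x, y)) \<partial>lborel)"
          by (intro nn_integral_cong) (simp add: g_def k_def indicator_def)
        finally show "(\<integral>\<^sup>+v. ennreal (terminal_weight c1 u x v) * (indicator {0<..} x * indicator {0<..} (second_excess a c1 c2 u x v)) \<partial>lborel) =
          (\<integral>\<^sup>+y. ennreal (local_const a c1 c2 u) * ennreal (g u (x, y)) \<partial>lborel)" .
      qed
      also have "\<dots> = (\<integral>\<^sup>+p. ennreal (local_const a c1 c2 u) * ennreal (g u p) \<partial>?LL)"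
        using gm[of u] by (subst lborel.nn_integral_fst[symmetric]) simp_all
      also have "\<dots> = ennreal (local_const a c1 c2 u) * (\<integral>\<^sup>+p. ennreal (g u p) \<partial>?LL)"
        using gm[of u] by (intro nn_integral_cmult) simp
      finally show "0 \<le> terminal_prob a c1 c2 u \<and> ennreal (terminal_prob a c1 c2 u) = ennreal (local_const a c1 c2 u) * (\<integral>\<^sup>+p. ennreal (g u p) \<partial>?LL)"
        by (simp add: terminal_prob_def)
    qed
  qed
  then show "((\<lambda>u. ruin_prob L a c1 c2 u / (lambda1 a \<rho> * lambda2 a \<rho> * J * terminal_prob a c1 c2 u)) \<longlongrightarrow> 1) at_top"
    by (simp add: l1_def l2_def)
qed

end

section \<open>Transfer between probability spaces and the theorem\<close>

lemma continuous_process_pair_path: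
  assumes X: "continuous_process M X" and Y: "continuous_process M Y"
  shows "(\<lambda>\<omega>. \<lambda>t\<in>{0..}. (X t \<omega>, Y t \<omega>)) \<in> M \<rightarrow>\<^sub>M Pi\<^sub>M {0..} (\<lambda>_. borel)"
proof (rule measurable_restrict)
  fix t :: real assume "t \<in> {0..}"
  then have [measurable]: "X t \<in> borel_measurable M" "Y t \<in> borel_measurable M"
    using X Y by (auto simp: continuous_process_def)
  show "(\<lambda>\<omega>. (X t \<omega>, Y t \<omega>)) \<in> borel_measurable M" unfolding borel_prod[symmetric] by measurable
qed

text \<open>
  For continuous paths the occupation time is a measurable functional on path space, so its
  distribution depends on the law of the pair only.
\<close>

lemma occupation_prob_of_law:
  fixes X Y :: "real \<Rightarrow> 'a \<Rightarrow> real" and X' Y' :: "real \<Rightarrow> 'b \<Rightarrow> real"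
  assumes law: "pair_process_law M X Y = pair_process_law M' X' Y'"
    and c: "continuous_process M X" "continuous_process M Y" "continuous_process M' X'" "continuous_process M' Y'"
    and S: "S \<in> sets borel" "S \<subseteq> {0..}"
    and P: "Measurable.pred (borel \<Otimes>\<^sub>M borel) (\<lambda>z. P (fst z) (fst (snd z)) (snd (snd z)))"
  shows "measure M {\<omega>\<in>space M. l < (\<integral>\<^sup>+s\<in>S. indicator {s. P s (X s \<omega>) (Y s \<omega>)} s \<partial>lborel)} =
    measure M' {\<omega>\<in>space M'. l < (\<integral>\<^sup>+s\<in>S. indicator {s. P s (X' s \<omega>) (Y' s \<omega>)} s \<partial>lborel)}"
proof -
  define H :: "(real \<times> (real \<times> real) \<times> (real \<times> real)) set" where "H = {z. P (fst z) (fst (fst (snd z))) (snd (fst (snd z)))}"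
  have H: "H \<in> sets (borel \<Otimes>\<^sub>M borel \<Otimes>\<^sub>M borel)"
  proof -
    have "(\<lambda>z. (fst z, fst (snd z))) \<in> borel \<Otimes>\<^sub>M borel \<Otimes>\<^sub>M (borel :: (real \<times> real) measure) \<rightarrow>\<^sub>M (borel :: real measure) \<Otimes>\<^sub>M (borel :: (real \<times> real) measure)" by measurable
    from measurable_compose[OF this P]
    have "Measurable.pred (borel \<Otimes>\<^sub>M borel \<Otimes>\<^sub>M (borel :: (real \<times> real) measure)) (\<lambda>z. P (fst z) (fst (fst (snd z))) (snd (fst (snd z))))" by simp
    then have "{z\<in>space (borel \<Otimes>\<^sub>M borel \<Otimes>\<^sub>M (borel :: (real \<times> real) measure)). P (fst z) (fst (fst (snd z))) (snd (fst (snd z)))} \<in> sets (borel \<Otimes>\<^sub>M borel \<Otimes>\<^sub>M borel)"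
      by (rule predE)
    then show ?thesis by (simp add: H_def space_pair_measure)
  qed
  let ?E = "{w\<in>space (Pi\<^sub>M {0..} (\<lambda>_. borel :: (real \<times> real) measure)). l < occupation S H 0 w}"
  have om: "occupation S H 0 \<in> borel_measurable (Pi\<^sub>M {0..} (\<lambda>_. borel))"
    by (rule measurable_occupation[OF S(1) H]) simp
  have E: "?E \<in> sets (Pi\<^sub>M {0..} (\<lambda>_. borel))" using om by measurable
  have ev: "measure K {\<omega>\<in>space K. l < (\<integral>\<^sup>+s\<in>S. indicator {s. P s (U s \<omega>) (V s \<omega>)} s \<partial>lborel)} = measure (pair_process_law K U V) ?E"
    if U: "continuous_process K U" and V: "continuous_process K V" for K :: "'k measure" and U V
  proof -
    let ?path = "\<lambda>\<omega>. \<lambda>t\<in>{0..}. (U t \<omega>, V t \<omega>)"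
    note pm = continuous_process_pair_path[OF U V]
    have "measure (pair_process_law K U V) ?E = measure K (?path -` ?E \<inter> space K)"
      unfolding pair_process_law_def by (rule measure_distr[OF pm E])
    also have "?path -` ?E \<inter> space K = {\<omega>\<in>space K. l < (\<integral>\<^sup>+s\<in>S. indicator {s. P s (U s \<omega>) (V s \<omega>)} s \<partial>lborel)}"
    proof -
      have "occupation S H 0 (?path \<omega>) = (\<integral>\<^sup>+s\<in>S. indicator {s. P s (U s \<omega>) (V s \<omega>)} s \<partial>lborel)" if w: "\<omega> \<in> space K" for \<omega>
      proof -
        have c: "continuous_on {0..} (\<lambda>t. (U t \<omega>, V t \<omega>))"
          using U V w by (intro continuous_intros) (auto simp: continuous_process_def)
        have "occupation S H 0 (?path \<omega>) = (\<integral>\<^sup>+s. indicator S s * indicator H (s, (U s \<omega>, V s \<omega>), (U 0 \<omega>, V 0 \<omega>)) \<partial>lborel)"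
          by (rule occupation_continuous_path[OF c]) (use S in auto)
        also have "\<dots> = (\<integral>\<^sup>+s\<in>S. indicator {s. P s (U s \<omega>) (V s \<omega>)} s \<partial>lborel)"
          by (intro nn_integral_cong) (simp add: H_def indicator_def)
        finally show ?thesis .
      qed
      then show ?thesis using measurable_space[OF pm] by auto
    qed
    finally show ?thesis ..
  qed
  show ?thesis unfolding ev[OF c(1,2)] ev[OF c(3,4)] law ..
qed

lemma terminal_prob_of_law:
  fixes X Y :: "real \<Rightarrow> 'a \<Rightarrow> real" and X' Y' :: "real \<Rightarrow> 'b \<Rightarrow> real"
  assumes law: "pair_process_law M X Y = pair_process_law M' X' Y'"
    and c: "continuous_process M X" "continuous_process M Y" "continuous_process M' X'" "continuous_process M' Y'"
  shows "measure M {\<omega>\<in>space M. k < X 1 \<omega> \<and> l < Y 1 \<omega>} = measure M' {\<omega>\<in>space M'. k < X' 1 \<omega> \<and> l < Y' 1 \<omega>}"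
proof -
  let ?E = "{w\<in>space (Pi\<^sub>M {0::real..} (\<lambda>_. borel :: (real \<times> real) measure)). k < fst (w 1) \<and> l < snd (w 1)}"
  have "(\<lambda>w. w 1) \<in> Pi\<^sub>M {0::real..} (\<lambda>_. borel :: (real \<times> real) measure) \<rightarrow>\<^sub>M borel \<Otimes>\<^sub>M borel"
    unfolding borel_prod by simp
  note co = measurable_compose[OF this measurable_fst] measurable_compose[OF this measurable_snd]
  note co[measurable]
  have E: "?E \<in> sets (Pi\<^sub>M {0..} (\<lambda>_. borel))" by measurable
  have ev: "measure K {\<omega>\<in>space K. k < U 1 \<omega> \<and> l < V 1 \<omega>} = measure (pair_process_law K U V) ?E"
    if U: "continuous_process K U" and V: "continuous_process K V" for K :: "'k measure" and U V
  proof -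
    note pm = continuous_process_pair_path[OF U V]
    have "measure (pair_process_law K U V) ?E = measure K ((\<lambda>\<omega>. \<lambda>t\<in>{0..}. (U t \<omega>, V t \<omega>)) -` ?E \<inter> space K)"
      unfolding pair_process_law_def by (rule measure_distr[OF pm E])
    also have "(\<lambda>\<omega>. \<lambda>t\<in>{0..}. (U t \<omega>, V t \<omega>)) -` ?E \<inter> space K = {\<omega>\<in>space K. k < U 1 \<omega> \<and> l < V 1 \<omega>}"
      using measurable_space[OF pm] by auto
    finally show ?thesis ..
  qed
  show ?thesis unfolding ev[OF c(1,2)] ev[OF c(3,4)] law ..
qed

context brownian_pair
begin

lemma continuous_process_b:
  "continuous_process Q b1" "continuous_process Q (\<lambda>t q. \<rho> * b1 t q + \<kappa> * b2 t q)"
  unfolding continuous_process_def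
  by (auto intro!: continuous_intros b1_continuous b2_continuous)

text \<open>
  Independence says that the joint law of \<open>(B1, B2)\<close> is a product measure, which is also the law of
  the two motions placed on separate factors of \<open>Q\<close>.
\<close>

lemma pair_process_law_Q:
  assumes ind: "indep_processes N B1 B2"
  shows "pair_process_law N B1 (\<lambda>t \<omega>. \<rho> * B1 t \<omega> + sqrt (1 - \<rho>\<^sup>2) * B2 t \<omega>) =
    pair_process_law Q b1 (\<lambda>t q. \<rho> * b1 t q + \<kappa> * b2 t q)"
proof -
  let ?P = "Pi\<^sub>M {0..} (\<lambda>_. borel :: real measure)" and ?R = "Pi\<^sub>M {0..} (\<lambda>_. borel :: (real \<times> real) measure)"
  let ?p1 = "\<lambda>\<omega>. \<lambda>t\<in>{0..}. B1 t \<omega>" and ?p2 = "\<lambda>\<omega>. \<lambda>t\<in>{0..}. B2 t \<omega>"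
  define \<Phi> where "\<Phi> w = (\<lambda>t\<in>{0..}. (fst w t, \<rho> * fst w t + \<kappa> * snd w t))" for w :: "(real \<Rightarrow> real) \<times> (real \<Rightarrow> real)"
  have \<Phi>: "\<Phi> \<in> ?P \<Otimes>\<^sub>M ?P \<rightarrow>\<^sub>M ?R"
    unfolding \<Phi>_def[abs_def]
  proof (rule measurable_restrict)
    fix t :: real assume t: "t \<in> {0..}"
    have [measurable]: "(\<lambda>w. w t) \<in> borel_measurable ?P" using t by simp
    show "(\<lambda>w. (fst w t, \<rho> * fst w t + \<kappa> * snd w t)) \<in> borel_measurable (?P \<Otimes>\<^sub>M ?P)"
      unfolding borel_prod[symmetric] by measurable
  qed
  from ind have iv: "N.indep_var ?P ?p1 ?P ?p2" by (simp add: indep_processes_def)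
  note m = N.indep_var_rv1[OF iv] N.indep_var_rv2[OF iv]
  interpret D2: prob_space "distr N ?P ?p2" by (rule N.prob_space_distr[OF m(2)])
  have "pair_process_law N B1 (\<lambda>t \<omega>. \<rho> * B1 t \<omega> + sqrt (1 - \<rho>\<^sup>2) * B2 t \<omega>) = distr N ?R (\<lambda>\<omega>. \<Phi> (?p1 \<omega>, ?p2 \<omega>))"
    unfolding pair_process_law_def \<Phi>_def \<kappa>_def by (intro distr_cong) auto
  also have "\<dots> = distr (distr N (?P \<Otimes>\<^sub>M ?P) (\<lambda>\<omega>. (?p1 \<omega>, ?p2 \<omega>))) ?R \<Phi>"
    using m by (subst distr_distr[OF \<Phi>]) (auto simp: comp_def)
  also have "distr N (?P \<Otimes>\<^sub>M ?P) (\<lambda>\<omega>. (?p1 \<omega>, ?p2 \<omega>)) = distr N ?P ?p1 \<Otimes>\<^sub>M distr N ?P ?p2"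
    using iv unfolding N.indep_var_distribution_eq by simp
  also have "\<dots> = distr (N \<Otimes>\<^sub>M N) (?P \<Otimes>\<^sub>M ?P) (\<lambda>(x, y). (?p1 x, ?p2 y))"
    by (rule pair_measure_distr[OF m]) unfold_locales
  also have "distr \<dots> ?R \<Phi> = distr (N \<Otimes>\<^sub>M N) ?R (\<lambda>q. \<Phi> (?p1 (fst q), ?p2 (snd q)))"
    using m by (subst distr_distr[OF \<Phi>]) (auto simp: comp_def case_prod_beta')
  also have "\<dots> = pair_process_law Q b1 (\<lambda>t q. \<rho> * b1 t q + \<kappa> * b2 t q)"
    unfolding pair_process_law_def Q_def \<Phi>_def
    by (intro distr_cong) (auto simp: b1_def b2_def fun_eq_iff max_absorb2)
  finally show ?thesis .
qed

lemma limit_prob1_reflect: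
  "limit_prob1 L (- x) = Q.prob {q\<in>space Q. ennreal L < (\<integral>\<^sup>+t\<in>{0..}. indicator {t. b1 t q - t > x} t \<partial>lborel)}"
proof -
  have "occ1 (- x) q = (\<integral>\<^sup>+t\<in>{0..}. indicator {t. b1 t q - t > x} t \<partial>lborel)" for q
    unfolding occ1_def by (intro nn_integral_cong) (auto simp: indicator_def)
  then show ?thesis by (simp add: limit_prob1_def)
qed

lemma limit_prob2_reflect:
  "limit_prob2 L a (- x) (- y) = Q.prob {q\<in>space Q. ennreal L <
     (\<integral>\<^sup>+t\<in>{0..}. indicator {t. b1 t q - t > x \<and> (\<rho> * b1 t q + \<kappa> * b2 t q) - a * t > y} t \<partial>lborel)}"
proof -
  have "occ2 a (- x) (- y) q = (\<integral>\<^sup>+t\<in>{0..}. indicator {t. b1 t q - t > x \<and> (\<rho> * b1 t q + \<kappa> * b2 t q) - a * t > y} t \<partial>lborel)" for q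
    unfolding occ2_def by (intro nn_integral_cong) (auto simp: indicator_def lim_quadrant_def)
  then show ?thesis by (simp add: limit_prob2_def)
qed

end

lemma nn_integral_lborel_pair_reflect:
  fixes F :: "real \<times> real \<Rightarrow> ennreal"
  assumes F[measurable]: "F \<in> borel_measurable (lborel \<Otimes>\<^sub>M lborel)"
  shows "(\<integral>\<^sup>+p. F (- fst p, - snd p) \<partial>(lborel \<Otimes>\<^sub>M lborel)) = (\<integral>\<^sup>+p. F p \<partial>(lborel \<Otimes>\<^sub>M lborel))"
proof -
  have r: "(\<integral>\<^sup>+x. G (- x) \<partial>lborel) = (\<integral>\<^sup>+x. G x \<partial>lborel)" if "G \<in> borel_measurable borel" for G :: "real \<Rightarrow> ennreal"
    using nn_integral_real_affine[OF that, of "-1" 0] by simp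
  have "(\<lambda>p. F (- fst p, - snd p)) \<in> borel_measurable (lborel \<Otimes>\<^sub>M lborel)" by measurable
  from lborel.nn_integral_fst[OF this]
  have "(\<integral>\<^sup>+p. F (- fst p, - snd p) \<partial>(lborel \<Otimes>\<^sub>M lborel)) = (\<integral>\<^sup>+x. (\<integral>\<^sup>+y. F (- x, - y) \<partial>lborel) \<partial>lborel)" by simp
  also have "\<dots> = (\<integral>\<^sup>+x. (\<integral>\<^sup>+y. F (- x, y) \<partial>lborel) \<partial>lborel)"
    by (intro nn_integral_cong r) measurable
  also have "\<dots> = (\<integral>\<^sup>+x. (\<integral>\<^sup>+y. F (x, y) \<partial>lborel) \<partial>lborel)" by (rule r) measurable
  also have "\<dots> = (\<integral>\<^sup>+p. F p \<partial>(lborel \<Otimes>\<^sub>M lborel))" by (rule lborel.nn_integral_fst[OF F])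
  finally show ?thesis .
qed

text \<open>
  Both probabilities and both constants depend on the law of \<open>(W1, W2)\<close> only and are moved to \<open>Q\<close>. The
  limiting probabilities there are parametrised by excesses, which are the negatives of the levels in
  the constants, hence the reflections.
\<close>

theorem theorem2p2:
  fixes N :: "'b measure" and B1 B2 :: "real \<Rightarrow> 'b \<Rightarrow> real"
    and M :: "'a measure" and W1 W2 :: "real \<Rightarrow> 'a \<Rightarrow> real"
    and \<rho> a c1 c2 L :: real
  assumes "standard_brownian_motion N B1" and "standard_brownian_motion N B2"
    and "indep_processes N B1 B2"
    and "-1 < \<rho>" and "\<rho> < 1"
    and "prob_space M"
    and "continuous_process M W1" and "continuous_process M W2"
    and "pair_process_law M W1 W2 =
           pair_process_law N B1 (\<lambda>t \<omega>. \<rho> * B1 t \<omega> + sqrt (1 - \<rho>\<^sup>2) * B2 t \<omega>)"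
    and "L > 0"
  shows "(\<rho> < a \<and> a \<le> 1 \<longrightarrow>
            0 < parisian_const2 M W1 W2 a \<rho> L \<and> parisian_const2 M W1 W2 a \<rho> L < \<infinity> \<and>
            ((\<lambda>u. cumulative_parisian_ruin_prob M W1 W2 c1 c2 L u (a * u) /
                   (enn2real (parisian_const2 M W1 W2 a \<rho> L) *
                    terminal_exceedance_prob M W1 W2 c1 c2 u (a * u))) \<longlongrightarrow> 1) at_top) \<and>
         (a \<le> \<rho> \<longrightarrow>
            0 < parisian_const1 M W1 L \<and> parisian_const1 M W1 L < \<infinity> \<and>
            ((\<lambda>u. cumulative_parisian_ruin_prob M W1 W2 c1 c2 L u (a * u) /
                   (enn2real (parisian_const1 M W1 L) *
                    terminal_exceedance_prob M W1 W2 c1 c2 u (a * u))) \<longlongrightarrow> 1) at_top)"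
proof -
  interpret brownian_pair N B1 B2 \<rho> using assms by unfold_locales
  let ?b = "\<lambda>t q. \<rho> * b1 t q + \<kappa> * b2 t q"
  have law: "pair_process_law M W1 W2 = pair_process_law Q b1 ?b"
    using assms(9) pair_process_law_Q[OF assms(3)] by simp
  note occ = occupation_prob_of_law[OF law assms(7,8) continuous_process_b]
  have ruin: "cumulative_parisian_ruin_prob M W1 W2 c1 c2 L u (a * u) = ruin_prob L a c1 c2 u" for u
  proof -
    have "Measurable.pred (borel \<Otimes>\<^sub>M borel) (\<lambda>z :: real \<times> real \<times> real. u < fst (snd z) - c1 * fst z \<and> a * u < snd (snd z) - c2 * fst z)"
      unfolding borel_prod[symmetric] by measurable
    note occ[OF _ _ this, of "{0..1}" "ennreal (L / u\<^sup>2)"]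
    moreover have "u + c1 * t - W1 t \<omega> < 0 \<and> a * u + c2 * t - W2 t \<omega> < 0 \<longleftrightarrow> u < W1 t \<omega> - c1 * t \<and> a * u < W2 t \<omega> - c2 * t" for t \<omega>
      by linarith
    ultimately show ?thesis
      unfolding cumulative_parisian_ruin_prob_def ruin_prob_def risk_process_def by simp
  qed
  have terminal: "terminal_exceedance_prob M W1 W2 c1 c2 u (a * u) = terminal_prob a c1 c2 u" for u
    using terminal_prob_of_law[OF law assms(7,8) continuous_process_b, of "u + c1" "a * u + c2"]
    unfolding terminal_exceedance_prob_def terminal_prob_def drifted_def by (simp add: less_diff_eq)
  have p1: "measure M {\<omega>\<in>space M. (\<integral>\<^sup>+t\<in>{0..}. indicator {t. W1 t \<omega> - t > x} t \<partial>lborel) > ennreal L} = limit_prob1 L (- x)" for x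
  proof -
    have "Measurable.pred (borel \<Otimes>\<^sub>M borel) (\<lambda>z :: real \<times> real \<times> real. fst (snd z) - fst z > x)"
      unfolding borel_prod[symmetric] by measurable
    note occ[OF _ _ this, of "{0..}" "ennreal L"]
    then show ?thesis unfolding limit_prob1_reflect by simp
  qed
  have p2: "measure M {\<omega>\<in>space M. (\<integral>\<^sup>+t\<in>{0..}. indicator {t. W1 t \<omega> - t > x \<and> W2 t \<omega> - a * t > y} t \<partial>lborel) > ennreal L} =
      limit_prob2 L a (- x) (- y)" for x y
  proof -
    have "Measurable.pred (borel \<Otimes>\<^sub>M borel) (\<lambda>z :: real \<times> real \<times> real. fst (snd z) - fst z > x \<and> snd (snd z) - a * fst z > y)"
      unfolding borel_prod[symmetric] by measurable
    note occ[OF _ _ this, of "{0..}" "ennreal L"]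
    then show ?thesis unfolding limit_prob2_reflect by simp
  qed
  show ?thesis
  proof (intro conjI impI)
    assume a: "\<rho> < a \<and> a \<le> 1"
    define J where "J = (LINT p|(lborel \<Otimes>\<^sub>M lborel). exp (- lambda1 a \<rho> * fst p - lambda2 a \<rho> * snd p) * limit_prob2 L a (fst p) (snd p))"
    note two = parisian_two_coordinates[OF assms(10), of a, folded J_def]
    have l: "0 < lambda1 a \<rho>" "0 < lambda2 a \<rho>" using lambda_pos a by auto
    let ?F = "\<lambda>p. ennreal (exp (- lambda1 a \<rho> * fst p - lambda2 a \<rho> * snd p) * limit_prob2 L a (fst p) (snd p))"
    have "parisian_const2 M W1 W2 a \<rho> L = ennreal (lambda1 a \<rho> * lambda2 a \<rho>) * (\<integral>\<^sup>+p. ?F (- fst p, - snd p) \<partial>lborel)"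
      unfolding parisian_const2_def p2
      by (intro arg_cong2[where f="(*)"] refl nn_integral_cong) (simp add: case_prod_beta' mult.commute)
    also have "(\<integral>\<^sup>+p. ?F (- fst p, - snd p) \<partial>lborel) = (\<integral>\<^sup>+p. ?F (- fst p, - snd p) \<partial>(lborel \<Otimes>\<^sub>M lborel))"
      by (simp only: lborel_prod)
    also have "\<dots> = (\<integral>\<^sup>+p. ?F p \<partial>(lborel \<Otimes>\<^sub>M lborel))"
      by (rule nn_integral_lborel_pair_reflect) measurable
    also have "\<dots> = ennreal J"
      unfolding J_def by (rule nn_integral_eq_integral) (use two(1) a in \<open>auto simp: limit_prob2_def\<close>)
    finally have c: "parisian_const2 M W1 W2 a \<rho> L = ennreal (lambda1 a \<rho> * lambda2 a \<rho> * J)"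
      using l two(2) a by (simp add: ennreal_mult)
    show "0 < parisian_const2 M W1 W2 a \<rho> L" "parisian_const2 M W1 W2 a \<rho> L < \<infinity>"
      using l two(2) a by (simp_all add: c)
    show "((\<lambda>u. cumulative_parisian_ruin_prob M W1 W2 c1 c2 L u (a * u) /
                   (enn2real (parisian_const2 M W1 W2 a \<rho> L) *
                    terminal_exceedance_prob M W1 W2 c1 c2 u (a * u))) \<longlongrightarrow> 1) at_top"
      unfolding c ruin terminal using two(2) two(3)[of c1 c2] l a by simp
  next
    assume a: "a \<le> \<rho>"
    define K where "K = (LINT x|lborel. exp (- x) * limit_prob1 L x)"
    note one = parisian_one_coordinate[OF assms(10) a, folded K_def]
    have "parisian_const1 M W1 L = (\<integral>\<^sup>+x. ennreal (exp (- (0 + - 1 * x)) * limit_prob1 L (0 + - 1 * x)) \<partial>lborel)"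
      unfolding parisian_const1_def p1 by simp
    also have "\<dots> = (\<integral>\<^sup>+x. ennreal (exp (- x) * limit_prob1 L x) \<partial>lborel)"
      by (subst nn_integral_real_affine[where c="-1" and t=0 and f="\<lambda>x. ennreal (exp (- x) * limit_prob1 L x)"]) simp_all
    also have "\<dots> = ennreal K"
      unfolding K_def by (rule nn_integral_eq_integral) (use one(1) in \<open>auto simp: limit_prob1_def\<close>)
    finally have c: "parisian_const1 M W1 L = ennreal K" .
    show "0 < parisian_const1 M W1 L" "parisian_const1 M W1 L < \<infinity>" using one(2) by (simp_all add: c)
    show "((\<lambda>u. cumulative_parisian_ruin_prob M W1 W2 c1 c2 L u (a * u) /
                   (enn2real (parisian_const1 M W1 L) *
                    terminal_exceedance_prob M W1 W2 c1 c2 u (a * u))) \<longlongrightarrow> 1) at_top"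
      unfolding c ruin terminal using one(2) one(3)[of c1 c2] by simp
  qed
qed

end
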